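(* If the class $C(m_n)$ is not quasianalytic, then there exists a Riemannian $C(m_n)$-manifold $M$ without boundary such that the geodesic flow on $M$ satisfies the following conditions: (1) for some $T>0$ the set $\Pi^a_T$ has positive measure; (2) there are nonperiodic trajectories; moreover, $S^*M\setminus\Pi$ is a set of positive measure.
   Context: **Carleman classes.** $\{m_n\}_{n\ge1}$ is a nondecreasing sequence of positive numbers such that (1) $m_n$ grows faster than any power of $n$; (2) $m_{n+1}/m_n\le n\,C^n$ for some constant $C>0$; (3) the sequence $\ln(m_n/n!)$ is convex in $n$. For a bounded domain $D\subset\mathbb R^N$, $C(m_n,D)$ is the set of $u\in C^\infty(D)$ for which there is a constant $C>0$ (depending on $u$) with $\sup_{D}|\partial^\alpha u|\le C^{|\alpha|}m_{|\alpha|}$ for all $|\alpha|\ge1$. A function $u$ belongs to $C(m_n)$ if $u\in C(m_n,D)$ for every relatively compact open subset $D$ of its domain of definition. The class is closed under composition; a $C(m_n)$-manifold is a smooth manifold with an atlas whose transition maps are of class $C(m_n)$; a Riemannian $C(m_n)$-manifold is a $C(m_n)$-manifold with a Riemannian metric whose coefficients in such charts are of class $C(m_n)$. The class $C(m_n)$ is quasianalytic if every $u\in C(m_n)$ (on a connected domain) having a zero of infinite order is identically zero. **Geodesic flow.** Let $h(x,\xi)=|\xi|_x$ be the Riemannian length of the covector $\xi\in T^*_xM$, $T'M=\{(x,\xi)\in T^*M:\xi\neq0\}$, $S^*M=\{(x,\xi)\in T'M: h(x,\xi)=1\}$. The geodesic flow is the Hamiltonian flow $(y,\eta)\mapsto(x^*(t;y,\eta),\xi^*(t;y,\eta))$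 of $h$ on $T'M$: $\dot x^*=h_\xi(x^*,\xi^* )$, $\dot\xi^*=-h_x(x^*,\xi^* )$ with initial point $(y,\eta)$ at $t=0$. Measure on $S^*M$ is the natural one induced by the canonical measure $dx\,d\xi$ on $T^*M$. **Periodicity.** For $T>0$, a point $(y_0,\eta_0)\in T'M$ and the trajectory starting at it are $T$-periodic if $(x^*(T;y_0,\eta_0),\xi^*(T;y_0,\eta_0))=(y_0,\eta_0)$, periodic if $T$-periodic for some $T>0$, and absolutely $T$-periodic if (in local coordinates) the function $(y,\eta)\mapsto|x^*(T;y,\eta)-y|^2+|\xi^*(T;y,\eta)-\eta|^2$ on $T'M$ has a zero of infinite order at $(y_0,\eta_0)$. $\Pi$ and $\Pi^a_T$ are the sets of periodic and of absolutely $T$-periodic points lying in $S^*M$. *)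

theory Defs
  imports "HOL-Analysis.Analysis"
begin

text \<open>
  Since dimensions are quantified over, \<open>\<real>^N\<close> is the library space \<^term>\<open>Euclidean_space N\<close>, whose
  points are the functions \<^typ>\<open>nat \<Rightarrow> real\<close> that vanish at all indices \<open>\<ge> N\<close>.
\<close>

type_synonym coord = "nat \<Rightarrow> real"

definition partial_deriv :: "nat \<Rightarrow> (coord \<Rightarrow> real) \<Rightarrow> coord \<Rightarrow> real" where
  "partial_deriv i u x = deriv (\<lambda>t. u (x(i := t))) (x i)"

text \<open>
  A derivative \<open>\<partial>^\<alpha>\<close> is given by the list of the directions of differentiation, so \<open>|\<alpha>|\<close> is the
  length of the list; for smooth functions the order in the list is immaterial.
\<close>

primrec partial_derivs :: "nat list \<Rightarrow> (coord \<Rightarrow> real) \<Rightarrow> coord \<Rightarrow> real" where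
  "partial_derivs [] u = u"
| "partial_derivs (i # is) u = partial_deriv i (partial_derivs is u)"

text \<open>Used for open \<open>D\<close> only: then the values of \<open>u\<close> outside \<open>D\<close> play no role.\<close>

definition smooth_on :: "nat \<Rightarrow> coord set \<Rightarrow> (coord \<Rightarrow> real) \<Rightarrow> bool" where
  "smooth_on N D u \<longleftrightarrow>
     (\<forall>is. set is \<subseteq> {..<N} \<longrightarrow>
        continuous_map (subtopology (Euclidean_space N) D) euclideanreal (partial_derivs is u) \<and>
        (\<forall>i<N. \<forall>x\<in>D. (\<lambda>t. partial_derivs is u (x(i := t))) differentiable (at (x i))))"

definition infinite_order_zero :: "nat \<Rightarrow> (coord \<Rightarrow> real) \<Rightarrow> coord \<Rightarrow> bool" where
  "infinite_order_zero N u x \<longleftrightarrow>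
     (\<exists>D. openin (Euclidean_space N) D \<and> x \<in> D \<and> smooth_on N D u) \<and>
     (\<forall>is. set is \<subseteq> {..<N} \<longrightarrow> partial_derivs is u x = 0)"


section \<open>Carleman classes\<close>

text \<open>Only the terms \<open>m n\<close> with \<open>n \<ge> 1\<close> matter.\<close>

definition carleman_sequence :: "(nat \<Rightarrow> real) \<Rightarrow> bool" where
  "carleman_sequence m \<longleftrightarrow>
     (\<forall>n\<ge>1. 0 < m n) \<and>
     (\<forall>n\<ge>1. m n \<le> m (Suc n)) \<and>
     (\<forall>k::nat. (\<lambda>n. real n ^ k / m n) \<longlonglongrightarrow> 0) \<and>
     (\<exists>C>0. \<forall>n\<ge>1. m (Suc n) / m n \<le> real n * C ^ n) \<and>
     (\<forall>n\<ge>1. 2 * ln (m (n + 1) / fact (n + 1)) \<le> ln (m n / fact n) + ln (m (n + 2) / fact (n + 2)))"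

text \<open>The class \<open>C(m\<^sub>n, D)\<close> for a bounded open set \<open>D\<close>.\<close>

definition carleman_bounded :: "(nat \<Rightarrow> real) \<Rightarrow> nat \<Rightarrow> coord set \<Rightarrow> (coord \<Rightarrow> real) \<Rightarrow> bool" where
  "carleman_bounded m N D u \<longleftrightarrow>
     smooth_on N D u \<and>
     (\<exists>C>0. \<forall>is. set is \<subseteq> {..<N} \<and> 1 \<le> length is \<longrightarrow>
        (\<forall>x\<in>D. \<bar>partial_derivs is u x\<bar> \<le> C ^ length is * m (length is)))"

text \<open>The class \<open>C(m\<^sub>n)\<close> of functions with the open domain of definition \<open>D\<close>.\<close>

definition carleman_class :: "(nat \<Rightarrow> real) \<Rightarrow> nat \<Rightarrow> coord set \<Rightarrow> (coord \<Rightarrow> real) \<Rightarrow> bool" where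
  "carleman_class m N D u \<longleftrightarrow>
     (\<forall>D'. openin (Euclidean_space N) D' \<and>
           compactin (Euclidean_space N) (Euclidean_space N closure_of D') \<and>
           Euclidean_space N closure_of D' \<subseteq> D \<longrightarrow> carleman_bounded m N D' u)"

definition quasianalytic :: "(nat \<Rightarrow> real) \<Rightarrow> bool" where
  "quasianalytic m \<longleftrightarrow>
     (\<forall>N D u x. openin (Euclidean_space N) D \<and> connectedin (Euclidean_space N) D \<and>
        carleman_class m N D u \<and> x \<in> D \<and> infinite_order_zero N u x \<longrightarrow> (\<forall>y\<in>D. u y = 0))"


section \<open>Riemannian manifolds of Carleman class\<close>

text \<open>
  A chart is a pair of its domain and its coordinate map; the values of the coordinate map outside
  the domain are irrelevant.
\<close>

type_synonym 'a chart = "'a set \<times> ('a \<Rightarrow> coord)"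

text \<open>
  The field \<open>metric\<close> gives, for every chart \<open>c\<close> of the atlas and every coordinate vector \<open>x\<close> in the
  range of \<open>c\<close>, the coefficients \<open>g\<^sub>i\<^sub>j(x)\<close> for \<open>i, j < dim\<close>.
\<close>

record 'a rmanifold =
  mdim :: nat
  mtop :: "'a topology"
  atlas :: "'a chart set"
  metric :: "'a chart \<Rightarrow> coord \<Rightarrow> nat \<Rightarrow> nat \<Rightarrow> real"

definition is_chart :: "nat \<Rightarrow> 'a topology \<Rightarrow> 'a chart \<Rightarrow> bool" where
  "is_chart n X c \<longleftrightarrow>
     openin X (fst c) \<and> openin (Euclidean_space n) (snd c ` fst c) \<and>
     homeomorphic_map (subtopology X (fst c)) (subtopology (Euclidean_space n) (snd c ` fst c)) (snd c)"

text \<open>From \<open>c\<close>-coordinates to \<open>d\<close>-coordinates, meaningful on \<open>snd c ` (fst c \<inter> fst d)\<close>.\<close>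

definition transition :: "'a chart \<Rightarrow> 'a chart \<Rightarrow> coord \<Rightarrow> coord" where
  "transition c d x = snd d (inv_into (fst c) (snd c) x)"

text \<open>\<open>\<partial>y\<^sub>k/\<partial>x\<^sub>i\<close> at \<open>x\<close>, with \<open>x\<close> the coordinates of \<open>c\<close> and \<open>y\<close> those of \<open>d\<close>.\<close>

definition jacobian :: "'a chart \<Rightarrow> 'a chart \<Rightarrow> coord \<Rightarrow> nat \<Rightarrow> nat \<Rightarrow> real" where
  "jacobian c d x k i = partial_deriv i (\<lambda>x'. transition c d x' k) x"

text \<open>Charts map to open subsets of \<open>\<real>\<^sup>n\<close>, so the manifold has no boundary.\<close>

definition carleman_manifold :: "(nat \<Rightarrow> real) \<Rightarrow> 'a rmanifold \<Rightarrow> bool" where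
  "carleman_manifold m M \<longleftrightarrow>
     Hausdorff_space (mtop M) \<and> second_countable (mtop M) \<and> connected_space (mtop M) \<and>
     (\<forall>c\<in>atlas M. is_chart (mdim M) (mtop M) c) \<and>
     (\<Union>c\<in>atlas M. fst c) = topspace (mtop M) \<and>
     (\<forall>c\<in>atlas M. \<forall>d\<in>atlas M. \<forall>k<mdim M.
        carleman_class m (mdim M) (snd c ` (fst c \<inter> fst d)) (\<lambda>x. transition c d x k))"

definition carleman_metric :: "(nat \<Rightarrow> real) \<Rightarrow> 'a rmanifold \<Rightarrow> bool" where
  "carleman_metric m M \<longleftrightarrow>
     (let n = mdim M; g = metric M in
      (\<forall>c\<in>atlas M.
         (\<forall>i<n. \<forall>j<n. carleman_class m n (snd c ` fst c) (\<lambda>x. g c x i j)) \<and>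
         (\<forall>x\<in>snd c ` fst c.
            (\<forall>i<n. \<forall>j<n. g c x i j = g c x j i) \<and>
            (\<forall>v::coord. (\<exists>i<n. v i \<noteq> 0) \<longrightarrow> 0 < (\<Sum>i<n. \<Sum>j<n. g c x i j * v i * v j)))) \<and>
      (\<forall>c\<in>atlas M. \<forall>d\<in>atlas M. \<forall>x\<in>snd c ` (fst c \<inter> fst d). \<forall>i<n. \<forall>j<n.
         g c x i j =
           (\<Sum>k<n. \<Sum>l<n. jacobian c d x k i * jacobian c d x l j * g d (transition c d x) k l)))"

definition riemannian_carleman_manifold :: "(nat \<Rightarrow> real) \<Rightarrow> 'a rmanifold \<Rightarrow> bool" where
  "riemannian_carleman_manifold m M \<longleftrightarrow> carleman_manifold m M \<and> carleman_metric m M"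


section \<open>The cotangent bundle\<close>

text \<open>
  A covector at \<open>p\<close> is the family of its coordinate vectors in all charts around \<open>p\<close>, obeying the
  transformation law \<open>\<xi>\<^sub>i = \<Sum>\<^sub>k \<partial>y\<^sub>k/\<partial>x\<^sub>i \<eta>\<^sub>k\<close>. Off these charts the family is set to \<open>0\<close>, so
  that equality of pairs is equality of points of the cotangent bundle.
\<close>

type_synonym 'a cpoint = "'a \<times> ('a chart \<Rightarrow> coord)"

definition cotangent :: "'a rmanifold \<Rightarrow> 'a cpoint set" where
  "cotangent M = {(p, \<omega>). p \<in> topspace (mtop M) \<and>
     (\<forall>c. \<not> (c \<in> atlas M \<and> p \<in> fst c) \<longrightarrow> \<omega> c = (\<lambda>_. 0)) \<and>
     (\<forall>c\<in>atlas M. p \<in> fst c \<longrightarrow> \<omega> c \<in> topspace (Euclidean_space (mdim M))) \<and>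
     (\<forall>c\<in>atlas M. \<forall>d\<in>atlas M. p \<in> fst c \<and> p \<in> fst d \<longrightarrow>
        (\<forall>i<mdim M. \<omega> c i = (\<Sum>k<mdim M. jacobian c d (snd c p) k i * \<omega> d k)))}"

definition cotangent_nz :: "'a rmanifold \<Rightarrow> 'a cpoint set" where
  "cotangent_nz M = {z \<in> cotangent M. snd z \<noteq> (\<lambda>_ _. 0)}"

definition inverse_mat :: "nat \<Rightarrow> (nat \<Rightarrow> nat \<Rightarrow> real) \<Rightarrow> nat \<Rightarrow> nat \<Rightarrow> real" where
  "inverse_mat n G = (THE H.
     (\<forall>i j. i \<ge> n \<or> j \<ge> n \<longrightarrow> H i j = 0) \<and>
     (\<forall>i<n. \<forall>j<n. (\<Sum>k<n. G i k * H k j) = (if i = j then 1 else 0)))"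

text \<open>The function \<open>h(x, \<xi>) = |\<xi>|\<^sub>x\<close> in the coordinates of \<open>c\<close>.\<close>

definition hamiltonian :: "'a rmanifold \<Rightarrow> 'a chart \<Rightarrow> coord \<Rightarrow> coord \<Rightarrow> real" where
  "hamiltonian M c x \<xi> =
     sqrt (\<Sum>i<mdim M. \<Sum>j<mdim M. inverse_mat (mdim M) (metric M c x) i j * \<xi> i * \<xi> j)"

definition cosphere :: "'a rmanifold \<Rightarrow> 'a cpoint set" where
  "cosphere M = {(p, \<omega>) \<in> cotangent_nz M.
     \<forall>c\<in>atlas M. p \<in> fst c \<longrightarrow> hamiltonian M c (snd c p) (\<omega> c) = 1}"

text \<open>Coordinates \<open>(x, \<xi>) \<in> \<real>\<^sup>2\<^sup>n\<close> on the part of the bundle over the domain of \<open>c\<close>.\<close>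

definition bundle_coords :: "'a rmanifold \<Rightarrow> 'a chart \<Rightarrow> 'a cpoint \<Rightarrow> coord" where
  "bundle_coords M c z = (\<lambda>i. if i < mdim M then snd c (fst z) i
     else if i < 2 * mdim M then snd z c (i - mdim M) else 0)"

definition bundle_point :: "'a rmanifold \<Rightarrow> 'a chart \<Rightarrow> coord \<Rightarrow> 'a cpoint" where
  "bundle_point M c = inv_into {z \<in> cotangent_nz M. fst z \<in> fst c} (bundle_coords M c)"


section \<open>Measure on the cosphere bundle\<close>

definition lebesgue_Rn :: "nat \<Rightarrow> coord measure" where
  "lebesgue_Rn N = distr (Pi\<^sub>M {..<N} (\<lambda>_. lborel)) borel (\<lambda>x i. if i < N then x i else 0)"

definition unit_cone :: "'a cpoint set \<Rightarrow> 'a cpoint set" where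
  "unit_cone B = {(p, \<lambda>c i. t * \<omega> c i) | p \<omega> t. (p, \<omega>) \<in> B \<and> 0 < t \<and> t \<le> 1}"

text \<open>
  The measure \<open>\<mu>\<close> on \<open>{h = 1}\<close> induced by \<open>dx d\<xi>\<close> is given by \<open>dx d\<xi> = dh d\<mu>\<close>. As \<open>h\<close> is homogeneous
  of degree 1 in \<open>\<xi>\<close>, in polar form \<open>dx d\<xi> = r\<^sup>n\<^sup>-\<^sup>1 dr d\<mu>\<close> with \<open>r = h\<close>, so that the cone over \<open>B\<close>
  has the volume \<open>\<mu>(B)/n\<close>. The predicate determines \<open>\<mu>\<close> uniquely, because \<open>M\<close> is covered by
  countably many chart domains. Its sigma-algebra is that of the Borel sets.
\<close>

definition liouville_measure :: "'a rmanifold \<Rightarrow> 'a cpoint measure \<Rightarrow> bool" where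
  "liouville_measure M \<mu> \<longleftrightarrow>
     space \<mu> = cosphere M \<and>
     sets \<mu> = sigma_sets (cosphere M)
       {B. B \<subseteq> cosphere M \<and>
           (\<exists>c\<in>atlas M. fst ` B \<subseteq> fst c \<and> bundle_coords M c ` B \<in> sets borel)} \<and>
     (\<forall>c\<in>atlas M. \<forall>B\<in>sets \<mu>. fst ` B \<subseteq> fst c \<longrightarrow>
        emeasure \<mu> B = of_nat (mdim M) *
          emeasure (lebesgue_Rn (2 * mdim M)) (bundle_coords M c ` unit_cone B))"


section \<open>Geodesic flow and periodicity\<close>

text \<open>
  \<open>\<Phi> t z\<close> is the point \<open>(x\<^sup>*(t; z), \<xi>\<^sup>*(t; z))\<close>; it is required to exist for all real \<open>t\<close>. Continuity
  of the projected trajectory makes Hamilton's equations in charts meaningful: near \<open>t\<close> the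
  trajectory stays over the domain of the chart.
\<close>

definition geodesic_flow :: "'a rmanifold \<Rightarrow> (real \<Rightarrow> 'a cpoint \<Rightarrow> 'a cpoint) \<Rightarrow> bool" where
  "geodesic_flow M \<Phi> \<longleftrightarrow> (\<forall>z\<in>cotangent_nz M.
     \<Phi> 0 z = z \<and>
     (\<forall>t. \<Phi> t z \<in> cotangent_nz M) \<and>
     continuous_map euclideanreal (mtop M) (\<lambda>t. fst (\<Phi> t z)) \<and>
     (\<forall>t. \<forall>c\<in>atlas M. fst (\<Phi> t z) \<in> fst c \<longrightarrow>
        (let x = (\<lambda>s. snd c (fst (\<Phi> s z))); \<xi> = (\<lambda>s. snd (\<Phi> s z) c) in
         \<forall>i<mdim M.
           ((\<lambda>s. x s i) has_real_derivative
              partial_deriv i (\<lambda>\<xi>'. hamiltonian M c (x t) \<xi>') (\<xi> t)) (at t) \<and>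
           ((\<lambda>s. \<xi> s i) has_real_derivative
              - partial_deriv i (\<lambda>x'. hamiltonian M c x' (\<xi> t)) (x t)) (at t))))"

definition T_periodic :: "(real \<Rightarrow> 'a cpoint \<Rightarrow> 'a cpoint) \<Rightarrow> real \<Rightarrow> 'a cpoint \<Rightarrow> bool" where
  "T_periodic \<Phi> T z \<longleftrightarrow> \<Phi> T z = z"

definition periodic :: "(real \<Rightarrow> 'a cpoint \<Rightarrow> 'a cpoint) \<Rightarrow> 'a cpoint \<Rightarrow> bool" where
  "periodic \<Phi> z \<longleftrightarrow> (\<exists>T>0. T_periodic \<Phi> T z)"

text \<open>
  The function \<open>|x\<^sup>*(T; y, \<eta>) - y|\<^sup>2 + |\<xi>\<^sup>*(T; y, \<eta>) - \<eta>|\<^sup>2\<close> in the coordinates \<open>w = (y, \<eta>)\<close>; it makes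
  sense near a \<open>T\<close>-periodic point over the domain of \<open>c\<close>.
\<close>

definition displacement ::
  "'a rmanifold \<Rightarrow> (real \<Rightarrow> 'a cpoint \<Rightarrow> 'a cpoint) \<Rightarrow> 'a chart \<Rightarrow> real \<Rightarrow> coord \<Rightarrow> real" where
  "displacement M \<Phi> c T w =
     (\<Sum>i<2 * mdim M. (bundle_coords M c (\<Phi> T (bundle_point M c w)) i - w i)\<^sup>2)"

text \<open>
  The first conjunct, implied by a zero of the displacement, only secures that \<open>\<Phi> T z\<close> lies over the
  domain of the chart in use.
\<close>

definition absolutely_periodic ::
  "'a rmanifold \<Rightarrow> (real \<Rightarrow> 'a cpoint \<Rightarrow> 'a cpoint) \<Rightarrow> real \<Rightarrow> 'a cpoint \<Rightarrow> bool" where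
  "absolutely_periodic M \<Phi> T z \<longleftrightarrow>
     T_periodic \<Phi> T z \<and>
     (\<forall>c\<in>atlas M. fst z \<in> fst c \<longrightarrow>
        infinite_order_zero (2 * mdim M) (displacement M \<Phi> c T) (bundle_coords M c z))"

definition periodic_set :: "'a rmanifold \<Rightarrow> (real \<Rightarrow> 'a cpoint \<Rightarrow> 'a cpoint) \<Rightarrow> 'a cpoint set" where
  "periodic_set M \<Phi> = {z \<in> cosphere M. periodic \<Phi> z}"

definition absolutely_periodic_set ::
  "'a rmanifold \<Rightarrow> (real \<Rightarrow> 'a cpoint \<Rightarrow> 'a cpoint) \<Rightarrow> real \<Rightarrow> 'a cpoint set" where
  "absolutely_periodic_set M \<Phi> T = {z \<in> cosphere M. absolutely_periodic M \<Phi> T z}"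

text \<open>A non-measurable set has \<^const>\<open>emeasure\<close> \<open>0\<close>, so this entails measurability.\<close>

definition positive_measure :: "'a measure \<Rightarrow> 'a set \<Rightarrow> bool" where
  "positive_measure \<mu> S \<longleftrightarrow> 0 < emeasure (completion \<mu>) S"

end

theory Submission
  imports Defs
begin

text \<open>
  The manifold is the plane, covered by the single chart \<open>id\<close>, with a conformal metric
  \<open>G |dx|\<^sup>2\<close>, \<open>G > 0\<close>. By the principle of Maupertuis its geodesics of unit speed are, after the
  change of time \<open>ds = G d\<tau>\<close>, the trajectories of Newton's equation \<open>x'' = \<nabla>G / 2\<close> with
  \<open>|x'|\<^sup>2 = G\<close>. Where \<open>G = 1 - |x|\<^sup>2\<close>, this is the harmonic oscillator: the trajectories are
  ellipses with the common period \<open>2\<pi>\<close> in the time \<open>\<tau>\<close>, and all these ellipses have the same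
  Riemannian length \<open>\<pi>\<close>. So if \<open>G = 1 - |x|\<^sup>2\<close> on a neighbourhood of the circle
  \<open>|x|\<^sup>2 = 1/2\<close> and of its inside, then the geodesics near this circular orbit form an open set of
  trajectories of period \<open>\<pi>\<close>, and the displacement vanishes identically near each of them
  (\<open>geo_elliptic\<close>). If moreover \<open>G\<close> is constant on a sector at infinity, the geodesics that run
  outwards in that sector are straight half-lines and never return (\<open>geo_escaping\<close>). Both sets of
  initial points are open and nonempty, so that they have positive measure
  (\<open>positive_measure_region\<close>). No analytic \<open>G\<close> has both properties; this is where the failure of
  quasianalyticity is used.

  The function \<open>G\<close> is a sum of three plane waves \<open>q (u\<^sub>k \<bullet> x)\<close> whose directions \<open>u\<^sub>k\<close> are the
  normals to the sides of a regular hexagon. As \<open>\<Sum> (u\<^sub>k \<bullet> x)\<^sup>2 = 3/2 |x|\<^sup>2\<close>, the profile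
  \<open>q(t) = 1/3 - 2/3 t\<^sup>2\<close> gives \<open>1 - |x|\<^sup>2\<close>, and it suffices to change this profile for
  \<open>|t| > 3/4\<close>, outside the circle of radius \<open>1/\<surd>2\<close>, so that it becomes \<open>1\<close> for \<open>|t| \<ge> 4/5\<close>.
  The hexagon \<open>|u\<^sub>k \<bullet> x| \<le> 4/5\<close> lies inside the unit disc, and this keeps \<open>G\<close> positive
  (\<open>G_lower\<close>). The derivative \<open>\<partial>\<^sup>\<alpha>\<close> of a plane wave is the derivative of order \<open>|\<alpha>|\<close> of its
  profile, times a product of components of \<open>u\<^sub>k\<close>; hence \<open>G\<close> inherits the Carleman bounds of \<open>q\<close>, a
  function of one variable (\<open>carleman_class_ridge\<close>).

  To get \<open>q\<close> (\<open>oscillator_profile\<close>), start from a function of \<open>N\<close> variables that has a zero of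
  infinite order without vanishing near it. Moving away from the zero by changing one coordinate
  at a time, one finds a coordinate line on which some partial derivative is flat at one point and
  nonzero at another (\<open>flat_line_function\<close>). Products of this function \<open>f\<close> with its reflection
  give a bump, the integral of the bump gives a smooth step, and two steps give a plateau. These
  operations stay in the class: products because \<open>m\<^sub>n / n!\<close> is log-convex (\<open>m_binomial\<close>), and
  derivatives because of the growth condition on \<open>m\<^sub>n\<^sub>+\<^sub>1 / m\<^sub>n\<close> (\<open>m_shift\<close>).

  It remains to treat the other trajectories. Because \<open>\<nabla>G\<close> is globally Lipschitz and \<open>G \<ge> 1/10\<close>,
  Newton's equation has global solutions by Picard iteration and the geodesics are complete. The
  measure conditions include measurability. The Newtonian flow is continuous in time and initial
  point jointly, and therefore the periodic points form a countable union of closed sets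
  (\<open>borel_periodic\<close>). The absolutely periodic points form a Borel set for a general reason: the
  zeros of infinite order of any function do, because all derivatives are continuous on the union
  of the open sets on which the function is smooth (\<open>borel_infinite_order_zero\<close>).
\<close>

section \<open>Carleman bounds in one variable\<close>

text \<open>
  Pascal's rule, in the form in which it is the induction step for the derivatives of a product.
\<close>

lemma sum_choose_Suc:
  fixes a :: "nat \<Rightarrow> nat \<Rightarrow> real"
  shows "(\<Sum>k\<le>Suc n. of_nat (Suc n choose k) * a k (Suc n - k)) =
    (\<Sum>k\<le>n. of_nat (n choose k) * (a (Suc k) (n - k) + a k (Suc (n - k))))"
proof -
  have "(\<Sum>k\<le>Suc n. of_nat (Suc n choose k) * a k (Suc n - k)) =
      a 0 (Suc n) + (\<Sum>k\<le>n. of_nat (Suc n choose Suc k) * a (Suc k) (n - k))"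
    by (subst sum.atMost_Suc_shift) simp
  also have "\<dots> = (\<Sum>k\<le>n. of_nat (n choose k) * a (Suc k) (n - k)) +
      (a 0 (Suc n) + (\<Sum>k\<le>n. of_nat (n choose Suc k) * a (Suc k) (n - k)))"
    by (simp add: algebra_simps sum.distrib)
  also have "a 0 (Suc n) + (\<Sum>k\<le>n. of_nat (n choose Suc k) * a (Suc k) (n - k)) =
      (\<Sum>k\<le>Suc n. of_nat (n choose k) * a k (Suc n - k))"
    by (subst sum.atMost_Suc_shift) simp
  also have "\<dots> = (\<Sum>k\<le>n. of_nat (n choose k) * a k (Suc (n - k)))"
    by (simp add: binomial_eq_0 Suc_diff_le)
  finally show ?thesis
    by (simp add: algebra_simps sum.distrib)
qed

text \<open>
  Derivatives of all orders are carried along explicitly: \<open>F n\<close> stands for the \<open>n\<close>-th derivative of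
  \<open>F 0\<close>. Then a construction is a formula for the whole family, and its Carleman bounds are read off
  from that formula.
\<close>

definition leibniz :: "(nat \<Rightarrow> real \<Rightarrow> real) \<Rightarrow> (nat \<Rightarrow> real \<Rightarrow> real) \<Rightarrow> nat \<Rightarrow> real \<Rightarrow> real" where
  "leibniz F G n t = (\<Sum>k\<le>n. of_nat (n choose k) * (F k t * G (n - k) t))"

definition jet_at :: "(nat \<Rightarrow> real \<Rightarrow> real) \<Rightarrow> real \<Rightarrow> bool" where
  "jet_at F t \<longleftrightarrow> (\<forall>n. (F n has_real_derivative F (Suc n) t) (at t))"

lemma jet_at_leibniz:
  assumes "jet_at F t" "jet_at G t"
  shows "jet_at (leibniz F G) t"
  unfolding jet_at_def
proof
  fix n
  note assms[unfolded jet_at_def, rule_format, derivative_intros]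
  show "(leibniz F G n has_real_derivative leibniz F G (Suc n) t) (at t)"
    unfolding leibniz_def
    by (subst sum_choose_Suc)
       (auto intro!: derivative_eq_intros sum.cong simp: algebra_simps)
qed

lemma leibniz_0_left: "(\<And>n. F n t = 0) \<Longrightarrow> leibniz F G n t = 0"
  and leibniz_0_right: "(\<And>n. G n t = 0) \<Longrightarrow> leibniz F G n t = 0"
  by (auto simp: leibniz_def)

lemma jet_at_affine:
  assumes "jet_at F (a * t + b)"
  shows "jet_at (\<lambda>n t. a ^ n * F n (a * t + b)) t"
  unfolding jet_at_def
proof
  fix n
  have "(F n has_real_derivative F (Suc n) (a * t + b)) (at (a * t + b))"
    using assms by (simp add: jet_at_def)
  moreover have "((\<lambda>t. a * t + b) has_real_derivative a) (at t)"
    by (auto intro!: derivative_eq_intros)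
  ultimately have "((\<lambda>t. F n (a * t + b)) has_real_derivative F (Suc n) (a * t + b) * a) (at t)"
    by (rule DERIV_chain2)
  then   show "((\<lambda>t. a ^ n * F n (a * t + b)) has_real_derivative a ^ Suc n * F (Suc n) (a * t + b)) (at t)"
    by (auto intro!: derivative_eq_intros)
qed

lemma jet_at_lincomb:
  assumes "jet_at F t" "jet_at G t"
  shows "jet_at (\<lambda>n t. a * F n t + b * G n t) t"
  using assms unfolding jet_at_def by (auto intro!: derivative_eq_intros)

lemma jet_vanish:
  assumes jet: "\<And>t. jet_at F t" and "open S" "\<And>t. t \<in> S \<Longrightarrow> F 0 t = c" "t \<in> S" "n \<ge> 1"
  shows "F n t = 0"
proof -
  have "F (Suc k) t = 0" if "t \<in> S" for k t
    using that
  proof (induction k arbitrary: t)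
    case 0
    have "(F 0 has_real_derivative F 1 t) (at t)"
      using jet by (simp add: jet_at_def)
    moreover have "(F 0 has_real_derivative 0) (at t)"
      by (rule has_field_derivative_transform_within_open[OF DERIV_const[of c] \<open>open S\<close> 0])
         (use assms in auto)
    ultimately show ?case by (metis DERIV_unique One_nat_def)
  next
    case (Suc k)
    have "(F (Suc k) has_real_derivative F (Suc (Suc k)) t) (at t)"
      using jet by (simp add: jet_at_def)
    moreover have "(F (Suc k) has_real_derivative 0) (at t)"
      by (rule has_field_derivative_transform_within_open[OF DERIV_const[of 0] \<open>open S\<close> Suc(2)])
         (use Suc in auto)
    ultimately show ?case by (metis DERIV_unique)
  qed
  from this[OF \<open>t \<in> S\<close>, of "n - 1"] show ?thesis using \<open>n \<ge> 1\<close> by simp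
qed

locale carleman =
  fixes m :: "nat \<Rightarrow> real"
  assumes carleman: "carleman_sequence m"
begin

lemma m_pos: "n \<ge> 1 \<Longrightarrow> 0 < m n"
  using carleman by (simp add: carleman_sequence_def)

lemma m_mono: "n \<le> k \<Longrightarrow> 1 \<le> n \<Longrightarrow> m n \<le> m k"
proof (induction k rule: dec_induct)
  case (step k)
  then show ?case
    using carleman unfolding carleman_sequence_def
    by (meson le_trans order_trans)
qed auto

text \<open>
  A fixed number of differentiations stays in the class: each costs a factor \<open>n C\<^sup>n \<le> (2 C)\<^sup>n\<close>.
\<close>

lemma m_shift: "\<exists>E\<ge>1. \<forall>n\<ge>1. m (n + k) \<le> E ^ n * m n"
proof -
  obtain C where C: "C > 0" "\<And>n. n \<ge> 1 \<Longrightarrow> m (Suc n) / m n \<le> real n * C ^ n"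
    using carleman by (auto simp: carleman_sequence_def)
  define D where "D = max 1 (2 * C)"
  have D: "D \<ge> 1" "m (Suc n) \<le> D ^ n * m n" if "n \<ge> 1" for n
  proof -
    show "D \<ge> 1" by (simp add: D_def)
    have "m (Suc n) \<le> real n * C ^ n * m n"
      using C(2)[OF that] m_pos[OF that] by (simp add: field_simps)
    also have "real n * C ^ n \<le> 2 ^ n * C ^ n"
      using C(1) by (intro mult_right_mono) (auto simp: less_imp_le)
    also have "\<dots> = (2 * C) ^ n" by (simp add: power_mult_distrib)
    also have "\<dots> \<le> D ^ n" using C(1) by (intro power_mono) (auto simp: D_def)
    finally show "m (Suc n) \<le> D ^ n * m n" using m_pos[OF that] by simp
  qed
  show ?thesis
  proof (induction k)
    case 0
    show ?case by (intro exI[of _ 1]) auto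
  next
    case (Suc k)
    then obtain E where E: "E \<ge> 1" "\<And>n. n \<ge> 1 \<Longrightarrow> m (n + k) \<le> E ^ n * m n" by blast
    show ?case
    proof (intro exI[of _ "D ^ Suc k * E"] conjI allI impI)
      have D1: "D \<ge> 1" by (simp add: D_def)
      show "D ^ Suc k * E \<ge> 1"
        using D1 E(1) by (metis one_le_power mult_mono' mult_1 zero_le_one)
      fix n :: nat assume n: "n \<ge> 1"
      have "m (n + Suc k) \<le> D ^ (n + k) * m (n + k)" using D(2)[of "n + k"] n by simp
      also have "\<dots> \<le> D ^ (n + k) * (E ^ n * m n)"
        using E(2)[OF n] D1 by (intro mult_left_mono) auto
      also have "\<dots> = D ^ (n + k) * E ^ n * m n" by simp
      also have "\<dots> \<le> D ^ (Suc k * n) * E ^ n * m n"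
      proof (intro mult_right_mono power_increasing)
        show "n + k \<le> Suc k * n" using n by simp
      qed (use D1 E(1) m_pos[OF n] in auto)
      also have "\<dots> = (D ^ Suc k * E) ^ n * m n" by (simp only: power_mult power_mult_distrib)
      finally show "m (n + Suc k) \<le> (D ^ Suc k * E) ^ n * m n" .
    qed
  qed
qed

text \<open>
  By convexity the ratios \<open>b\<^sub>n\<^sub>+\<^sub>1 / b\<^sub>n\<close> of \<open>b\<^sub>n = m\<^sub>n / n!\<close> increase, so that
  \<open>b\<^sub>k b\<^sub>l \<le> b\<^sub>1 b\<^sub>k\<^sub>+\<^sub>l\<^sub>-\<^sub>1\<close>. This bounds each mixed term in the Leibniz formula by
  \<open>n m\<^sub>1 m\<^sub>n\<close>, up to geometric factors.
\<close>

lemma m_binomial: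
  assumes "k \<ge> 1" "l \<ge> 1"
  shows "real ((k + l) choose k) * m k * m l \<le> real (k + l) * m 1 * m (k + l - 1)"
proof -
  define b where "b n = m n / fact n" for n
  have b_pos: "b n > 0" if "n \<ge> 1" for n using m_pos[OF that] by (simp add: b_def)
  define r where "r n = b (Suc n) / b n" for n
  have r_step: "r n \<le> r (Suc n)" if n: "n \<ge> 1" for n
  proof -
    have "2 * ln (b (n + 1)) \<le> ln (b n) + ln (b (n + 2))"
      using carleman n by (simp add: carleman_sequence_def b_def)
    then have "ln (b (Suc n) ^ 2) \<le> ln (b n * b (n + 2))"
      using b_pos[of n] b_pos[of "n + 1"] b_pos[of "n + 2"] n by (simp add: ln_mult ln_realpow)
    then have "b (Suc n) ^ 2 \<le> b n * b (n + 2)"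
      using ln_le_cancel_iff[of "b (Suc n) ^ 2" "b n * b (n + 2)"] b_pos[of "Suc n"]
        mult_pos_pos[OF b_pos[of n] b_pos[of "n + 2"]] n by simp
    then show ?thesis
      using b_pos[of n] b_pos[of "Suc n"] n by (simp add: r_def field_simps power2_eq_square)
  qed
  have r_mono: "r i \<le> r j" if "1 \<le> i" "i \<le> j" for i j
    using that(2,1)
  proof (induction j rule: dec_induct)
    case (step j)
    then show ?case using r_step[of j] by linarith
  qed auto
  have "b k * b l \<le> b 1 * b (k + l - 1)"
    using assms(1)
  proof (induction k rule: nat_induct_at_least)
    case base
    then show ?case by simp
  next
    case (Suc k)
    have rk: "b (Suc k) = r k * b k" using b_pos[OF Suc(1)] by (simp add: r_def)
    have bkl: "b (k + l - 1) > 0" using Suc(1) assms(2) by (intro b_pos) auto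
    have rkl: "b (k + l) = r (k + l - 1) * b (k + l - 1)"
    proof -
      have "b (k + l - 1) > 0" by (rule bkl)
      moreover have "Suc (k + l - 1) = k + l" using assms(2) by simp
      ultimately show ?thesis by (simp add: r_def del: diff_Suc_Suc)
    qed
    have rpos: "r k \<ge> 0" using b_pos[of k] b_pos[of "Suc k"] Suc(1) by (simp add: r_def)
    have "b (Suc k) * b l = r k * (b k * b l)" by (simp add: rk)
    also have "\<dots> \<le> r k * (b 1 * b (k + l - 1))" using Suc rpos by (intro mult_left_mono) auto
    also have "\<dots> \<le> r (k + l - 1) * (b 1 * b (k + l - 1))"
    proof (intro mult_right_mono r_mono mult_nonneg_nonneg)
      show "0 \<le> b 1" "0 \<le> b (k + l - 1)"
        using b_pos[of 1] bkl by auto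
    qed (use Suc(1) assms(2) in auto)
    also have "\<dots> = b 1 * b (Suc k + l - 1)" by (simp add: rkl)
    finally show ?case .
  qed
  then have "fact (k + l) * (b k * b l) \<le> fact (k + l) * (b 1 * b (k + l - 1))"
    by (intro mult_left_mono) auto
  moreover have "fact (k + l) * (b k * b l) = real ((k + l) choose k) * m k * m l"
    by (simp add: b_def binomial_fact)
  moreover have "fact (k + l) = real (k + l) * fact (k + l - 1)"
    using assms by (metis One_nat_def fact_reduce le_add1 order.strict_trans2 zero_less_one)
  then have "fact (k + l) * (b 1 * b (k + l - 1)) = real (k + l) * m 1 * m (k + l - 1)"
    by (simp add: b_def)
  ultimately show ?thesis by simp
qed

text \<open>
  The bound \<open>B\<close> for the value is separate, since \<open>m 0\<close> is arbitrary.
\<close>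

definition bounded_jet :: "real \<Rightarrow> real \<Rightarrow> (nat \<Rightarrow> real \<Rightarrow> real) \<Rightarrow> real \<Rightarrow> bool" where
  "bounded_jet B C F t \<longleftrightarrow> \<bar>F 0 t\<bar> \<le> B \<and> (\<forall>n\<ge>1. \<bar>F n t\<bar> \<le> C ^ n * m n)"

lemma bounded_jet_mono:
  assumes "bounded_jet B C F t" "B \<le> B'" "C \<le> C'" "0 \<le> C"
  shows "bounded_jet B' C' F t"
  using assms unfolding bounded_jet_def
  by (meson order_trans mult_right_mono power_mono m_pos less_imp_le)

text \<open>
  In the Leibniz formula the two extreme terms contribute \<open>2 B C\<^sup>n m\<^sub>n\<close> and each of the other
  \<open>n - 1\<close> terms at most \<open>n m\<^sub>1 C\<^sup>n m\<^sub>n\<close>; the factor \<open>n\<^sup>2 \<le> 4\<^sup>n\<close> is absorbed in the geometric one.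
\<close>

lemma bounded_jet_leibniz:
  assumes "0 \<le> B" "0 \<le> C" "bounded_jet B C F t" "bounded_jet B C G t"
  shows "bounded_jet (B\<^sup>2) ((2 * B + m 1 + 1) * (4 * C)) (leibniz F G) t"
proof -
  have F: "\<bar>F n t\<bar> \<le> C ^ n * m n" and G: "\<bar>G n t\<bar> \<le> C ^ n * m n" if "n \<ge> 1" for n
    using assms(3,4) that by (auto simp: bounded_jet_def)
  have F0: "\<bar>F 0 t\<bar> \<le> B" and G0: "\<bar>G 0 t\<bar> \<le> B"
    using assms(3,4) by (auto simp: bounded_jet_def)
  have m1: "m 1 > 0" by (rule m_pos) simp
  show ?thesis
    unfolding bounded_jet_def
  proof (intro conjI allI impI)
    show "\<bar>leibniz F G 0 t\<bar> \<le> B\<^sup>2"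
      using F0 G0 assms(1) by (simp add: leibniz_def abs_mult power2_eq_square mult_mono')
    fix n :: nat assume n: "n \<ge> 1"
    then obtain p where p: "n = Suc p" by (cases n) auto
    have mn: "m n > 0" using m_pos n by simp
    have mid: "\<bar>real (n choose k) * (F k t * G (n - k) t)\<bar> \<le> C ^ n * (real n * m 1 * m n)"
      if k: "k \<in> {1..p}" for k
    proof -
      have kn: "k \<ge> 1" "n - k \<ge> 1" "k \<le> n" using k p by auto
      have "\<bar>real (n choose k) * (F k t * G (n - k) t)\<bar> =
          real (n choose k) * (\<bar>F k t\<bar> * \<bar>G (n - k) t\<bar>)" by (simp add: abs_mult)
      also have "\<dots> \<le> real (n choose k) * ((C ^ k * m k) * (C ^ (n - k) * m (n - k)))"
        using F[OF kn(1)] G[OF kn(2)] by (intro mult_left_mono mult_mono') auto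
      also have "\<dots> = C ^ (k + (n - k)) * (real (n choose k) * m k * m (n - k))"
        by (simp add: power_add)
      also have "k + (n - k) = n" using kn by simp
      also have "real (n choose k) * m k * m (n - k) \<le> real n * m 1 * m (n - 1)"
        using m_binomial[OF kn(1,2)] kn by simp
      also have "\<dots> \<le> real n * m 1 * m n"
        using m_mono[of "n - 1" n] kn m1 by (intro mult_left_mono) auto
      finally show ?thesis using assms(2) by (simp add: mult_left_mono)
    qed
    have "leibniz F G n t = (\<Sum>k\<in>insert 0 (insert n {1..p}). real (n choose k) * (F k t * G (n - k) t))"
      unfolding leibniz_def by (intro sum.cong) (auto simp: p)
    also have "\<dots> = F 0 t * G n t + (F n t * G 0 t + (\<Sum>k\<in>{1..p}. real (n choose k) * (F k t * G (n - k) t)))"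
      using p by (subst sum.insert; simp)
    also have "\<bar>\<dots>\<bar> \<le> B * (C ^ n * m n) + ((C ^ n * m n) * B + (\<Sum>k\<in>{1..p}. C ^ n * (real n * m 1 * m n)))"
    proof (intro order_trans[OF abs_triangle_ineq] add_mono)
      show "\<bar>F 0 t * G n t\<bar> \<le> B * (C ^ n * m n)" unfolding abs_mult
        using F0 G[OF n] by (intro mult_mono') auto
      show "\<bar>F n t * G 0 t\<bar> \<le> (C ^ n * m n) * B" unfolding abs_mult
        using G0 F[OF n] by (intro mult_mono') auto
      show "\<bar>\<Sum>k\<in>{1..p}. real (n choose k) * (F k t * G (n - k) t)\<bar> \<le> (\<Sum>k\<in>{1..p}. C ^ n * (real n * m 1 * m n))"
        using mid by (intro order_trans[OF sum_abs] sum_mono) auto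
    qed
    also have "\<dots> = (2 * B + real p * real n * m 1) * (C ^ n * m n)" by (simp add: algebra_simps)
    also have "\<dots> \<le> ((2 * B + m 1 + 1) * 4 ^ n) * (C ^ n * m n)"
    proof (intro mult_right_mono)
      have "real p * real n \<le> 2 ^ n * 2 ^ n"
      proof (intro mult_mono)
        show "real p \<le> 2 ^ n" "real n \<le> 2 ^ n"
          using of_nat_less_two_power[of n, where 'a=real] p by auto
      qed auto
      also have "\<dots> = (4 :: real) ^ n" by (simp flip: power_mult_distrib)
      finally have "real p * real n * m 1 \<le> 4 ^ n * m 1" using m1 by simp
      moreover have "2 * B \<le> (2 * B + 1) * 4 ^ n"
      proof -
        have "2 * B * 1 \<le> (2 * B + 1) * 4 ^ n" using assms(1) by (intro mult_mono) auto
        then show ?thesis by simp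
      qed
      ultimately show "2 * B + real p * real n * m 1 \<le> (2 * B + m 1 + 1) * 4 ^ n"
        by (simp add: algebra_simps)
      show "0 \<le> C ^ n * m n" using assms(2) mn by simp
    qed
    also have "\<dots> \<le> ((2 * B + m 1 + 1) ^ n * 4 ^ n) * (C ^ n * m n)"
    proof (intro mult_right_mono)
      have "(2 * B + m 1 + 1) ^ 1 \<le> (2 * B + m 1 + 1) ^ n"
        using n assms(1) m1 by (intro power_increasing) auto
      then show "2 * B + m 1 + 1 \<le> (2 * B + m 1 + 1) ^ n" by simp
    qed (use assms(2) mn in auto)
    also have "\<dots> = ((2 * B + m 1 + 1) * (4 * C)) ^ n * m n"
      by (simp add: power_mult_distrib)
    finally show "\<bar>leibniz F G n t\<bar> \<le> ((2 * B + m 1 + 1) * (4 * C)) ^ n * m n" .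
  qed
qed

definition bounded_jets :: "(nat \<Rightarrow> real \<Rightarrow> real) \<Rightarrow> real set \<Rightarrow> bool" where
  "bounded_jets F I \<longleftrightarrow> (\<exists>B\<ge>0. \<exists>C\<ge>0. \<forall>t\<in>I. bounded_jet B C F t)"

lemma bounded_jetsI:
  "B \<ge> 0 \<Longrightarrow> C \<ge> 0 \<Longrightarrow> (\<And>t. t \<in> I \<Longrightarrow> bounded_jet B C F t) \<Longrightarrow> bounded_jets F I"
  unfolding bounded_jets_def by blast

lemma bounded_jets_common:
  assumes "bounded_jets F I" "bounded_jets G J"
  obtains B C where "B \<ge> 0" "C \<ge> 0" "\<And>t. t \<in> I \<Longrightarrow> bounded_jet B C F t"
    "\<And>t. t \<in> J \<Longrightarrow> bounded_jet B C G t"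
proof -
  obtain B C B' C' where "B \<ge> 0" "C \<ge> 0" "\<And>t. t \<in> I \<Longrightarrow> bounded_jet B C F t"
    "B' \<ge> 0" "C' \<ge> 0" "\<And>t. t \<in> J \<Longrightarrow> bounded_jet B' C' G t"
    using assms unfolding bounded_jets_def by blast
  then show ?thesis
    by (intro that[of "max B B'" "max C C'"])
       (auto intro: bounded_jet_mono[where C = C and B = B] bounded_jet_mono[where C = C' and B = B'])
qed

lemma bounded_jets_leibniz:
  assumes "bounded_jets F I" "bounded_jets G I"
  shows "bounded_jets (leibniz F G) I"
proof -
  from bounded_jets_common[OF assms] obtain B C where *: "B \<ge> 0" "C \<ge> 0"
    "\<And>t. t \<in> I \<Longrightarrow> bounded_jet B C F t" "\<And>t. t \<in> I \<Longrightarrow> bounded_jet B C G t" by blast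
  have "m 1 > 0" by (rule m_pos) simp
  then show ?thesis
    using * bounded_jet_leibniz
    by (intro bounded_jetsI[of "B\<^sup>2" "(2 * B + m 1 + 1) * (4 * C)"]) auto
qed

lemma bounded_jets_affine:
  assumes "bounded_jets F ((\<lambda>t. a * t + b) ` I)"
  shows "bounded_jets (\<lambda>n t. a ^ n * F n (a * t + b)) I"
proof -
  obtain B C where *: "B \<ge> 0" "C \<ge> 0" "\<And>t. t \<in> I \<Longrightarrow> bounded_jet B C F (a * t + b)"
    using assms unfolding bounded_jets_def by auto
  have "bounded_jet B (\<bar>a\<bar> * C) (\<lambda>n t. a ^ n * F n (a * t + b)) t" if "t \<in> I" for t
    using *(3)[OF that] unfolding bounded_jet_def
    by (auto simp: abs_mult power_abs power_mult_distrib mult.assoc intro!: mult_left_mono)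
  then show ?thesis
    by (rule bounded_jetsI[rotated 2]) (use *(1,2) in simp_all)
qed

lemma bounded_jets_lincomb:
  assumes "bounded_jets F I" "bounded_jets G I"
  shows "bounded_jets (\<lambda>n t. a * F n t + b * G n t) I"
proof -
  from bounded_jets_common[OF assms] obtain B C where *: "B \<ge> 0" "C \<ge> 0"
    "\<And>t. t \<in> I \<Longrightarrow> bounded_jet B C F t" "\<And>t. t \<in> I \<Longrightarrow> bounded_jet B C G t" by blast
  define s where "s = \<bar>a\<bar> + \<bar>b\<bar> + 1"
  have s: "s \<ge> 1" by (simp add: s_def)
  have "bounded_jet (s * B) (s * C) (\<lambda>n t. a * F n t + b * G n t) t" if t: "t \<in> I" for t
    unfolding bounded_jet_def
  proof (intro conjI allI impI)
    have lin: "\<bar>a * x + b * y\<bar> \<le> s * c" if "\<bar>x\<bar> \<le> c" "\<bar>y\<bar> \<le> c" for x y c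
    proof -
      have "\<bar>a * x + b * y\<bar> \<le> \<bar>a\<bar> * \<bar>x\<bar> + \<bar>b\<bar> * \<bar>y\<bar>" by (metis abs_mult abs_triangle_ineq)
      also have "\<dots> \<le> \<bar>a\<bar> * c + \<bar>b\<bar> * c" using that by (intro add_mono mult_left_mono) auto
      also have "\<dots> \<le> s * c" using that by (simp add: s_def algebra_simps)
      finally show ?thesis .
    qed
    show "\<bar>a * F 0 t + b * G 0 t\<bar> \<le> s * B"
      using *(3,4)[OF t] by (intro lin) (auto simp: bounded_jet_def)
    fix n :: nat assume n: "n \<ge> 1"
    have "\<bar>a * F n t + b * G n t\<bar> \<le> s * (C ^ n * m n)"
      using *(3,4)[OF t] n by (intro lin) (auto simp: bounded_jet_def)
    also have "\<dots> = s ^ 1 * (C ^ n * m n)" by simp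
    also have "\<dots> \<le> s ^ n * (C ^ n * m n)"
      using s n * m_pos[OF n] by (intro mult_right_mono power_increasing) auto
    finally show "\<bar>a * F n t + b * G n t\<bar> \<le> (s * C) ^ n * m n" by (simp add: power_mult_distrib)
  qed
  then show ?thesis
    by (rule bounded_jetsI[rotated 2]) (use *(1,2) s in simp_all)
qed

text \<open>
  An antiderivative shifts the orders down by one, which is harmless because \<open>m\<close> is nondecreasing.
  Only the bound on the first derivative has to be read off from the value bound of the integrand.
\<close>

lemma bounded_jets_integral:
  assumes "bounded_jets (\<lambda>n. F (Suc n)) I" "\<And>t. t \<in> I \<Longrightarrow> \<bar>F 0 t\<bar> \<le> B0"
  shows "bounded_jets F I"
proof -
  obtain B C where *: "B \<ge> 0" "C \<ge> 0" "\<And>t. t \<in> I \<Longrightarrow> bounded_jet B C (\<lambda>n. F (Suc n)) t"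
    using assms unfolding bounded_jets_def by auto
  have m1: "m 1 > 0" by (rule m_pos) simp
  define D where "D = C + 1 + B / m 1"
  have D: "D \<ge> 1" "D \<ge> C" "D \<ge> B / m 1" using * m1 by (auto simp: D_def)
  have "bounded_jet \<bar>B0\<bar> D F t" if t: "t \<in> I" for t
    unfolding bounded_jet_def
  proof (intro conjI allI impI)
    show "\<bar>F 0 t\<bar> \<le> \<bar>B0\<bar>" using assms(2)[OF t] by linarith
    fix n :: nat assume n: "n \<ge> 1"
    show "\<bar>F n t\<bar> \<le> D ^ n * m n"
    proof (cases "n = 1")
      case True
      have "\<bar>F 1 t\<bar> \<le> B" using *(3)[OF t] by (simp add: bounded_jet_def)
      also have "\<dots> \<le> D * m 1" using D(3) m1 by (simp add: field_simps)
      finally show ?thesis using True by simp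
    next
      case False
      then obtain k where k: "n = Suc k" "k \<ge> 1" using n by (cases n) auto
      have "\<bar>F n t\<bar> \<le> C ^ k * m k" using *(3)[OF t] k by (auto simp: bounded_jet_def)
      also have "\<dots> \<le> D ^ k * m n"
        using * D k m_mono[of k n] m_pos[of k] by (intro mult_mono power_mono) auto
      also have "\<dots> \<le> D ^ n * m n"
        using D k m_pos[OF n] by (intro mult_right_mono power_increasing) auto
      finally show ?thesis .
    qed
  qed
  then show ?thesis
    by (rule bounded_jetsI[rotated 2]) (use D in simp_all)
qed

end

section \<open>Flat functions, bumps and plateaus in non-quasianalytic classes\<close>

lemma Euclidean_space_eq: "Euclidean_space n = top_of_set {x. \<forall>i\<ge>n. x i = 0}"
  by (simp add: Euclidean_space_def euclidean_product_topology)

definition coord_box :: "nat \<Rightarrow> coord \<Rightarrow> real \<Rightarrow> coord set" where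
  "coord_box N z r = {x. (\<forall>i<N. \<bar>x i - z i\<bar> < r) \<and> (\<forall>i\<ge>N. x i = 0)}"

lemma open_coord_less:
  fixes z :: coord
  shows "open {x::coord. \<forall>i<N. \<bar>x i - z i\<bar> < r}"
proof -
  have "{x::coord. \<forall>i<N. \<bar>x i - z i\<bar> < r} = (\<Inter>i\<in>{..<N}. {x. \<bar>x i - z i\<bar> < r})" by auto
  also have "open \<dots>"
    by (intro open_INT finite_lessThan ballI open_Collect_less continuous_intros) auto
  finally show ?thesis .
qed

lemma openin_coord_box: "openin (Euclidean_space N) (coord_box N z r)"
proof -
  have "coord_box N z r = {x. \<forall>i\<ge>N. x i = 0} \<inter> {x. \<forall>i<N. \<bar>x i - z i\<bar> < r}"
    by (auto simp: coord_box_def)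
  then show ?thesis
    unfolding Euclidean_space_eq by (simp add: openin_open_Int open_coord_less)
qed

text \<open>
  Carleman bounds are available on sets with compact closure in the domain only; boxes are such
  neighbourhoods, and they are stable under changing coordinates one at a time.
\<close>

lemma exists_coord_box:
  assumes "openin (Euclidean_space N) D" "z \<in> D"
  obtains r where "r > 0" "coord_box N z r \<subseteq> D"
    "compactin (Euclidean_space N) (Euclidean_space N closure_of (coord_box N z r))"
    "Euclidean_space N closure_of (coord_box N z r) \<subseteq> D"
proof -
  obtain T where T: "open T" "D = {x. \<forall>i\<ge>N. x i = 0} \<inter> T"
    using assms(1) unfolding Euclidean_space_eq openin_open by blast
  have zT: "z \<in> T" "\<forall>i\<ge>N. z i = 0" using assms(2) T by auto
  have "openin (powertop_real UNIV) T" using T(1) by (simp add: euclidean_product_topology)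
  from product_topology_open_contains_basis[OF this zT(1)]
  obtain X where X: "z \<in> Pi\<^sub>E UNIV X" "\<And>i. open (X i)" "Pi\<^sub>E UNIV X \<subseteq> T" "finite {i. X i \<noteq> UNIV}"
    by auto
  have "\<forall>\<^sub>F r in at_right 0. \<forall>i\<in>{..<N}. {z i - r..z i + r} \<subseteq> X i"
  proof (rule eventually_ball_finite)
    show "\<forall>i\<in>{..<N}. \<forall>\<^sub>F r in at_right 0. {z i - r..z i + r} \<subseteq> X i"
    proof
      fix i
      have "z i \<in> X i" using X(1) by auto
      then obtain e where e: "e > 0" "cball (z i) e \<subseteq> X i"
        using X(2) open_contains_cball by blast
      have "{z i - r..z i + r} \<subseteq> X i" if "r < e" for r
        using e(2) that by (force simp: cball_def dist_real_def subset_iff)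
      then show "\<forall>\<^sub>F r in at_right 0. {z i - r..z i + r} \<subseteq> X i"
        unfolding eventually_at_right_field using e(1) by blast
    qed
  qed auto
  then obtain r where r: "r > 0" "\<And>i. i < N \<Longrightarrow> {z i - r..z i + r} \<subseteq> X i"
    unfolding eventually_at_right_field by (metis dense lessThan_iff)
  define C where "C = Pi\<^sub>E UNIV (\<lambda>i. if i < N then {z i - r..z i + r} else {0})"
  have C_eq: "C = {x. (\<forall>i<N. \<bar>x i - z i\<bar> \<le> r) \<and> (\<forall>i\<ge>N. x i = 0)}"
  proof -
    have "x i \<in> (if i < N then {z i - r..z i + r} else {0}) \<longleftrightarrow>
        (i < N \<longrightarrow> \<bar>x i - z i\<bar> \<le> r) \<and> (N \<le> i \<longrightarrow> x i = 0)" for x i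
      by (auto simp: abs_le_iff)
    then show ?thesis
      unfolding C_def PiE_UNIV_domain Pi_iff by auto
  qed
  have CD: "C \<subseteq> D"
  proof -
    have "C \<subseteq> Pi\<^sub>E UNIV X"
      unfolding C_def using r(2) X(1) zT(2)
      by (intro PiE_mono) (auto simp: PiE_UNIV_domain not_less Pi_iff; metis)
    then show ?thesis using X(3) T(2) C_eq by auto
  qed
  have "compactin (powertop_real UNIV) C"
    unfolding C_def compactin_PiE by auto
  then have comp: "compact C" by (simp add: euclidean_product_topology)
  have boxC: "coord_box N z r \<subseteq> C" by (auto simp: C_eq coord_box_def less_imp_le)
  have compC: "compactin (Euclidean_space N) C"
    unfolding Euclidean_space_eq using comp by (auto simp: compactin_subtopology C_eq)
  have closC: "closedin (Euclidean_space N) C"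
    unfolding closedin_Euclidean_space_iff using comp
    by (auto simp: compact_imp_closed C_eq topspace_Euclidean_space)
  have clos: "Euclidean_space N closure_of (coord_box N z r) \<subseteq> C"
    by (rule closure_of_minimal[OF boxC closC])
  show ?thesis
  proof (rule that[OF r(1)])
    show "coord_box N z r \<subseteq> D" using boxC CD by blast
    show "compactin (Euclidean_space N) (Euclidean_space N closure_of (coord_box N z r))"
      by (rule closed_compactin[OF compC clos]) simp
    show "Euclidean_space N closure_of (coord_box N z r) \<subseteq> D" using clos CD by blast
  qed
qed

lemma smooth_on_deriv:
  assumes "smooth_on N D u" "set is \<subseteq> {..<N}" "i < N" "x(i := s) \<in> D"
  shows "((\<lambda>s. partial_derivs is u (x(i := s))) has_real_derivative
           partial_derivs (i # is) u (x(i := s))) (at s)"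
proof -
  have "(\<lambda>t. partial_derivs is u ((x(i := s))(i := t))) differentiable (at ((x(i := s)) i))"
    using assms unfolding smooth_on_def by blast
  then show ?thesis
    by (auto simp: partial_deriv_def field_differentiable_derivI DERIV_deriv_iff_real_differentiable)
qed

lemma connected_clopen_boundary:
  assumes "connectedin X D" "openin X D" "openin X (D - Z)" "Z \<subseteq> D" "Z \<noteq> {}" "Z \<noteq> D"
  shows "\<not> openin X Z"
proof
  assume "openin X Z"
  then have "\<not> (D \<subseteq> Z \<union> (D - Z) \<and> Z \<inter> (D - Z) \<inter> D = {} \<and> Z \<inter> D \<noteq> {} \<and> (D - Z) \<inter> D \<noteq> {})"
    using assms(1,3) unfolding connectedin by blast
  then show False using assms by auto
qed

lemma antiderivative_exists:
  fixes g :: "real \<Rightarrow> 'a::euclidean_space"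
  assumes "continuous_on UNIV g"
  obtains H where "H 0 = 0" "\<And>t. (H has_vector_derivative g t) (at t)"
proof -
  define H where "H u = (LBINT y=0..u. g y)" for u :: real
  have "(H has_vector_derivative g t) (at t)" for t
  proof -
    define b where "b = \<bar>t\<bar> + 1"
    have "(H has_vector_derivative g t) (at t within {-b..b})"
      unfolding H_def zero_ereal_def
      by (rule interval_integral_FTC2) (auto intro: continuous_on_subset[OF assms] simp: b_def)
    then show ?thesis by (subst (asm) at_within_Icc_at) (auto simp: b_def)
  qed
  moreover have "H 0 = 0" by (simp add: H_def zero_ereal_def)
  ultimately show ?thesis by (rule that[rotated])
qed

context carleman
begin

lemma bounded_jets_geometric:
  assumes "\<And>t. t \<in> I \<Longrightarrow> \<bar>F 0 t\<bar> \<le> B" "A \<ge> 0" "C \<ge> 0"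
    "\<And>t n. t \<in> I \<Longrightarrow> n \<ge> 1 \<Longrightarrow> \<bar>F n t\<bar> \<le> A * C ^ n * m n"
  shows "bounded_jets F I"
proof (rule bounded_jetsI[of "\<bar>B\<bar>" "(A + 1) * C"])
  fix t assume t: "t \<in> I"
  show "bounded_jet \<bar>B\<bar> ((A + 1) * C) F t"
    unfolding bounded_jet_def
  proof (intro conjI allI impI)
    show "\<bar>F 0 t\<bar> \<le> \<bar>B\<bar>" using assms(1)[OF t] by linarith
    fix n :: nat assume n: "n \<ge> 1"
    have "A \<le> (A + 1) ^ 1" by simp
    also have "\<dots> \<le> (A + 1) ^ n" using n assms(2) by (intro power_increasing) auto
    finally have "A * C ^ n * m n \<le> (A + 1) ^ n * C ^ n * m n"
      using assms(3) m_pos[OF n] by (intro mult_right_mono) auto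
    then show "\<bar>F n t\<bar> \<le> ((A + 1) * C) ^ n * m n"
      using assms(4)[OF t n] by (simp add: power_mult_distrib)
  qed
qed (use assms in auto)

text \<open>
  The set \<open>Z\<close> of zeros of infinite order is closed in the connected domain, nonempty, and not the
  whole domain, so that some \<open>z \<in> Z\<close> has points \<open>y \<notin> Z\<close> arbitrarily close to it. On the path from
  \<open>z\<close> to \<open>y\<close> that changes the coordinates one after the other, some edge leads out of \<open>Z\<close>. At its
  end point a derivative \<open>\<partial>\<^sup>\<alpha>u\<close> is nonzero; restricted to the line of that edge, \<open>\<partial>\<^sup>\<alpha>u\<close> is flat at
  the start. As edges are parallel to the axes, the derivatives along an edge are iterated partial
  derivatives of \<open>u\<close>.
\<close>

lemma flat_line_function:
  assumes "\<not> quasianalytic m"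
  obtains F where "\<And>s. s \<in> {0..2} \<Longrightarrow> jet_at F s" "bounded_jets F {0..2}"
    "\<And>n. F n 0 = 0" "F 0 1 \<noteq> 0"
proof -
  obtain N D u x0 y0 where D: "openin (Euclidean_space N) D" "connectedin (Euclidean_space N) D"
      "carleman_class m N D u" "x0 \<in> D" "infinite_order_zero N u x0" "y0 \<in> D" "u y0 \<noteq> 0"
    using assms unfolding quasianalytic_def by blast
  define Z where "Z = {x \<in> D. \<forall>is. set is \<subseteq> {..<N} \<longrightarrow> partial_derivs is u x = 0}"
  have box: "\<exists>r>0. coord_box N z r \<subseteq> D \<and> carleman_bounded m N (coord_box N z r) u" if "z \<in> D" for z
    using exists_coord_box[OF D(1) that] D(3) openin_coord_box unfolding carleman_class_def
    by metis
  have in_box: "z \<in> coord_box N z r" if "z \<in> D" "r > 0" for z r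
    using that openin_subset[OF D(1)] by (auto simp: coord_box_def topspace_Euclidean_space)
  have "openin (Euclidean_space N) (D - Z)"
    unfolding openin_subopen[of _ "D - Z"]
  proof
    fix x assume x: "x \<in> D - Z"
    then obtain "is" where is': "set is \<subseteq> {..<N}" "partial_derivs is u x \<noteq> 0" by (auto simp: Z_def)
    obtain r where r: "r > 0" "coord_box N x r \<subseteq> D" "carleman_bounded m N (coord_box N x r) u"
      using box x by blast
    let ?X = "subtopology (Euclidean_space N) (coord_box N x r)"
    have "continuous_map ?X euclideanreal (partial_derivs is u)"
      using r(3) is'(1) by (auto simp: carleman_bounded_def smooth_on_def)
    then have "openin ?X {y \<in> topspace ?X. partial_derivs is u y \<in> - {0}}"
      by (rule openin_continuous_map_preimage) auto
    then have "openin (Euclidean_space N) {y \<in> topspace ?X. partial_derivs is u y \<in> - {0}}"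
      using openin_coord_box openin_trans_full by blast
    moreover have "x \<in> {y \<in> topspace ?X. partial_derivs is u y \<in> - {0}}"
      using x is' in_box[OF _ r(1)] openin_subset[OF D(1)] by auto
    moreover have "{y \<in> topspace ?X. partial_derivs is u y \<in> - {0}} \<subseteq> D - Z"
      using r(2) is'(1) by (auto simp: Z_def)
    ultimately show "\<exists>T. openin (Euclidean_space N) T \<and> x \<in> T \<and> T \<subseteq> D - Z" by blast
  qed
  moreover have "x0 \<in> Z" using D by (auto simp: Z_def infinite_order_zero_def)
  moreover have "y0 \<notin> Z" using D(7) by (auto simp: Z_def intro!: exI[of _ "[]"])
  ultimately have "\<not> openin (Euclidean_space N) Z"
    using D(1,2,6) by (intro connected_clopen_boundary[of _ D]) (auto simp: Z_def)
  then obtain z where z: "z \<in> Z" "\<And>T. openin (Euclidean_space N) T \<Longrightarrow> z \<in> T \<Longrightarrow> \<not> T \<subseteq> Z"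
    by (subst (asm) openin_subopen) blast
  have zD: "z \<in> D" using z by (simp add: Z_def)
  obtain r where r: "r > 0" "coord_box N z r \<subseteq> D" "carleman_bounded m N (coord_box N z r) u"
    using box[OF zD] by blast
  have z0: "z i = 0" if "i \<ge> N" for i
    using in_box[OF zD r(1)] that by (simp add: coord_box_def)
  \<comment> \<open>The factor \<open>1/3\<close> leaves room to prolong each edge to twice its length inside the box.\<close>
  obtain y where y: "y \<in> coord_box N z (r / 3)" "y \<notin> Z"
    using z(2)[OF openin_coord_box in_box[OF zD]] r(1) by (metis divide_pos_pos subsetI zero_less_numeral)
  \<comment> \<open>The \<open>i\<close>-th vertex of the path from \<open>z\<close> to \<open>y\<close>.\<close>
  define w where "w i j = (if j < i then y j else z j)" for i j :: nat
  have w0: "w 0 = z" by (auto simp: w_def)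
  have wN: "w N = y" using y(1) z0 by (auto simp: w_def coord_box_def)
  have w_box: "w i \<in> coord_box N z (r / 3)" for i
    using y(1) z0 r(1) by (auto simp: w_def coord_box_def)
  have "\<exists>i<N. w i \<in> Z \<and> w (Suc i) \<notin> Z"
  proof (rule ccontr)
    assume *: "\<not> ?thesis"
    have "i \<le> N \<Longrightarrow> w i \<in> Z" for i
      by (induction i) (use * w0 z(1) in auto)
    then show False using wN y(2) by auto
  qed
  then obtain i where i: "i < N" "w i \<in> Z" "w (Suc i) \<notin> Z" by blast
  have w_Suc: "w (Suc i) = (w i)(i := y i)" by (auto simp: w_def less_Suc_eq)
  have w_i: "w i i = z i" by (simp add: w_def)
  have "w (Suc i) \<in> D"
  proof -
    have "coord_box N z (r / 3) \<subseteq> coord_box N z r"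
      using r(1) by (fastforce simp: coord_box_def)
    then show ?thesis using w_box r(2) by blast
  qed
  then obtain "is" where is': "set is \<subseteq> {..<N}" "partial_derivs is u (w (Suc i)) \<noteq> 0"
    using i(3) by (auto simp: Z_def)
  define d where "d = y i - z i"
  have d: "\<bar>d\<bar> < r / 3" using y(1) i(1) by (simp add: d_def coord_box_def)
  define f where "f n s = partial_derivs (replicate n i @ is) u ((w i)(i := s))" for n s
  have on_line: "(w i)(i := d * s + z i) \<in> coord_box N z r" if "s \<in> {0..2}" for s
  proof -
    have "\<bar>d * s\<bar> \<le> \<bar>d\<bar> * 2" using that unfolding abs_mult by (intro mult_left_mono) auto
    also have "\<dots> < r" using d r(1) by linarith
    finally have "\<bar>d * s\<bar> < r" .
    then show ?thesis using w_box[of i] i(1) r(1) by (auto simp: coord_box_def)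
  qed
  have smooth: "smooth_on N (coord_box N z r) u" using r(3) by (simp add: carleman_bounded_def)
  have jet_f: "jet_at f (d * s + z i)" if "s \<in> {0..2}" for s
    unfolding jet_at_def
  proof
    fix n
    have "set (replicate n i @ is) \<subseteq> {..<N}" using is'(1) i(1) by auto
    from smooth_on_deriv[OF smooth this i(1) on_line[OF that]]
    show "(f n has_real_derivative f (Suc n) (d * s + z i)) (at (d * s + z i))"
      by (simp add: f_def[abs_def])
  qed
  \<comment> \<open>The edge becomes the parameter interval from \<open>0\<close> to \<open>1\<close>.\<close>
  define F where "F n s = d ^ n * f n (d * s + z i)" for n s
  have jet_F: "jet_at F s" if "s \<in> {0..2}" for s
    unfolding F_def[abs_def] by (rule jet_at_affine[OF jet_f[OF that]])
  have "bounded_jets f ((\<lambda>s. d * s + z i) ` {0..2})"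
  proof -
    obtain C where C: "C > 0" "\<And>js x. set js \<subseteq> {..<N} \<Longrightarrow> 1 \<le> length js \<Longrightarrow> x \<in> coord_box N z r \<Longrightarrow>
        \<bar>partial_derivs js u x\<bar> \<le> C ^ length js * m (length js)"
      using r(3) unfolding carleman_bounded_def by blast
    obtain E where E: "E \<ge> 1" "\<And>n. n \<ge> 1 \<Longrightarrow> m (n + length is) \<le> E ^ n * m n"
      using m_shift by blast
    have "continuous_on {0..2} (F 0)"
      using jet_F unfolding jet_at_def
      by (intro DERIV_atLeastAtMost_imp_continuous_on) auto
    then have "compact (F 0 ` {0..2})" by (rule compact_continuous_image) auto
    then obtain B where B: "\<And>s. s \<in> {0..2} \<Longrightarrow> \<bar>F 0 s\<bar> \<le> B"
      by (meson bounded_real compact_imp_bounded imageI)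
    show ?thesis
    proof (rule bounded_jets_geometric[of _ _ B "C ^ length is" "C * E"])
      show "\<bar>f 0 t\<bar> \<le> B" if "t \<in> (\<lambda>s. d * s + z i) ` {0..2}" for t
        using B that by (auto simp: F_def)
      fix t and n :: nat assume t: "t \<in> (\<lambda>s. d * s + z i) ` {0..2}" and n: "n \<ge> 1"
      have "\<bar>f n t\<bar> \<le> C ^ (n + length is) * m (n + length is)"
        unfolding f_def using C(2)[of "replicate n i @ is"] is'(1) i(1) n on_line t by auto
      also have "\<dots> \<le> C ^ (n + length is) * (E ^ n * m n)"
        using E(2)[OF n] C(1) by (intro mult_left_mono) auto
      finally show "\<bar>f n t\<bar> \<le> C ^ length is * (C * E) ^ n * m n"
        by (simp add: power_add power_mult_distrib mult_ac)
    qed (use C E in auto)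
  qed
  then have "bounded_jets F {0..2}"
    unfolding F_def[abs_def] by (rule bounded_jets_affine)
  moreover have "F n 0 = 0" for n
  proof -
    have "(w i)(i := z i) = w i" using w_i by auto
    moreover have "set (replicate n i @ is) \<subseteq> {..<N}" using is'(1) i(1) by auto
    ultimately show ?thesis using i(2) by (simp add: F_def f_def Z_def)
  qed
  moreover have "F 0 1 \<noteq> 0"
    using is'(2) by (simp add: F_def f_def w_Suc d_def)
  ultimately show ?thesis using that jet_F by blast
qed

lemma bounded_jets_extend:
  assumes "bounded_jets F I" "\<And>t n. t \<notin> I \<Longrightarrow> F n t = 0"
  shows "bounded_jets F UNIV"
proof -
  obtain B C where *: "B \<ge> 0" "C \<ge> 0" "\<And>t. t \<in> I \<Longrightarrow> bounded_jet B C F t"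
    using assms unfolding bounded_jets_def by blast
  have "bounded_jet B C F t" for t
    using *(3)[of t] assms(2)[of t] *(1,2) m_pos
    by (cases "t \<in> I") (auto simp: bounded_jet_def less_imp_le)
  then show ?thesis by (rule bounded_jetsI[rotated 2]) (use * in simp_all)
qed

lemma bounded_jets_subset: "bounded_jets F I \<Longrightarrow> J \<subseteq> I \<Longrightarrow> bounded_jets F J"
  unfolding bounded_jets_def by blast

text \<open>
  With \<open>f\<close> flat at \<open>0\<close> and \<open>f 1 \<noteq> 0\<close>, the function \<open>f(s)\<^sup>2 f(2 - s)\<^sup>2\<close> is flat at both ends of \<open>[0, 2]\<close>
  and does not vanish at \<open>1\<close>; its extension by \<open>0\<close> has all derivatives.
\<close>

lemma bump:
  assumes "\<not> quasianalytic m"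
  obtains K where "\<And>t. jet_at K t" "bounded_jets K UNIV" "\<And>t. K 0 t \<ge> 0" "K 0 1 > 0"
    "\<And>n t. t \<notin> {0..2} \<Longrightarrow> K n t = 0"
proof -
  from flat_line_function[OF assms] obtain F where F: "\<And>s. s \<in> {0..2} \<Longrightarrow> jet_at F s"
    "bounded_jets F {0..2}" "\<And>n. F n 0 = 0" "F 0 1 \<noteq> 0" by blast
  define E where "E = leibniz F F"
  define E' where "E' n t = (-1) ^ n * E n ((-1) * t + 2)" for n and t :: real
  define H where "H = leibniz E E'"
  have jE: "jet_at E s" if "s \<in> {0..2}" for s
    using F(1)[OF that] by (simp add: E_def jet_at_leibniz)
  have jE': "jet_at E' s" if "s \<in> {0..2}" for s
    unfolding E'_def[abs_def] using that by (intro jet_at_affine jE) auto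
  have jH: "jet_at H s" if "s \<in> {0..2}" for s
    unfolding H_def using jE[OF that] jE'[OF that] by (rule jet_at_leibniz)
  have bE: "bounded_jets E {0..2}" unfolding E_def by (intro bounded_jets_leibniz F)
  have "(\<lambda>t. (-1) * t + 2) ` {0..2} = {0..2::real}"
    by (auto simp: image_iff intro!: bexI[of _ "2 - _"])
  then have bE': "bounded_jets E' {0..2}"
    unfolding E'_def[abs_def] using bE by (intro bounded_jets_affine) simp
  have bH: "bounded_jets H {0..2}" unfolding H_def by (intro bounded_jets_leibniz bE bE')
  have E0: "E n 0 = 0" for n unfolding E_def using F(3) by (rule leibniz_0_left)
  have H0: "H n 0 = 0" for n unfolding H_def using E0 by (rule leibniz_0_left)
  have H2: "H n 2 = 0" for n
    unfolding H_def by (rule leibniz_0_right) (simp add: E'_def E0)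
  define K where "K n t = (if t \<in> {0..2} then H n t else 0)" for n t
  have jK: "jet_at K t" for t
    unfolding jet_at_def
  proof
    fix n
    have "((\<lambda>t. if t \<in> {0..2} then H n t else 0) has_vector_derivative
        (if t \<in> {0..2} then H (Suc n) t else 0)) (at t within {0..2} \<union> ({..0} \<union> {2..}))"
    proof (rule has_vector_derivative_If_within_closures)
      have *: "closure {0..2} \<inter> closure ({..0} \<union> {2..}) \<subseteq> {0, 2::real}" by auto
      show "t \<in> {0..2} \<union> ({..0} \<union> {2..})" by auto
      show "(H n has_vector_derivative H (Suc n) t)
          (at t within {0..2} \<union> closure {0..2} \<inter> closure ({..0} \<union> {2..}))"
        if "t \<in> {0..2} \<union> closure {0..2} \<inter> closure ({..0} \<union> {2..})"
        using jH[of t] that * unfolding jet_at_def has_real_derivative_iff_has_vector_derivative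
        by (auto intro: has_vector_derivative_at_within)
      show "((\<lambda>t. 0) has_vector_derivative 0)
          (at t within ({..0} \<union> {2..}) \<union> closure {0..2} \<inter> closure ({..0} \<union> {2..}))" by simp
      show "H n x = 0" if "x \<in> closure {0..2}" "x \<in> closure ({..0} \<union> {2..})" for x
        using that H0 H2 * by blast
      show "H (Suc n) x = 0" if "x \<in> closure {0..2}" "x \<in> closure ({..0} \<union> {2..})" for x
        using that H0 H2 * by blast
    qed auto
    moreover have "{0..2} \<union> ({..0} \<union> {2..}) = (UNIV :: real set)" by auto
    ultimately show "(K n has_real_derivative K (Suc n) t) (at t)"
      by (simp add: K_def[abs_def] has_real_derivative_iff_has_vector_derivative)
  qed
  have "bounded_jets K {0..2}" using bH unfolding bounded_jets_def bounded_jet_def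
    by (simp add: K_def)
  then have "bounded_jets K UNIV" by (rule bounded_jets_extend) (auto simp: K_def)
  moreover have "K 0 t \<ge> 0" for t
    by (auto simp: K_def H_def E'_def E_def leibniz_def)
  moreover have "K 0 1 > 0"
    using F(4) by (simp add: K_def H_def E'_def E_def leibniz_def zero_less_mult_iff) linarith
  ultimately show ?thesis using jK by (intro that[of K]) (auto simp: K_def)
qed

text \<open>
  The normalized integral of a bump.
\<close>

lemma smooth_step:
  assumes "\<not> quasianalytic m"
  obtains X where "\<And>t. jet_at X t" "bounded_jets X UNIV" "\<And>t. 0 \<le> X 0 t" "\<And>t. X 0 t \<le> 1"
    "\<And>t. t \<le> 0 \<Longrightarrow> X 0 t = 0" "\<And>t. t \<ge> 2 \<Longrightarrow> X 0 t = 1"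
proof -
  from bump[OF assms] obtain K where K: "\<And>t. jet_at K t" "bounded_jets K UNIV" "\<And>t. K 0 t \<ge> 0"
    "K 0 1 > 0" "\<And>n t. t \<notin> {0..2} \<Longrightarrow> K n t = 0" by blast
  have contK: "continuous_on UNIV (K 0)"
    using K(1) unfolding jet_at_def by (intro DERIV_continuous_on) (auto intro: has_field_derivative_at_within)
  from antiderivative_exists[OF contK] obtain Y where
    Y0: "Y 0 = 0" and "\<And>t. (Y has_vector_derivative K 0 t) (at t)" by blast
  then have dY: "(Y has_real_derivative K 0 t) (at t)" for t
    by (simp add: has_real_derivative_iff_has_vector_derivative)
  have contY: "continuous_on S Y" for S
    using dY by (intro DERIV_continuous_on) (auto intro: has_field_derivative_at_within)
  have mono: "Y s \<le> Y t" if "s \<le> t" for s t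
    using that K(3) dY by (intro DERIV_nonneg_imp_nondecreasing[OF that]) blast
  have Yleft: "Y t = 0" if "t \<le> 0" for t
  proof (cases "t < 0")
    case True
    have "Y 0 = Y t"
    proof (rule DERIV_isconst2[OF True contY])
      show "(Y has_real_derivative 0) (at x)" if "t < x" "x < 0" for x
        using dY[of x] K(5)[of x 0] that by simp
    qed (use True in auto)
    then show ?thesis using Y0 by simp
  qed (use that Y0 in auto)
  have Yright: "Y t = Y 2" if "t \<ge> 2" for t
  proof (cases "t > 2")
    case True
    show "Y t = Y 2"
    proof (rule DERIV_isconst2[OF True contY])
      show "(Y has_real_derivative 0) (at x)" if "2 < x" "x < t" for x
        using dY[of x] K(5)[of x 0] that by simp
    qed (use True in auto)
  qed (use that in auto)
  have "Y 2 > 0"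
  proof (rule ccontr)
    assume "\<not> Y 2 > 0"
    then have "Y t = 0" if "t \<in> {0<..<2}" for t
      using mono[of 0 t] mono[of t 2] that Y0 by simp
    then have "(Y has_real_derivative 0) (at 1)"
      by (intro has_field_derivative_transform_within_open[OF DERIV_const[of 0], of "{0<..<2}"]) auto
    then show False using dY[of 1] K(4) DERIV_unique by fastforce
  qed
  define Xs where "Xs n = (case n of 0 \<Rightarrow> Y | Suc k \<Rightarrow> K k)" for n
  define X where "X n t = (1 / Y 2) * Xs n t + 0 * Xs n t" for n t
  have jXs: "jet_at Xs t" for t
    using dY[of t] K(1)[of t] unfolding jet_at_def Xs_def by (auto split: nat.split)
  have "bounded_jets Xs UNIV"
  proof (rule bounded_jets_integral[of _ _ "Y 2"])
    show "bounded_jets (\<lambda>n. Xs (Suc n)) UNIV" using K(2) by (simp add: Xs_def)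
    show "\<bar>Xs 0 t\<bar> \<le> Y 2" for t
      using mono[of t 2] mono[of 0 t] Yleft[of t] Yright[of t] Y0 \<open>Y 2 > 0\<close>
      by (cases "t \<le> 0"; cases "t \<ge> 2") (auto simp: Xs_def)
  qed
  note jb = jet_at_lincomb[OF jXs jXs] bounded_jets_lincomb[OF this this]
  show ?thesis
  proof (rule that[of X])
    show "jet_at X t" for t unfolding X_def[abs_def] by (rule jb)
    show "bounded_jets X UNIV" unfolding X_def[abs_def] by (rule jb)
    have "0 \<le> Y t \<and> Y t \<le> Y 2" for t
      using mono[of t 2] mono[of 0 t] Yleft[of t] Yright[of t] Y0 \<open>Y 2 > 0\<close>
      by (cases "t \<le> 0"; cases "t \<ge> 2") auto
    then show "0 \<le> X 0 t" "X 0 t \<le> 1" for t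
      using \<open>Y 2 > 0\<close> by (auto simp: X_def Xs_def)
    show "X 0 t = 0" if "t \<le> 0" for t using Yleft[OF that] by (simp add: X_def Xs_def)
    show "X 0 t = 1" if "t \<ge> 2" for t using Yright[OF that] \<open>Y 2 > 0\<close> by (simp add: X_def Xs_def)
  qed
qed

lemma bounded_jets_finite:
  assumes "\<And>n t. n \<ge> 3 \<Longrightarrow> F n t = 0" "\<And>t. t \<in> I \<Longrightarrow> \<bar>F 0 t\<bar> \<le> B \<and> \<bar>F 1 t\<bar> \<le> B \<and> \<bar>F 2 t\<bar> \<le> B"
  shows "bounded_jets F I"
proof (rule bounded_jets_geometric[of _ _ B "\<bar>B\<bar> / m 1" 1])
  have m1: "m 1 > 0" by (rule m_pos) simp
  then show "\<bar>B\<bar> / m 1 \<ge> 0" by simp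
  fix t and n :: nat assume t: "t \<in> I" and n: "n \<ge> 1"
  have "\<bar>F n t\<bar> \<le> \<bar>B\<bar>"
    using assms(1)[of n t] assms(2)[OF t] n by (cases "n = 1"; cases "n = 2") auto
  also have "\<dots> = \<bar>B\<bar> / m 1 * m 1" using m1 by simp
  also have "\<dots> \<le> \<bar>B\<bar> / m 1 * m n" using m_mono[OF n] m1 by (intro mult_left_mono) auto
  finally show "\<bar>F n t\<bar> \<le> \<bar>B\<bar> / m 1 * 1 ^ n * m n" by simp
qed (use assms in auto)

text \<open>
  Let \<open>P\<close> be a plateau function, equal to \<open>1\<close> for \<open>|t| \<le> 3/4\<close> and to \<open>0\<close> for \<open>|t| \<ge> 4/5\<close>. Then
  \<open>1 + P(t) (p(t) - 1)\<close> interpolates between \<open>p(t) = 1/3 - 2/3 t\<^sup>2\<close> and \<open>1\<close>.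
\<close>

lemma oscillator_profile:
  assumes "\<not> quasianalytic m"
  obtains Q where "\<And>t. jet_at Q t" "bounded_jets Q UNIV"
    "\<And>t. \<bar>t\<bar> \<le> 3/4 \<Longrightarrow> Q 0 t = 1/3 - 2/3 * t\<^sup>2" "\<And>t. \<bar>t\<bar> \<ge> 4/5 \<Longrightarrow> Q 0 t = 1"
    "\<And>t. 1/3 - 2/3 * t\<^sup>2 \<le> Q 0 t"
proof -
  from smooth_step[OF assms] obtain X where X: "\<And>t. jet_at X t" "bounded_jets X UNIV"
    "\<And>t. 0 \<le> X 0 t" "\<And>t. X 0 t \<le> 1" "\<And>t. t \<le> 0 \<Longrightarrow> X 0 t = 0" "\<And>t. t \<ge> 2 \<Longrightarrow> X 0 t = 1" by blast
  define one where "one n t = (if n = 0 then 1 else 0 :: real)" for n :: nat and t :: real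
  have one: "jet_at one t" "bounded_jets one UNIV" for t
  proof -
    show "jet_at one t" by (auto simp: jet_at_def one_def[abs_def])
    show "bounded_jets one UNIV" by (rule bounded_jets_finite[of _ _ 1]) (auto simp: one_def)
  qed
  \<comment> \<open>The step \<open>X\<close> rises on \<open>[0, 2]\<close>; the substitution \<open>40 t + 32\<close> takes \<open>[-4/5, -3/4]\<close> to it.\<close>
  define A where "A n t = 40 ^ n * X n (40 * t + 32)" for n t
  define B where "B n t = (-40) ^ n * X n ((-40) * t + 32)" for n t
  define AB where "AB n t = 1 * A n t + 1 * B n t" for n t
  define P where "P n t = 1 * AB n t + (-1) * one n t" for n t
  have A: "jet_at A t" "bounded_jets A UNIV" for t
    unfolding A_def[abs_def]
    by (rule jet_at_affine X(1) bounded_jets_affine bounded_jets_subset[OF X(2)] subset_UNIV)+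
  have B: "jet_at B t" "bounded_jets B UNIV" for t
    unfolding B_def[abs_def]
    by (rule jet_at_affine X(1) bounded_jets_affine bounded_jets_subset[OF X(2)] subset_UNIV)+
  have AB: "jet_at AB t" "bounded_jets AB UNIV" for t
    unfolding AB_def[abs_def] by (rule jet_at_lincomb bounded_jets_lincomb A B)+
  have P: "jet_at P t" "bounded_jets P UNIV" for t
    unfolding P_def[abs_def] by (rule jet_at_lincomb bounded_jets_lincomb AB one)+
  have P0: "P 0 t = X 0 (40 * t + 32) + X 0 (32 - 40 * t) - 1" for t
    by (simp add: P_def AB_def A_def B_def one_def add.commute)
  have P_in: "P 0 t = 1" if "\<bar>t\<bar> \<le> 3/4" for t
    using X(6)[of "40 * t + 32"] X(6)[of "32 - 40 * t"] that by (simp add: P0 abs_le_iff)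
  have P_out: "P 0 t = 0" if "\<bar>t\<bar> \<ge> 4/5" for t
    using X(5,6)[of "40 * t + 32"] X(5,6)[of "32 - 40 * t"] that
    by (auto simp: P0 abs_le_iff abs_if split: if_splits)
  have P_bounds: "0 \<le> P 0 t \<and> P 0 t \<le> 1" for t
    using X(3,4)[of "40 * t + 32"] X(3,4)[of "32 - 40 * t"]
      X(6)[of "40 * t + 32"] X(6)[of "32 - 40 * t"]
    by (cases "t \<ge> 0") (auto simp: P0)
  have P_vanish: "P n t = 0" if "\<bar>t\<bar> > 4/5" for n t
  proof (cases "n = 0")
    case False
    have "open {t::real. \<bar>t\<bar> > 4/5}" by (intro open_Collect_less continuous_intros)
    from jet_vanish[OF P(1) this, of 0 t n] show ?thesis using P_out that False by auto
  qed (use P_out that in auto)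
  \<comment> \<open>The derivatives of \<open>p - 1\<close>. They are bounded on \<open>[-1, 1]\<close>, and \<open>P\<close> vanishes outside.\<close>
  define R where "R n t = (if n = 0 then - 2/3 - 2/3 * t\<^sup>2 else if n = 1 then - 4/3 * t
    else if n = 2 then - 4/3 else 0)" for n :: nat and t :: real
  have jR: "jet_at R t" for t
    unfolding jet_at_def
  proof
    fix n :: nat
    consider "n = 0" | "n = 1" | "n = 2" | "n \<ge> 3" by linarith
    then show "(R n has_real_derivative R (Suc n) t) (at t)"
      by cases (auto simp: R_def[abs_def] numeral_2_eq_2 intro!: derivative_eq_intros)
  qed
  have bR: "bounded_jets R {-1..1}"
  proof (rule bounded_jets_finite[of _ _ 2])
    fix t :: real assume "t \<in> {-1..1}"
    then have "0 \<le> t\<^sup>2" "t\<^sup>2 \<le> 1" "\<bar>t\<bar> \<le> 1" by (auto simp: abs_square_le_1)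
    moreover have "R 0 t = - 2/3 - 2/3 * t\<^sup>2" "R 1 t = - 4/3 * t" "R 2 t = - 4/3"
      by (simp_all add: R_def)
    ultimately show "\<bar>R 0 t\<bar> \<le> 2 \<and> \<bar>R 1 t\<bar> \<le> 2 \<and> \<bar>R 2 t\<bar> \<le> 2"
      by linarith
  qed (simp add: R_def)
  define L where "L = leibniz P R"
  have jL: "jet_at L t" for t unfolding L_def by (intro jet_at_leibniz P jR)
  have "bounded_jets L {-1..1}"
    unfolding L_def by (intro bounded_jets_leibniz bR bounded_jets_subset[OF P(2)]) auto
  then have bL: "bounded_jets L UNIV"
    by (rule bounded_jets_extend) (auto simp: L_def intro!: leibniz_0_left P_vanish)
  define Q where "Q n t = 1 * L n t + 1 * one n t" for n t
  have Q0: "Q 0 t = 1 + P 0 t * (- 2/3 - 2/3 * t\<^sup>2)" for t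
    by (simp add: Q_def L_def leibniz_def R_def one_def)
  show ?thesis
  proof (rule that[of Q])
    show "jet_at Q t" for t unfolding Q_def[abs_def] by (rule jet_at_lincomb jL one)+
    show "bounded_jets Q UNIV"
      unfolding Q_def[abs_def] by (rule bounded_jets_lincomb bL one)+
    show "Q 0 t = 1/3 - 2/3 * t\<^sup>2" if "\<bar>t\<bar> \<le> 3/4" for t using P_in[OF that] by (simp add: Q0)
    show "Q 0 t = 1" if "\<bar>t\<bar> \<ge> 4/5" for t using P_out[OF that] by (simp add: Q0)
    have "(1 - P 0 t) * (2/3 + 2/3 * t\<^sup>2) \<ge> 0" for t using P_bounds[of t] by (intro mult_nonneg_nonneg) auto
    moreover have "(1 - P 0 t) * (2/3 + 2/3 * t\<^sup>2) = Q 0 t - (1/3 - 2/3 * t\<^sup>2)" for t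
      by (simp add: Q0 field_simps)
    ultimately show "1/3 - 2/3 * t\<^sup>2 \<le> Q 0 t" for t by (metis diff_ge_0_iff_ge)
  qed
qed

end

section \<open>Globally Lipschitz ordinary differential equations\<close>

text \<open>
  The function \<open>|u - v|\<^sup>2 exp(-2 K t)\<close> is nonincreasing.
\<close>

lemma gronwall_forward:
  fixes F :: "'a::real_inner \<Rightarrow> 'a"
  assumes lip: "\<And>x y. norm (F x - F y) \<le> K * norm (x - y)"
    and u: "\<And>t. 0 \<le> t \<Longrightarrow> t \<le> T \<Longrightarrow> (u has_vector_derivative F (u t)) (at t)"
    and v: "\<And>t. 0 \<le> t \<Longrightarrow> t \<le> T \<Longrightarrow> (v has_vector_derivative F (v t)) (at t)"
    and "0 \<le> T"
  shows "norm (u T - v T) \<le> exp (K * T) * norm (u 0 - v 0)"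
proof -
  define e where "e t = ((u t - v t) \<bullet> (u t - v t)) * exp (-2 * K * t)" for t
  have "e T \<le> e 0"
  proof (rule DERIV_nonpos_imp_nonincreasing[OF \<open>0 \<le> T\<close>])
    fix t assume t: "0 \<le> t" "t \<le> T"
    define w where "w = F (u t) - F (v t)"
    have "((\<lambda>t. u t - v t) has_vector_derivative w) (at t)"
      unfolding w_def by (intro has_vector_derivative_diff u v t)
    then have "((\<lambda>t. u t - v t) has_derivative (\<lambda>h. h *\<^sub>R w)) (at t)"
      by (simp add: has_vector_derivative_def)
    then have d1: "((\<lambda>t. (u t - v t) \<bullet> (u t - v t)) has_real_derivative 2 * ((u t - v t) \<bullet> w)) (at t)"
      unfolding has_field_derivative_def
      by (intro has_derivative_eq_rhs[OF has_derivative_inner]) (auto simp: inner_commute)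
    have d2: "((\<lambda>t. exp (-2 * K * t)) has_real_derivative -2 * K * exp (-2 * K * t)) (at t)"
      by (auto intro!: derivative_eq_intros)
    have "(e has_real_derivative
        (2 * ((u t - v t) \<bullet> w) - 2 * K * ((u t - v t) \<bullet> (u t - v t))) * exp (-2 * K * t)) (at t)"
      unfolding e_def[abs_def] by (rule DERIV_cong[OF DERIV_mult[OF d1 d2]]) (simp add: algebra_simps)
    moreover have "(u t - v t) \<bullet> w \<le> K * ((u t - v t) \<bullet> (u t - v t))"
    proof -
      have "(u t - v t) \<bullet> w \<le> norm (u t - v t) * norm w" by (rule norm_cauchy_schwarz)
      also have "\<dots> \<le> norm (u t - v t) * (K * norm (u t - v t))"
        unfolding w_def by (intro mult_left_mono lip) auto
      also have "\<dots> = K * ((u t - v t) \<bullet> (u t - v t))"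
        by (simp add: dot_square_norm power2_eq_square)
      finally show ?thesis .
    qed
    then have "(2 * ((u t - v t) \<bullet> w) - 2 * K * ((u t - v t) \<bullet> (u t - v t))) * exp (-2 * K * t) \<le> 0"
      by (intro mult_nonpos_nonneg) auto
    ultimately show "\<exists>y. (e has_real_derivative y) (at t) \<and> y \<le> 0" by blast
  qed
  then have "(norm (u T - v T))\<^sup>2 * exp (-2 * K * T) \<le> (norm (u 0 - v 0))\<^sup>2"
    by (simp add: e_def dot_square_norm)
  then have "(norm (u T - v T))\<^sup>2 \<le> exp (2 * K * T) * (norm (u 0 - v 0))\<^sup>2"
    by (simp add: exp_minus field_simps)
  also have "\<dots> = (exp (K * T) * norm (u 0 - v 0))\<^sup>2"
    by (simp add: power_mult_distrib power2_eq_square flip: exp_add)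
  finally show ?thesis by (rule power2_le_imp_le) simp
qed

lemma has_vector_derivative_reflect:
  assumes "(u has_vector_derivative D) (at (- t))"
  shows "((\<lambda>t. u (- t)) has_vector_derivative - D) (at (t::real))"
proof -
  have "((u \<circ> uminus) has_vector_derivative (-1) *\<^sub>R D) (at t)"
    by (rule vector_diff_chain_at) (use assms in \<open>auto intro!: derivative_eq_intros\<close>)
  then show ?thesis by (simp add: o_def)
qed

lemma gronwall:
  fixes F :: "'a::real_inner \<Rightarrow> 'a"
  assumes lip: "\<And>x y. norm (F x - F y) \<le> K * norm (x - y)"
    and u: "\<And>t. (u has_vector_derivative F (u t)) (at t)"
    and v: "\<And>t. (v has_vector_derivative F (v t)) (at t)"
  shows "norm (u t - v t) \<le> exp (K * \<bar>t\<bar>) * norm (u 0 - v 0)"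
proof (cases "t \<ge> 0")
  case True
  then show ?thesis using gronwall_forward[OF lip u v, of t] by simp
next
  case False
  have "norm (u (- (- t)) - v (- (- t))) \<le> exp (K * (- t)) * norm (u (- 0) - v (- 0))"
  proof (rule gronwall_forward[where F = "\<lambda>x. - F x"])
    show "norm (- F x - - F y) \<le> K * norm (x - y)" for x y
      using lip[of x y] by (simp add: norm_minus_commute)
  qed (use False in \<open>auto intro!: has_vector_derivative_reflect u v\<close>)
  then show ?thesis using False by simp
qed

text \<open>
  Integration of the bound; negative times are treated by reflection.
\<close>

lemma picard_majorant:
  fixes f g :: "real \<Rightarrow> 'a::euclidean_space"
  assumes "f 0 = 0" and f: "\<And>t. (f has_vector_derivative g t) (at t)"
    and g: "\<And>t. norm (g t) \<le> c * \<bar>t\<bar> ^ n"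
  shows "norm (f t) \<le> c * \<bar>t\<bar> ^ Suc n / real (Suc n)"
proof -
  have fwd: "norm (f t) \<le> c * t ^ Suc n / real (Suc n)"
    if "t \<ge> 0" "f 0 = 0" "\<And>t. (f has_vector_derivative g t) (at t)"
      "\<And>t. norm (g t) \<le> c * \<bar>t\<bar> ^ n" for t and f g :: "real \<Rightarrow> 'a"
  proof (cases "t = 0")
    case False
    have "norm (f t - f 0) \<le> c * t ^ Suc n / real (Suc n) - c * 0 ^ Suc n / real (Suc n)"
    proof (rule differentiable_bound_general[where f' = g and \<phi>' = "\<lambda>t. c * t ^ n"])
      show "0 < t" using False that by simp
      show "continuous_on {0..t} f"
        using that(3) by (intro continuous_on_vector_derivative) (auto intro: has_vector_derivative_at_within)
      show "continuous_on {0..t} (\<lambda>t. c * t ^ Suc n / real (Suc n))" by (intro continuous_intros) auto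
      show "(f has_vector_derivative g x) (at x)" for x by (rule that)
      show "((\<lambda>t. c * t ^ Suc n / real (Suc n)) has_vector_derivative c * x ^ n) (at x)" for x
        unfolding has_real_derivative_iff_has_vector_derivative[symmetric]
        using DERIV_cdivide[OF DERIV_cmult[OF DERIV_pow[of "Suc n" x UNIV], of c], of "real (Suc n)"]
        by (simp del: of_nat_Suc power_Suc)
      show "norm (g x) \<le> c * x ^ n" if "0 < x" for x
        using \<open>\<And>t. norm (g t) \<le> c * \<bar>t\<bar> ^ n\<close>[of x] that by simp
    qed
    then show ?thesis using that(2) by simp
  qed (use that in auto)
  show ?thesis
  proof (cases "t \<ge> 0")
    case True
    then show ?thesis using fwd[OF True assms] by simp
  next
    case False
    have "norm (f (- (- t))) \<le> c * (- t) ^ Suc n / real (Suc n)"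
    proof (rule fwd[of "- t" "\<lambda>t. f (- t)" "\<lambda>t. - g (- t)"])
      show "norm (- g (- t)) \<le> c * \<bar>t\<bar> ^ n" for t using g[of "- t"] by simp
    qed (use False assms(1) in \<open>auto intro!: has_vector_derivative_reflect f\<close>)
    then show ?thesis using False by simp
  qed
qed

text \<open>
  Picard iteration. The differences of consecutive iterates are dominated by the terms
  \<open>K\<^sup>n |t|\<^sup>n\<^sup>+\<^sup>1 / (n + 1)!\<close> of an exponential series, so that the iterates and, by the Lipschitz
  condition, their derivatives converge uniformly on every interval \<open>[-T, T]\<close>.
\<close>

lemma lipschitz_ode_exists:
  fixes F :: "'a::euclidean_space \<Rightarrow> 'a"
  assumes lip: "\<And>x y. norm (F x - F y) \<le> K * norm (x - y)" and K: "K \<ge> 0"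
  obtains u where "u 0 = w" "\<And>t. (u has_vector_derivative F (u t)) (at t)"
proof -
  have contF: "continuous_on UNIV F"
    by (rule lipschitz_on_continuous_on[of K], rule lipschitz_onI) (use lip K in \<open>auto simp: dist_norm\<close>)
  have "\<exists>H. H 0 = w \<and> (\<forall>t. (H has_vector_derivative F (g t)) (at t))"
    if "continuous_on UNIV g" for g :: "real \<Rightarrow> 'a"
  proof -
    have "continuous_on UNIV (\<lambda>t. F (g t))"
      using continuous_on_compose2[OF contF that] by simp
    from antiderivative_exists[OF this] obtain H where "H 0 = 0"
      "\<And>t. (H has_vector_derivative F (g t)) (at t)" by blast
    then show ?thesis
      by (intro exI[of _ "\<lambda>t. w + H t"]) (auto intro!: derivative_eq_intros)
  qed
  then obtain step where step: "\<And>g. continuous_on UNIV g \<Longrightarrow> step g 0 = w"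
    "\<And>g t. continuous_on UNIV g \<Longrightarrow> (step g has_vector_derivative F (g t)) (at t)"
    by metis
  define y where "y n = (step ^^ n) (\<lambda>_. w)" for n
  have contS: "continuous_on UNIV (step g)" if "continuous_on UNIV g" for g
    using step(2)[OF that] by (intro continuous_on_vector_derivative) (auto intro: has_vector_derivative_at_within)
  have conty: "continuous_on UNIV (y n)" for n
    by (induction n) (auto simp: y_def intro: contS)
  have y_Suc: "(y (Suc n) has_vector_derivative F (y n t)) (at t)" for n t
    using step(2)[OF conty[of n]] by (simp add: y_def)
  have y0: "y n 0 = w" for n
    by (cases n) (auto simp: y_def intro!: step(1) conty[unfolded y_def])
  have y_first: "y 0 t = w" for t by (simp add: y_def)
  have diff: "norm (y (Suc n) t - y n t) \<le> norm (F w) * K ^ n * \<bar>t\<bar> ^ Suc n / fact (Suc n)" for n t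
  proof (induction n arbitrary: t)
    case 0
    have "norm (y 1 t - w) \<le> norm (F w) * \<bar>t\<bar> ^ Suc 0 / real (Suc 0)"
      by (rule picard_majorant[where g = "\<lambda>_. F w"])
         (use y_Suc[of 0] y0[of 1] in \<open>auto simp: y_first intro!: derivative_eq_intros\<close>)
    then show ?case by (simp add: y_first)
  next
    case (Suc n)
    have "norm (y (Suc (Suc n)) t - y (Suc n) t) \<le>
      (K * (norm (F w) * K ^ n / fact (Suc n))) * \<bar>t\<bar> ^ Suc (Suc n) / real (Suc (Suc n))"
    proof (rule picard_majorant[where g = "\<lambda>t. F (y (Suc n) t) - F (y n t)"])
      show "((\<lambda>t. y (Suc (Suc n)) t - y (Suc n) t) has_vector_derivative
          F (y (Suc n) t) - F (y n t)) (at t)" for t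
        by (intro has_vector_derivative_diff y_Suc)
      show "norm (F (y (Suc n) t) - F (y n t)) \<le> K * (norm (F w) * K ^ n / fact (Suc n)) * \<bar>t\<bar> ^ Suc n" for t
        using order_trans[OF lip mult_left_mono[OF Suc[of t] K]] by simp
    qed (simp add: y0)
    then show ?case by (simp add: field_simps)
  qed
  have ex: "\<exists>g. \<forall>t\<in>{-T..T}. (\<lambda>n. y n t) \<longlonglongrightarrow> g t \<and> (g has_vector_derivative F (g t)) (at t within {-T..T})"
    if T: "T > 0" for T
  proof -
    define b where "b n = norm (F w) * T * ((K * T) ^ n / fact n)" for n
    have "summable b"
      unfolding b_def using summable_exp[of "K * T"]
      by (intro summable_mult) (simp add: field_simps)
    have ydiff: "norm (y (Suc n) t - y n t) \<le> b n" if "t \<in> {-T..T}" for n t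
    proof -
      have "norm (y (Suc n) t - y n t) \<le> norm (F w) * K ^ n * \<bar>t\<bar> ^ Suc n / fact (Suc n)" by (rule diff)
      also have "\<dots> \<le> norm (F w) * K ^ n * T ^ Suc n / fact n"
        using that K by (intro frac_le mult_left_mono power_mono mult_nonneg_nonneg fact_mono) auto
      also have "\<dots> = b n" by (simp add: b_def field_simps)
      finally show ?thesis .
    qed
    have "uniformly_convergent_on {-T..T} (\<lambda>n t. \<Sum>i<n. y (Suc i) t - y i t)"
      by (rule Weierstrass_m_test'[OF ydiff \<open>summable b\<close>])
    moreover have "(\<Sum>i<n. y (Suc i) t - y i t) = y n t - w" for n t
      using sum_lessThan_telescope[of "\<lambda>i. y i t" n] by (simp add: y_first)
    ultimately have "uniformly_convergent_on {-T..T} (\<lambda>n t. y n t - w)" by simp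
    then obtain h where "uniform_limit {-T..T} (\<lambda>n t. y n t - w) h sequentially"
      by (auto simp: uniformly_convergent_on_def)
    then have "uniform_limit {-T..T} (\<lambda>n t. (y n t - w) + w) (\<lambda>t. h t + w) sequentially"
      by (intro uniform_limit_add uniform_limit_const)
    then obtain g where g: "uniform_limit {-T..T} y g sequentially" by auto
    have lim: "(\<lambda>n. y n t) \<longlonglongrightarrow> g t" if "t \<in> {-T..T}" for t
      using tendsto_uniform_limitI[OF g that] .
    have "\<exists>h. \<forall>t\<in>{-T..T}. (\<lambda>n. y (Suc n) t) \<longlonglongrightarrow> h t \<and>
        (h has_derivative (\<lambda>s. s *\<^sub>R F (g t))) (at t within {-T..T})"
    proof (rule has_derivative_sequence[where f' = "\<lambda>n t s. s *\<^sub>R F (y n t)" and ?x0.0 = 0 and l = w])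
      show "(y (Suc n) has_derivative (\<lambda>s. s *\<^sub>R F (y n t))) (at t within {-T..T})" for n t
        using has_vector_derivative_at_within[OF y_Suc] by (simp add: has_vector_derivative_def)
      show "(\<lambda>n. y (Suc n) 0) \<longlonglongrightarrow> w" by (simp add: y0)
      fix e :: real assume e: "e > 0"
      have "\<forall>\<^sub>F n in sequentially. \<forall>t\<in>{-T..T}. dist (y n t) (g t) < e / (K + 1)"
        using g e K by (intro uniform_limitD) auto
      then show "\<forall>\<^sub>F n in sequentially. \<forall>t\<in>{-T..T}. \<forall>s. norm (s *\<^sub>R F (y n t) - s *\<^sub>R F (g t)) \<le> e * norm s"
      proof (eventually_elim, intro ballI allI)
        fix n t s assume *: "\<forall>t\<in>{-T..T}. dist (y n t) (g t) < e / (K + 1)" and t: "t \<in> {-T..T}"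
        have "norm (F (y n t) - F (g t)) \<le> K * norm (y n t - g t)" by (rule lip)
        also have "\<dots> \<le> (K + 1) * (e / (K + 1))"
          using * t K by (intro mult_mono) (auto simp: dist_norm less_imp_le)
        also have "\<dots> = e" using K by simp
        finally show "norm (s *\<^sub>R F (y n t) - s *\<^sub>R F (g t)) \<le> e * norm s"
          by (metis abs_ge_zero mult.commute mult_left_mono norm_scaleR real_norm_def scaleR_right_diff_distrib)
      qed
    qed (use T in auto)
    then obtain h where h: "\<And>t. t \<in> {-T..T} \<Longrightarrow> (\<lambda>n. y (Suc n) t) \<longlonglongrightarrow> h t"
      "\<And>t. t \<in> {-T..T} \<Longrightarrow> (h has_derivative (\<lambda>s. s *\<^sub>R F (g t))) (at t within {-T..T})" by blast
    have "h t = g t" if "t \<in> {-T..T}" for t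
      using LIMSEQ_unique[OF h(1)[OF that] LIMSEQ_Suc[OF lim[OF that]]] .
    then show ?thesis using h by (intro exI[of _ h]) (auto simp: has_vector_derivative_def LIMSEQ_imp_Suc lim)
  qed
  define u where "u t = lim (\<lambda>n. y n t)" for t
  have "(u has_vector_derivative F (u t)) (at t)" for t
  proof -
    define T where "T = \<bar>t\<bar> + 1"
    have "T > 0" by (simp add: T_def)
    from ex[OF this] obtain g where g: "\<And>t. t \<in> {-T..T} \<Longrightarrow> (\<lambda>n. y n t) \<longlonglongrightarrow> g t"
      "\<And>t. t \<in> {-T..T} \<Longrightarrow> (g has_vector_derivative F (g t)) (at t within {-T..T})"
      by blast
    have ug: "u s = g s" if "s \<in> {-T..T}" for s
      unfolding u_def using g(1)[OF that] by (rule limI)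
    have t: "t \<in> {-T<..<T}" by (auto simp: T_def)
    have "(g has_vector_derivative F (g t)) (at t)"
      using g(2)[of t] t at_within_Icc_at[of "- T" t T] by auto
    then have "(g has_vector_derivative F (u t)) (at t)" using ug[of t] t by simp
    then show ?thesis
      by (rule has_vector_derivative_transform_within_open[of _ _ _ "{-T<..<T}"]) (use t ug in auto)
  qed
  moreover have "u 0 = w" by (simp add: u_def y0)
  ultimately show ?thesis by (rule that[rotated])
qed

section \<open>The hexagonal modification of the harmonic oscillator\<close>

text \<open>
  This inverts the relation between Newtonian time and arc length.
\<close>

lemma expanding_inverse:
  fixes f f' :: "real \<Rightarrow> real"
  assumes f: "\<And>t. (f has_real_derivative f' t) (at t)" and f': "\<And>t. f' t \<ge> c" and c: "c > 0"
  shows "f (inv f s) = s" "inv f (f t) = t"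
    "(inv f has_real_derivative 1 / f' (inv f s)) (at s)" "strict_mono (inv f)"
proof -
  have mono: "strict_mono f"
  proof (rule strict_monoI)
    fix s t :: real assume "s < t"
    then show "f s < f t"
      using f f' c by (intro DERIV_pos_imp_increasing[OF \<open>s < t\<close>]) (meson less_le_trans)
  qed
  have grow: "f t - c * t \<ge> f s - c * s" if "s \<le> t" for s t
    using f' by (intro DERIV_nonneg_imp_nondecreasing[OF that])
      (auto intro!: exI[of _ "f' _ - c"] derivative_eq_intros f)
  have cont: "continuous_on S f" for S
    using f by (intro DERIV_continuous_on) (auto intro: has_field_derivative_at_within)
  have "surj f"
    unfolding surj_def
  proof
    fix s
    define b where "b = (\<bar>s\<bar> + \<bar>f 0\<bar>) / c"
    have b: "b \<ge> 0" "c * b = \<bar>s\<bar> + \<bar>f 0\<bar>" using c by (auto simp: b_def)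
    have "\<exists>x\<ge>- b. x \<le> b \<and> f x = s"
      using grow[of 0 b] grow[of "- b" 0] b by (intro IVT' cont) auto
    then show "\<exists>x. s = f x" by blast
  qed
  define g where "g = inv f"
  have fg: "f (g s) = s" for s using \<open>surj f\<close> by (simp add: g_def surj_f_inv_f)
  have gf: "g (f t) = t" for t using strict_mono_imp_inj_on[OF mono] by (simp add: g_def)
  have "strict_mono g"
    using fg mono by (intro strict_monoI) (metis strict_mono_less)
  moreover have "(g has_real_derivative 1 / f' (g s)) (at s)" for s
  proof -
    have "isCont g s"
      by (rule isCont_inverse_function[of 1 "g s" g f, unfolded fg])
         (use gf f in \<open>auto intro: DERIV_isCont\<close>)
    moreover have "f' (g s) \<noteq> 0" using f'[of "g s"] c by linarith
    ultimately have "(g has_real_derivative inverse (f' (g s))) (at s)"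
      using DERIV_inverse_function[of f "f' (g s)" g s "s - 1" "s + 1"] f fg by auto
    then show ?thesis by (simp add: inverse_eq_divide)
  qed
  ultimately show "f (inv f s) = s" "inv f (f t) = t"
    "(inv f has_real_derivative 1 / f' (inv f s)) (at s)" "strict_mono (inv f)"
    using fg gf unfolding g_def by blast+
qed

text \<open>
  Unit vectors at the angles \<open>0\<close> and \<open>\<plusminus>60\<close> degrees.
\<close>

definition hexdir :: "nat \<Rightarrow> complex" where
  "hexdir k = (if k = 0 then 1 else if k = 1 then Complex (1/2) (sqrt 3 / 2) else Complex (1/2) (- (sqrt 3 / 2)))"

lemma hexdir_simps [simp]: "hexdir 0 = 1" "hexdir (Suc 0) = Complex (1/2) (sqrt 3 / 2)"
  "hexdir 2 = Complex (1/2) (- (sqrt 3 / 2))"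
  by (auto simp: hexdir_def)

lemma sum_lessThan_3: "(\<Sum>k<3. f k) = f 0 + f 1 + f (2::nat)"
  by (simp add: eval_nat_numeral)

lemma hexdir_add: "hexdir 1 + hexdir 2 = hexdir 0"
  by (simp add: complex_eq_iff)

lemma inner_hexdir_add: "hexdir 1 \<bullet> x + hexdir 2 \<bullet> x = hexdir 0 \<bullet> x"
  by (metis hexdir_add inner_add_left)

lemma norm_hexdir: "norm (hexdir k) = 1"
  by (simp add: hexdir_def cmod_def power_divide)

text \<open>
  The three directions form a tight frame, which makes the sum of plane waves with quadratic profile
  rotationally symmetric.
\<close>

lemma hexdir_frame: "(\<Sum>k<3. (hexdir k \<bullet> x) *\<^sub>R hexdir k) = (3/2) *\<^sub>R x"
  by (simp add: sum_lessThan_3 complex_eq_iff inner_complex_def algebra_simps)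

lemma hexdir_tight: "(\<Sum>k<3. (hexdir k \<bullet> x)\<^sup>2) = 3/2 * (norm x)\<^sup>2"
proof -
  have "(\<Sum>k<3. (hexdir k \<bullet> x)\<^sup>2) = (\<Sum>k<3. (hexdir k \<bullet> x) *\<^sub>R hexdir k) \<bullet> x"
    by (simp add: inner_sum_left power2_eq_square)
  then show ?thesis by (simp add: hexdir_frame dot_square_norm)
qed

lemma abs_inner_hexdir: "\<bar>hexdir k \<bullet> x\<bar> \<le> norm x"
  using Cauchy_Schwarz_ineq2[of "hexdir k" x] by (simp add: norm_hexdir)

type_synonym phase = "complex \<times> complex"

text \<open>
  The thresholds satisfy \<open>1/2 < (3/4)\<^sup>2\<close>, so that the circular orbit of the oscillator, of radius
  \<open>1/\<surd>2\<close>, and the orbits near it lie where \<open>q\<close> is quadratic, and \<open>4/3 (4/5)\<^sup>2 < 1\<close>, so that the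
  hexagon \<open>|u\<^sub>k \<bullet> x| \<le> 4/5\<close>, whose corners have \<open>|x|\<^sup>2 = 4/3 (4/5)\<^sup>2\<close>, lies in the unit disc.
\<close>

locale oscillator =
  fixes q q' :: "real \<Rightarrow> real" and K :: real
  assumes q_deriv: "\<And>t. (q has_real_derivative q' t) (at t)"
    and q'_lip: "\<And>s t. \<bar>q' s - q' t\<bar> \<le> K * \<bar>s - t\<bar>"
    and q_in: "\<And>t. \<bar>t\<bar> \<le> 3/4 \<Longrightarrow> q t = 1/3 - 2/3 * t\<^sup>2"
    and q_out: "\<And>t. \<bar>t\<bar> \<ge> 4/5 \<Longrightarrow> q t = 1"
    and q_lower: "\<And>t. 1/3 - 2/3 * t\<^sup>2 \<le> q t"
begin

definition G :: "complex \<Rightarrow> real" where "G x = (\<Sum>k<3. q (hexdir k \<bullet> x))"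
definition gradG :: "complex \<Rightarrow> complex" where "gradG x = (\<Sum>k<3. q' (hexdir k \<bullet> x) *\<^sub>R hexdir k)"
text \<open>
  Newton's equation \<open>x'' = \<nabla>G / 2\<close> as a first order system for position and velocity.
\<close>

definition newton_field :: "phase \<Rightarrow> phase" where "newton_field w = (snd w, (1/2) *\<^sub>R gradG (fst w))"

lemma G_has_derivative: "(G has_derivative (\<lambda>h. gradG x \<bullet> h)) (at x)"
proof -
  have "((\<lambda>x. q (hexdir k \<bullet> x)) has_derivative (\<lambda>h. (hexdir k \<bullet> h) *\<^sub>R q' (hexdir k \<bullet> x))) (at x)" for k
    by (rule has_derivative_compose[where g = q, of "\<lambda>x. hexdir k \<bullet> x"])
       (use q_deriv in \<open>auto intro!: derivative_eq_intros simp: has_field_derivative_def mult_commute_abs\<close>)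
  then show ?thesis
    unfolding G_def[abs_def] gradG_def inner_sum_left
    by (intro has_derivative_sum) (simp add: mult.commute)
qed

lemma G_continuous: "continuous_on S G"
  using G_has_derivative by (meson has_derivative_continuous continuous_at_imp_continuous_on)

lemma q_ge: "q t \<ge> - (7/75)"
proof (cases "\<bar>t\<bar> \<ge> 4/5")
  case False
  then have "t\<^sup>2 \<le> (4/5)\<^sup>2" by (intro power2_le_iff_abs_le[THEN iffD2]) auto
  then show ?thesis using q_lower[of t] by (simp add: power2_eq_square)
qed (use q_out in auto)

text \<open>
  If some \<open>|u\<^sub>k \<bullet> x| \<ge> 4/5\<close>, one summand is \<open>1\<close> and the others are at least \<open>-7/75\<close>. Otherwise
  \<open>G \<ge> 1 - 2/3 (a\<^sup>2 + b\<^sup>2 + c\<^sup>2)\<close> with \<open>a = b + c\<close>; two of the numbers \<open>b, c, -a\<close>, which add up to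
  \<open>0\<close>, have the same sign, and the sum of their squares is at most the square of the third.
\<close>

lemma G_lower: "G x \<ge> 1/10"
proof -
  define a b c where "a = hexdir 0 \<bullet> x" and "b = hexdir 1 \<bullet> x" and "c = hexdir 2 \<bullet> x"
  have abc: "a = b + c" using inner_hexdir_add[of x] by (simp add: a_def b_def c_def)
  have G: "G x = q a + q b + q c" by (simp add: G_def sum_lessThan_3 a_def b_def c_def)
  show ?thesis
  proof (cases "\<bar>a\<bar> \<ge> 4/5 \<or> \<bar>b\<bar> \<ge> 4/5 \<or> \<bar>c\<bar> \<ge> 4/5")
    case True
    then show ?thesis
      using q_ge[of a] q_ge[of b] q_ge[of c] q_out[of a] q_out[of b] q_out[of c]
      unfolding G by linarith
  next
    case False
    have sq: "t\<^sup>2 \<le> 16/25" if "\<bar>t\<bar> < 4/5" for t :: real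
    proof -
      have "t\<^sup>2 \<le> (4/5)\<^sup>2" using that by (intro power2_le_iff_abs_le[THEN iffD2]) auto
      then show ?thesis by (simp add: power2_eq_square)
    qed
    have two: "r\<^sup>2 + s\<^sup>2 \<le> (r + s)\<^sup>2" if "r * s \<ge> 0" for r s :: real
      using that by (simp add: power2_sum)
    have "a\<^sup>2 + b\<^sup>2 + c\<^sup>2 \<le> 32/25"
    proof -
      consider "b * c \<ge> 0" | "a * (- c) \<ge> 0" | "a * (- b) \<ge> 0"
        unfolding abc by (cases "b \<ge> 0"; cases "c \<ge> 0"; cases "b + c \<ge> 0")
          (auto simp: zero_le_mult_iff mult_le_0_iff)
      then show ?thesis
      proof cases
        case 1
        then have "b\<^sup>2 + c\<^sup>2 \<le> a\<^sup>2" unfolding abc by (rule two)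
        then show ?thesis using sq[of a] False by auto
      next
        case 2
        then have "a\<^sup>2 + c\<^sup>2 \<le> b\<^sup>2" using two[OF 2] by (simp add: abc)
        then show ?thesis using sq[of b] False by auto
      next
        case 3
        then have "a\<^sup>2 + b\<^sup>2 \<le> c\<^sup>2" using two[OF 3] by (simp add: abc)
        then show ?thesis using sq[of c] False by auto
      qed
    qed
    then show ?thesis using q_lower[of a] q_lower[of b] q_lower[of c] unfolding G by linarith
  qed
qed

lemma G_pos: "G x > 0" using G_lower[of x] by linarith

lemma K_nonneg: "K \<ge> 0" using q'_lip[of 1 0] by simp

lemma newton_field_lip: "norm (newton_field w - newton_field w') \<le> (1 + 3/2 * K) * norm (w - w')"
proof -
  have "norm (gradG x - gradG y) \<le> 3 * K * norm (x - y)" for x y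
  proof -
    have "gradG x - gradG y = (\<Sum>k<3. (q' (hexdir k \<bullet> x) - q' (hexdir k \<bullet> y)) *\<^sub>R hexdir k)"
      by (simp add: gradG_def sum_subtractf algebra_simps)
    also have "norm \<dots> \<le> (\<Sum>k<3::nat. K * norm (x - y))"
    proof (intro order_trans[OF norm_sum] sum_mono)
      fix k
      have "norm ((q' (hexdir k \<bullet> x) - q' (hexdir k \<bullet> y)) *\<^sub>R hexdir k) \<le> K * \<bar>hexdir k \<bullet> x - hexdir k \<bullet> y\<bar>"
        by (simp add: norm_hexdir q'_lip)
      also have "\<dots> \<le> K * norm (x - y)"
        using abs_inner_hexdir[of k "x - y"] K_nonneg by (intro mult_left_mono) (auto simp: inner_diff_right)
      finally show "norm ((q' (hexdir k \<bullet> x) - q' (hexdir k \<bullet> y)) *\<^sub>R hexdir k) \<le> K * norm (x - y)" .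
    qed
    finally show ?thesis by simp
  qed
  note grad = this[of "fst w" "fst w'"]
  have "norm (newton_field w - newton_field w') \<le> norm (snd w - snd w') + norm ((1/2) *\<^sub>R (gradG (fst w) - gradG (fst w')))"
    unfolding newton_field_def by (simp add: norm_Pair_le flip: scaleR_right_diff_distrib del: norm_scaleR)
  also have "\<dots> \<le> norm (snd w - snd w') + 1/2 * (3 * K * norm (fst w - fst w'))"
    using grad by simp
  also have "\<dots> \<le> norm (w - w') + 1/2 * (3 * K * norm (w - w'))"
    using norm_snd_le[of "snd (w - w')" "fst (w - w')"] norm_fst_le[of "fst (w - w')" "snd (w - w')"] K_nonneg
    by (intro add_mono mult_left_mono) (auto simp flip: fst_diff snd_diff simp del: fst_diff snd_diff)
  finally show ?thesis by (simp add: algebra_simps)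
qed

lemma newton_exists: "\<exists>u. u 0 = w \<and> (\<forall>t. (u has_vector_derivative newton_field (u t)) (at t))"
  by (rule lipschitz_ode_exists[OF newton_field_lip, of w]) (use K_nonneg in auto)

definition newton :: "phase \<Rightarrow> real \<Rightarrow> phase" where
  "newton w = (SOME u. u 0 = w \<and> (\<forall>t. (u has_vector_derivative newton_field (u t)) (at t)))"

lemma newton_0 [simp]: "newton w 0 = w"
  and newton_deriv: "(newton w has_vector_derivative newton_field (newton w t)) (at t)"
  using someI_ex[OF newton_exists[of w]] unfolding newton_def by auto

lemma newton_eq_forward:
  assumes "\<And>t. t \<ge> 0 \<Longrightarrow> (u has_vector_derivative newton_field (u t)) (at t)" "u 0 = w" "t \<ge> 0"
  shows "newton w t = u t"
proof -
  have "norm (newton w t - u t) \<le> exp ((1 + 3/2 * K) * t) * norm (newton w 0 - u 0)"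
    by (rule gronwall_forward[OF newton_field_lip newton_deriv assms(1) assms(3)]) auto
  then show ?thesis using assms(2) by simp
qed

lemma newton_continuous: "continuous_on UNIV (\<lambda>p. newton (snd p) (fst p))"
proof (rule continuous_at_imp_continuous_on, rule ballI)
  fix p :: "real \<times> phase"
  define t w where "t = fst p" and "w = snd p"
  have "isCont (newton w) t"
    using newton_deriv by (rule has_vector_derivative_continuous)
  then have "((\<lambda>p. newton w (fst p)) \<longlongrightarrow> newton w t) (at p)"
    using isCont_tendsto_compose[of t "newton w" fst "at p"] by (simp add: t_def tendsto_fst)
  moreover have "((\<lambda>p. newton (snd p) (fst p) - newton w (fst p)) \<longlongrightarrow> 0) (at p)"
  proof (rule Lim_null_comparison)
    show "\<forall>\<^sub>F p in at p. norm (newton (snd p) (fst p) - newton w (fst p))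
        \<le> exp ((1 + 3/2 * K) * \<bar>fst p\<bar>) * norm (snd p - w)"
      using gronwall[OF newton_field_lip newton_deriv newton_deriv] by (intro always_eventually) (metis newton_0)
    have "((\<lambda>p. exp ((1 + 3/2 * K) * \<bar>fst p\<bar>) * norm (snd p - w)) \<longlongrightarrow>
        exp ((1 + 3/2 * K) * \<bar>fst p\<bar>) * norm (snd p - w)) (at p)"
      by (intro tendsto_intros)
    then show "((\<lambda>p. exp ((1 + 3/2 * K) * \<bar>fst p\<bar>) * norm (snd p - w)) \<longlongrightarrow> 0) (at p)"
      by (simp add: w_def)
  qed
  ultimately have "((\<lambda>p. newton (snd p) (fst p)) \<longlongrightarrow> newton w t) (at p)"
    using tendsto_add by fastforce
  then show "isCont (\<lambda>p. newton (snd p) (fst p)) p"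
    by (simp add: isCont_def t_def w_def)
qed

lemma newton_components:
  shows "((\<lambda>t. fst (newton w t)) has_vector_derivative snd (newton w t)) (at t)"
    and "((\<lambda>t. snd (newton w t)) has_vector_derivative (1/2) *\<^sub>R gradG (fst (newton w t))) (at t)"
  using bounded_linear.has_vector_derivative[OF bounded_linear_fst newton_deriv[of w t]]
    bounded_linear.has_vector_derivative[OF bounded_linear_snd newton_deriv[of w t]]
  by (auto simp: newton_field_def)

text \<open>
  Thus trajectories that start with \<open>|x'|\<^sup>2 = G\<close>, those which correspond to geodesics, keep this
  property.
\<close>

lemma newton_energy:
  "(norm (snd (newton w t)))\<^sup>2 - G (fst (newton w t)) = (norm (snd w))\<^sup>2 - G (fst w)"
proof -
  define e where "e t = snd (newton w t) \<bullet> snd (newton w t) - G (fst (newton w t))" for t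
  have "(e has_real_derivative 0) (at t)" for t
  proof -
    define x \<eta> where "x = fst (newton w t)" and "\<eta> = snd (newton w t)"
    have 1: "((\<lambda>t. snd (newton w t)) has_derivative (\<lambda>h. h *\<^sub>R (1/2) *\<^sub>R gradG x)) (at t)"
      and 2: "((\<lambda>t. fst (newton w t)) has_derivative (\<lambda>h. h *\<^sub>R \<eta>)) (at t)"
      using newton_components[of w t] by (auto simp: has_vector_derivative_def x_def \<eta>_def)
    have "(e has_derivative (\<lambda>h. (\<eta> \<bullet> (h *\<^sub>R (1/2) *\<^sub>R gradG x) + (h *\<^sub>R (1/2) *\<^sub>R gradG x) \<bullet> \<eta>)
        - gradG x \<bullet> (h *\<^sub>R \<eta>))) (at t)"
      unfolding e_def[abs_def] \<eta>_def x_def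
      by (intro has_derivative_diff has_derivative_inner 1[unfolded x_def]
          has_derivative_compose[OF 2[unfolded \<eta>_def] G_has_derivative])
    then show ?thesis
      unfolding has_field_derivative_def
      by (rule has_derivative_eq_rhs) (auto simp: inner_commute)
  qed
  then have "e t = e 0" by (intro DERIV_isconst_all) auto
  then show ?thesis by (simp add: e_def dot_square_norm)
qed

text \<open>
  For times in a compact interval the periodicity condition is closed, by joint continuity.
\<close>

lemma closed_periodic:
  "closed {w. \<exists>t\<in>{a..b}. newton w t = w}"
  unfolding closed_sequential_limits
proof (intro allI impI, elim conjE)
  fix s l assume s: "\<forall>n. s n \<in> {w. \<exists>t\<in>{a..b}. newton w t = w}" and l: "s \<longlonglongrightarrow> l"
  then have "\<forall>n. \<exists>t. t \<in> {a..b} \<and> newton (s n) t = s n" by blast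
  then obtain t where t: "\<And>n. t n \<in> {a..b}" "\<And>n. newton (s n) (t n) = s n" by metis
  have "seq_compact {a..b}" by (simp add: compact_imp_seq_compact)
  then obtain r \<tau> where r: "strict_mono r" "\<tau> \<in> {a..b}" "(t \<circ> r) \<longlonglongrightarrow> \<tau>"
    using t(1) unfolding seq_compact_def by metis
  have sr: "(s \<circ> r) \<longlonglongrightarrow> l" using l r(1) by (rule LIMSEQ_subseq_LIMSEQ)
  have "(\<lambda>n. newton (snd (t (r n), s (r n))) (fst (t (r n), s (r n)))) \<longlonglongrightarrow> newton (snd (\<tau>, l)) (fst (\<tau>, l))"
    using newton_continuous r(3) sr unfolding o_def
    by (intro continuous_on_tendsto_compose[OF newton_continuous] tendsto_Pair) auto
  then have "(\<lambda>n. s (r n)) \<longlonglongrightarrow> newton l \<tau>" by (simp add: t(2))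
  then have "newton l \<tau> = l" using sr LIMSEQ_unique unfolding o_def by blast
  then show "l \<in> {w. \<exists>t\<in>{a..b}. newton w t = w}" using r(2) by blast
qed

lemma borel_periodic: "{w. \<exists>t>0. newton w t = w} \<in> sets borel"
proof -
  have "{w. \<exists>t>0. newton w t = w} = (\<Union>n. {w. \<exists>t\<in>{1 / real (Suc n)..real n}. newton w t = w})"
  proof (intro equalityI subsetI)
    fix w assume "w \<in> {w. \<exists>t>0. newton w t = w}"
    then obtain t where t: "t > 0" "newton w t = w" by blast
    obtain n1 where n1: "1 / real (Suc n1) < t" using t(1) nat_approx_posE by blast
    obtain n2 where n2: "t \<le> real n2" using real_arch_simple by blast
    have "1 / real (Suc (max n1 n2)) \<le> 1 / real (Suc n1)" by (intro divide_left_mono) auto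
    then have "t \<in> {1 / real (Suc (max n1 n2))..real (max n1 n2)}" using n1 n2 by auto
    then show "w \<in> (\<Union>n. {w. \<exists>t\<in>{1 / real (Suc n)..real n}. newton w t = w})" using t(2) by blast
  next
    fix w assume "w \<in> (\<Union>n. {w. \<exists>t\<in>{1 / real (Suc n)..real n}. newton w t = w})"
    then obtain n t where "t \<ge> 1 / real (Suc n)" "newton w t = w" by auto
    moreover have "1 / real (Suc n) > 0" by simp
    ultimately show "w \<in> {w. \<exists>t>0. newton w t = w}" by (metis (mono_tags) less_le_trans mem_Collect_eq)
  qed
  also have "\<dots> \<in> sets borel" by (intro sets.countable_UN) (auto intro!: borel_closed closed_periodic)
  finally show ?thesis .
qed

section \<open>Geodesics as reparametrized Newtonian trajectories\<close>

lemma clock_exists: "\<exists>c. c 0 = 0 \<and> (\<forall>t. (c has_real_derivative G (fst (newton w t))) (at t))"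
proof -
  have "continuous_on UNIV (\<lambda>t. fst (newton w t))"
    using has_vector_derivative_continuous[OF newton_components(1)]
    by (intro continuous_at_imp_continuous_on) auto
  then have "continuous_on UNIV (\<lambda>t. G (fst (newton w t)))"
    by (rule continuous_on_compose2[OF G_continuous]) auto
  from antiderivative_exists[OF this] show ?thesis
    unfolding has_real_derivative_iff_has_vector_derivative by metis
qed

text \<open>
  For a trajectory with \<open>|x'|\<^sup>2 = G\<close> this is the Riemannian arc length as a function of the Newtonian
  time; \<open>tick\<close> is its inverse.
\<close>

definition clock :: "phase \<Rightarrow> real \<Rightarrow> real" where
  "clock w = (SOME c. c 0 = 0 \<and> (\<forall>t. (c has_real_derivative G (fst (newton w t))) (at t)))"

lemma clock_0 [simp]: "clock w 0 = 0"
  and clock_deriv: "(clock w has_real_derivative G (fst (newton w t))) (at t)"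
  using someI_ex[OF clock_exists[of w]] unfolding clock_def by auto

definition tick :: "phase \<Rightarrow> real \<Rightarrow> real" where "tick w = inv (clock w)"

lemma tick_clock: "tick w (clock w t) = t"
  and tick_deriv: "(tick w has_real_derivative 1 / G (fst (newton w (tick w s)))) (at s)"
  and tick_mono: "strict_mono (tick w)"
  unfolding tick_def
  using expanding_inverse[where f = "clock w" and c = "1/10", OF clock_deriv G_lower] by auto

lemma tick_0 [simp]: "tick w 0 = 0" using tick_clock[of w 0] by simp

lemma tick_pos: "s > 0 \<Longrightarrow> tick w s > 0"
  using tick_mono[of w] by (metis strict_mono_less tick_0)

text \<open>
  Here \<open>speed\<close> is the Hamiltonian \<open>h\<close>. As \<open>h\<close> is homogeneous of degree 1 in the covector, the geodesic
  flow commutes with scaling of the covector, so \<open>geo\<close> normalizes to \<open>h = 1\<close>, follows the Newtonian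
  trajectory reparametrized by arc length, and scales back.
\<close>

definition speed :: "phase \<Rightarrow> real" where "speed z = norm (snd z) / sqrt (G (fst z))"
definition rescale :: "phase \<Rightarrow> phase" where "rescale z = (fst z, snd z /\<^sub>R speed z)"
definition geo :: "real \<Rightarrow> phase \<Rightarrow> phase" where
  "geo s z = (let p = newton (rescale z) (tick (rescale z) s) in (fst p, speed z *\<^sub>R snd p))"

lemma speed_pos: "snd z \<noteq> 0 \<Longrightarrow> speed z > 0"
  using G_pos by (simp add: speed_def)

lemma norm_rescale: "snd z \<noteq> 0 \<Longrightarrow> (norm (snd (rescale z)))\<^sup>2 = G (fst z)"
  using G_pos[of "fst z"] speed_pos[of z]
  by (simp add: rescale_def speed_def power_mult_distrib power_divide less_imp_le)

lemma geo_0: "snd z \<noteq> 0 \<Longrightarrow> geo 0 z = z"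
  using speed_pos[of z] by (simp add: geo_def rescale_def)

lemma geo_energy:
  assumes "snd z \<noteq> 0"
  shows "norm (snd (geo s z)) = speed z * sqrt (G (fst (geo s z)))"
proof -
  have "(norm (snd (newton (rescale z) t)))\<^sup>2 = G (fst (newton (rescale z) t))" for t
    using newton_energy[of "rescale z" t] norm_rescale[OF assms] by (simp add: rescale_def)
  then have "norm (snd (newton (rescale z) t)) = sqrt (G (fst (newton (rescale z) t)))" for t
    by (metis norm_ge_zero real_sqrt_unique)
  then show ?thesis using speed_pos[OF assms] by (simp add: geo_def Let_def)
qed

lemma geo_nonzero: "snd z \<noteq> 0 \<Longrightarrow> snd (geo s z) \<noteq> 0"
  using geo_energy[of z s] speed_pos[of z] G_pos[of "fst (geo s z)"] by auto

text \<open>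
  Hamilton's equations for \<open>h(x, \<xi>) = |\<xi>| / \<surd>G(x)\<close>. With \<open>\<xi> = E x'\<close>, where \<open>E\<close> is the value of \<open>h\<close>,
  conservation of energy gives \<open>|\<xi>| = E \<surd>G\<close>; the time change divides Newton's equation by \<open>G\<close>.
\<close>

lemma geo_Hamilton:
  assumes "snd z \<noteq> 0"
  defines "x \<equiv> \<lambda>s. fst (geo s z)" and "\<xi> \<equiv> \<lambda>s. snd (geo s z)"
  shows "(x has_vector_derivative (1 / (sqrt (G (x s)) * norm (\<xi> s))) *\<^sub>R \<xi> s) (at s)"
    and "(\<xi> has_vector_derivative (norm (\<xi> s) / (2 * sqrt (G (x s)) ^ 3)) *\<^sub>R gradG (x s)) (at s)"
proof -
  define w E p where "w = rescale z" and "E = speed z" and "p = newton w (tick w s)"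
  have E: "E > 0" using speed_pos[OF assms(1)] by (simp add: E_def)
  have xs: "x s = fst p" and \<xi>s: "\<xi> s = E *\<^sub>R snd p"
    by (simp_all add: x_def \<xi>_def geo_def p_def w_def E_def Let_def)
  define g where "g = sqrt (G (x s))"
  have g: "g > 0" "g\<^sup>2 = G (x s)" using G_pos by (simp_all add: g_def less_imp_le)
  have norm: "norm (\<xi> s) = E * g"
    using geo_energy[OF assms(1), of s] by (simp add: x_def \<xi>_def E_def g_def)
  have tick: "(tick w has_vector_derivative 1 / G (x s)) (at s)"
    using tick_deriv[of w s] by (simp add: xs p_def has_real_derivative_iff_has_vector_derivative)
  have "((\<lambda>t. fst (newton w t)) \<circ> tick w has_vector_derivative (1 / G (x s)) *\<^sub>R snd p) (at s)"
    using tick newton_components(1) unfolding p_def by (rule vector_diff_chain_at)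
  moreover have "(\<lambda>t. fst (newton w t)) \<circ> tick w = x"
    by (auto simp: x_def geo_def w_def Let_def)
  moreover have "(1 / (sqrt (G (x s)) * norm (\<xi> s))) *\<^sub>R \<xi> s = (1 / G (x s)) *\<^sub>R snd p"
    using E g(1) unfolding norm g_def[symmetric] g(2)[symmetric] unfolding \<xi>s by (simp add: power2_eq_square)
  ultimately show "(x has_vector_derivative (1 / (sqrt (G (x s)) * norm (\<xi> s))) *\<^sub>R \<xi> s) (at s)" by simp
  have "((\<lambda>t. snd (newton w t)) \<circ> tick w has_vector_derivative (1 / G (x s)) *\<^sub>R (1/2) *\<^sub>R gradG (x s)) (at s)"
    using tick newton_components(2)[of w "tick w s"] unfolding xs p_def by (rule vector_diff_chain_at)
  then have "((\<lambda>s. E *\<^sub>R ((\<lambda>t. snd (newton w t)) \<circ> tick w) s) has_vector_derivative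
      E *\<^sub>R (1 / G (x s)) *\<^sub>R (1/2) *\<^sub>R gradG (x s)) (at s)"
    by (rule bounded_linear.has_vector_derivative[OF bounded_linear_scaleR_right])
  moreover have "(\<lambda>s. E *\<^sub>R ((\<lambda>t. snd (newton w t)) \<circ> tick w) s) = \<xi>"
    by (auto simp: \<xi>_def geo_def w_def E_def Let_def)
  moreover have "(norm (\<xi> s) / (2 * sqrt (G (x s)) ^ 3)) *\<^sub>R gradG (x s) =
      E *\<^sub>R (1 / G (x s)) *\<^sub>R (1/2) *\<^sub>R gradG (x s)"
    using E g(1) unfolding norm g_def[symmetric] g(2)[symmetric]
    by (simp add: power2_eq_square power3_eq_cube)
  ultimately show "(\<xi> has_vector_derivative (norm (\<xi> s) / (2 * sqrt (G (x s)) ^ 3)) *\<^sub>R gradG (x s)) (at s)"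
    by (simp only:)
qed

lemma geo_periodic_iff:
  assumes "snd z \<noteq> 0"
  shows "(\<exists>s>0. geo s z = z) \<longleftrightarrow> (\<exists>t>0. newton (rescale z) t = rescale z)"
proof -
  have "geo s z = z \<longleftrightarrow> newton (rescale z) (tick (rescale z) s) = rescale z" for s
  proof -
    have "speed z *\<^sub>R v = snd z \<longleftrightarrow> v = snd z /\<^sub>R speed z" for v
      using speed_pos[OF assms] by (auto dest!: sym[of _ "snd z"])
    then show ?thesis by (auto simp: geo_def Let_def prod_eq_iff rescale_def)
  qed
  moreover have "\<exists>s>0. tick (rescale z) s = t" if "t > 0" for t
  proof (intro exI conjI)
    show "tick (rescale z) (clock (rescale z) t) = t" by (rule tick_clock)
    then show "clock (rescale z) t > 0"
      using that tick_mono[of "rescale z"] by (metis strict_mono_less tick_0)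
  qed
  ultimately show ?thesis using tick_pos by metis
qed

text \<open>
  The left-hand side is the squared amplitude of the oscillation of the coordinate \<open>u\<^sub>k \<bullet> x\<close>, so the
  condition says that the whole ellipse stays where all three profiles are quadratic. It is preserved
  along the orbit.
\<close>

definition elliptic :: "phase set" where
  "elliptic = {w. \<forall>k<3. (hexdir k \<bullet> fst w)\<^sup>2 + (hexdir k \<bullet> snd w)\<^sup>2 < 9/16}"

text \<open>
  Both \<open>u\<^sub>1 \<bullet> x\<close> and \<open>u\<^sub>2 \<bullet> x\<close> are beyond \<open>4/5\<close> and increasing; so is their sum \<open>u\<^sub>0 \<bullet> x\<close>, and all three
  profiles are constant for all later times.
\<close>

definition escaping :: "phase set" where
  "escaping = {w. \<forall>k\<in>{1,2}. hexdir k \<bullet> fst w > 4/5 \<and> hexdir k \<bullet> snd w > 0}"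

lemma G_elliptic:
  assumes "\<And>k. k < 3 \<Longrightarrow> \<bar>hexdir k \<bullet> x\<bar> < 3/4"
  shows "G x = 1 - (norm x)\<^sup>2" "gradG x = -2 *\<^sub>R x"
proof -
  have q: "q (hexdir k \<bullet> x) = 1/3 - 2/3 * (hexdir k \<bullet> x)\<^sup>2" if "k < 3" for k
    using assms[OF that] by (intro q_in) auto
  have "G x = 1 - 2/3 * (\<Sum>k<3. (hexdir k \<bullet> x)\<^sup>2)"
    by (simp add: G_def sum_lessThan_3 q algebra_simps)
  then show "G x = 1 - (norm x)\<^sup>2" by (simp add: hexdir_tight)
  have "q' t = - 4/3 * t" if "\<bar>t\<bar> < 3/4" for t
  proof -
    have "((\<lambda>t. 1/3 - 2/3 * t\<^sup>2) has_real_derivative - 4/3 * t) (at t)"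
      by (auto intro!: derivative_eq_intros)
    then have "(q has_real_derivative - 4/3 * t) (at t)"
      by (rule has_field_derivative_transform_within_open[of _ _ _ "{-3/4<..<3/4}"])
         (use that in \<open>auto simp: q_in abs_le_iff abs_less_iff\<close>)
    then show ?thesis using q_deriv DERIV_unique by blast
  qed
  then have "q' (hexdir k \<bullet> x) *\<^sub>R hexdir k = (- 4/3) *\<^sub>R (hexdir k \<bullet> x) *\<^sub>R hexdir k" if "k < 3" for k
    using assms[OF that] by simp
  then have "gradG x = (- 4/3) *\<^sub>R (\<Sum>k<3. (hexdir k \<bullet> x) *\<^sub>R hexdir k)"
    unfolding gradG_def scaleR_sum_right by (intro sum.cong) auto
  then show "gradG x = -2 *\<^sub>R x" by (simp add: hexdir_frame)
qed

lemma elliptic_orbit: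
  assumes w: "(x, \<eta>) \<in> elliptic"
  defines "X \<equiv> \<lambda>t. cos t *\<^sub>R x + sin t *\<^sub>R \<eta>"
  shows "t \<ge> 0 \<Longrightarrow> newton (x, \<eta>) t = (X t, cos t *\<^sub>R \<eta> - sin t *\<^sub>R x)"
    and "k < 3 \<Longrightarrow> \<bar>hexdir k \<bullet> X t\<bar> < 3/4"
proof -
  show inside: "\<bar>hexdir k \<bullet> X t\<bar> < 3/4" if k: "k < 3" for k t
  proof -
    define a b where "a = hexdir k \<bullet> x" and "b = hexdir k \<bullet> \<eta>"
    have "(cos t * a + sin t * b)\<^sup>2 + (cos t * b - sin t * a)\<^sup>2 = ((cos t)\<^sup>2 + (sin t)\<^sup>2) * (a\<^sup>2 + b\<^sup>2)"
      by algebra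
    then have "(cos t * a + sin t * b)\<^sup>2 + (cos t * b - sin t * a)\<^sup>2 = a\<^sup>2 + b\<^sup>2" by simp
    then have "(cos t * a + sin t * b)\<^sup>2 \<le> a\<^sup>2 + b\<^sup>2"
      using zero_le_power2[of "cos t * b - sin t * a"] by linarith
    also have "\<dots> < (3/4)\<^sup>2" using w k by (simp add: elliptic_def a_def b_def power2_eq_square)
    finally have "\<bar>cos t * a + sin t * b\<bar>\<^sup>2 < (3/4)\<^sup>2" by simp
    then have "\<bar>cos t * a + sin t * b\<bar> < 3/4" by (rule power_less_imp_less_base) simp
    then show ?thesis by (simp add: X_def inner_add_right a_def b_def)
  qed
  show "newton (x, \<eta>) t = (X t, cos t *\<^sub>R \<eta> - sin t *\<^sub>R x)" if "t \<ge> 0"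
  proof (rule newton_eq_forward[OF _ _ that])
    fix t
    have "gradG (X t) = -2 *\<^sub>R X t" using inside by (intro G_elliptic)
    then have "newton_field (X t, cos t *\<^sub>R \<eta> - sin t *\<^sub>R x) = (cos t *\<^sub>R \<eta> - sin t *\<^sub>R x, - X t)"
      by (simp add: newton_field_def)
    then show "((\<lambda>t. (X t, cos t *\<^sub>R \<eta> - sin t *\<^sub>R x)) has_vector_derivative
        newton_field (X t, cos t *\<^sub>R \<eta> - sin t *\<^sub>R x)) (at t)"
      unfolding X_def
      by (simp only:, intro has_vector_derivative_Pair) (auto intro!: derivative_eq_intros simp: algebra_simps)
  qed (simp add: X_def)
qed

text \<open>
  The length of one turn of the ellipse is the integral of \<open>1 - |X|\<^sup>2\<close> over \<open>[0, 2\<pi>]\<close>. It equals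
  \<open>2\<pi> - \<pi> (|x|\<^sup>2 + |\<eta>|\<^sup>2) = \<pi>\<close>, because \<open>|\<eta>|\<^sup>2 = 1 - |x|\<^sup>2\<close>.
\<close>

lemma geo_elliptic:
  assumes "snd z \<noteq> 0" "rescale z \<in> elliptic"
  shows "geo pi z = z"
proof -
  obtain x \<eta> where w: "rescale z = (x, \<eta>)" by (cases "rescale z") auto
  define X where "X t = cos t *\<^sub>R x + sin t *\<^sub>R \<eta>" for t
  note orbit = elliptic_orbit[OF assms(2)[unfolded w], folded X_def]
  have G: "G (X t) = 1 - (norm (X t))\<^sup>2" for t using orbit(2) by (intro G_elliptic)
  have x\<eta>: "(norm x)\<^sup>2 + (norm \<eta>)\<^sup>2 = 1"
  proof -
    have "fst z = x" using w by (simp add: rescale_def)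
    then show ?thesis using norm_rescale[OF assms(1)] G[of 0] w by (simp add: X_def)
  qed
  define S where "S t = t / 2 - (norm x)\<^sup>2 / 4 * sin (2 * t) + (norm \<eta>)\<^sup>2 / 4 * sin (2 * t)
      - (x \<bullet> \<eta>) * (sin t)\<^sup>2" for t
  have dS: "(S has_real_derivative G (X t)) (at t)" for t
  proof -
    have "(S has_real_derivative 1/2 - (norm x)\<^sup>2 / 2 * cos (2 * t) + (norm \<eta>)\<^sup>2 / 2 * cos (2 * t)
        - (x \<bullet> \<eta>) * (2 * sin t * cos t)) (at t)"
      unfolding S_def[abs_def] by (auto intro!: derivative_eq_intros)
    moreover have norm_X: "(norm (X t))\<^sup>2 = (cos t)\<^sup>2 * (norm x)\<^sup>2 + (sin t)\<^sup>2 * (norm \<eta>)\<^sup>2 + 2 * (sin t * cos t) * (x \<bullet> \<eta>)"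
      unfolding X_def power2_norm_eq_inner
      by (simp add: inner_add_left inner_add_right inner_commute[of \<eta> x])
         (simp add: power2_eq_square algebra_simps)
    have half: "(cos t)\<^sup>2 = 1/2 + cos (2 * t) / 2" "(sin t)\<^sup>2 = 1/2 - cos (2 * t) / 2"
      using cos_double_cos[of t] sin_squared_eq[of t] by linarith+
    have "(norm \<eta>)\<^sup>2 = 1 - (norm x)\<^sup>2" using x\<eta> by simp
    then have "G (X t) = 1/2 - (norm x)\<^sup>2 / 2 * cos (2 * t) + (norm \<eta>)\<^sup>2 / 2 * cos (2 * t)
        - (x \<bullet> \<eta>) * (2 * sin t * cos t)"
      unfolding G norm_X half by (simp add: field_simps)
    ultimately show ?thesis by (simp only:)
  qed
  have "clock (rescale z) (2 * pi) = S (2 * pi)"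
  proof -
    define d where "d t = clock (rescale z) t - S t" for t
    have "d (2 * pi) = d 0"
    proof (rule DERIV_isconst2[of 0 "2 * pi"])
      have dd: "(d has_real_derivative 0) (at t)" if "t \<ge> 0" for t
        using DERIV_diff[OF clock_deriv[of "rescale z" t] dS[of t]] orbit(1)[OF that]
        unfolding d_def[abs_def] w by simp
      then show "continuous_on {0..2 * pi} d"
        by (intro DERIV_continuous_on) (auto intro: has_field_derivative_at_within)
      show "(d has_real_derivative 0) (at t)" if "0 < t" for t using dd that by simp
    qed auto
    then show ?thesis by (simp add: d_def S_def)
  qed
  also have "S (2 * pi) = pi" using sin_periodic[of "2 * pi"] by (simp add: S_def)
  finally have "tick (rescale z) pi = 2 * pi" using tick_clock by metis
  then show ?thesis
    using orbit(1)[of "2 * pi"] speed_pos[OF assms(1)] w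
    by (auto simp: geo_def Let_def X_def rescale_def prod_eq_iff)
qed

lemma geo_escaping:
  assumes "snd z \<noteq> 0" "rescale z \<in> escaping"
  shows "\<not> (\<exists>s>0. geo s z = z)"
  unfolding geo_periodic_iff[OF assms(1)]
proof safe
  fix t :: real assume t: "t > 0" "newton (rescale z) t = rescale z"
  obtain x \<eta> where w: "rescale z = (x, \<eta>)" by (cases "rescale z") auto
  have "newton (x, \<eta>) t = (x + t *\<^sub>R \<eta>, \<eta>)"
  proof (rule newton_eq_forward)
    fix t :: real assume t: "t \<ge> 0"
    have q': "q' s = 0" if "s > 4/5" for s
    proof -
      have "(q has_real_derivative 0) (at s)"
        by (rule has_field_derivative_transform_within_open[OF DERIV_const[of 1], of "{4/5<..}"])
           (use that in \<open>auto simp: q_out\<close>)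
      then show ?thesis using q_deriv DERIV_unique by blast
    qed
    have "hexdir k \<bullet> (x + t *\<^sub>R \<eta>) > 4/5" if "k \<in> {1, 2}" for k
    proof -
      have "hexdir k \<bullet> x > 4/5" "hexdir k \<bullet> \<eta> > 0"
        using assms(2) that unfolding w escaping_def by auto
      moreover have "t * (hexdir k \<bullet> \<eta>) \<ge> 0" using t calculation(2) by simp
      ultimately show ?thesis by (simp add: inner_add_right)
    qed
    note far = this[of 1] this[of 2]
    have "gradG (x + t *\<^sub>R \<eta>) = 0"
      unfolding gradG_def sum_lessThan_3 using far inner_hexdir_add[of "x + t *\<^sub>R \<eta>"] by (simp add: q')
    then show "((\<lambda>t. (x + t *\<^sub>R \<eta>, \<eta>)) has_vector_derivative newton_field (x + t *\<^sub>R \<eta>, \<eta>)) (at t)"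
      unfolding newton_field_def
      by (intro has_vector_derivative_Pair) (auto intro!: derivative_eq_intros)
  qed (use t in auto)
  then have "\<eta> = 0" using t w by simp
  then show False using assms w speed_pos[OF assms(1)] by (auto simp: rescale_def)
qed

lemma rescale_scaled: "t > 0 \<Longrightarrow> rescale (x, t *\<^sub>R \<xi>) = rescale (x, \<xi>)"
  by (simp add: rescale_def speed_def)

lemma open_rescale_vimage:
  assumes "open U"
  shows "open {z. snd z \<noteq> 0 \<and> rescale z \<in> U}"
proof -
  have op: "open {z :: phase. snd z \<noteq> 0}" by (intro open_Collect_neq continuous_intros)
  have "continuous_on {z. snd z \<noteq> 0} rescale"
    unfolding rescale_def[abs_def] speed_def
    using G_pos by (intro continuous_intros continuous_on_compose2[OF G_continuous]) (auto simp: less_imp_neq[OF G_pos, symmetric])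
  then have "open (rescale -` U \<inter> {z. snd z \<noteq> 0})"
    using continuous_on_open_vimage[OF op] assms by blast
  then show ?thesis by (simp add: vimage_def Collect_conj_eq Int_commute)
qed

lemma open_elliptic: "open elliptic"
proof -
  have "elliptic = (\<Inter>k\<in>{..<3}. {w. (hexdir k \<bullet> fst w)\<^sup>2 + (hexdir k \<bullet> snd w)\<^sup>2 < 9/16})"
    by (auto simp: elliptic_def)
  also have "open \<dots>"
    by (intro open_INT finite_lessThan ballI open_Collect_less continuous_intros)
  finally show ?thesis .
qed

lemma open_escaping: "open escaping"
proof -
  have "escaping = (\<Inter>k\<in>{1,2}. {w. 4/5 < hexdir k \<bullet> fst w} \<inter> {w. 0 < hexdir k \<bullet> snd w})"
    by (auto simp: escaping_def)
  also have "open \<dots>"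
    by (intro open_INT ballI open_Int open_Collect_less continuous_intros) auto
  finally show ?thesis .
qed

text \<open>
  The circular orbit.
\<close>

lemma elliptic_nonempty: "\<exists>z. snd z \<noteq> 0 \<and> rescale z \<in> elliptic"
proof -
  define x \<eta> where "x = Complex (1 / sqrt 2) 0" and "\<eta> = Complex 0 (1 / sqrt 2)"
  have h: "(hexdir k \<bullet> x)\<^sup>2 + (hexdir k \<bullet> \<eta>)\<^sup>2 = 1/2" if "k < 3" for k
  proof -
    have "(hexdir k \<bullet> x)\<^sup>2 + (hexdir k \<bullet> \<eta>)\<^sup>2 = ((Re (hexdir k))\<^sup>2 + (Im (hexdir k))\<^sup>2) / 2"
      by (simp add: x_def \<eta>_def inner_complex_def power_mult_distrib power_divide)
    also have "\<dots> = 1/2" using norm_hexdir[of k] by (simp add: cmod_def)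
    finally show ?thesis .
  qed
  have ell: "(x, \<eta>) \<in> elliptic"
    unfolding elliptic_def
  proof (intro CollectI allI impI)
    fix k :: nat assume "k < 3"
    from h[OF this] show "(hexdir k \<bullet> fst (x, \<eta>))\<^sup>2 + (hexdir k \<bullet> snd (x, \<eta>))\<^sup>2 < 9/16"
      unfolding fst_conv snd_conv by linarith
  qed
  have "G x = 1 - (norm x)\<^sup>2"
    using elliptic_orbit(2)[OF ell, of _ 0] by (intro G_elliptic) auto
  then have Gx: "G x = 1/2" by (simp add: x_def cmod_def power_divide)
  have "norm \<eta> = sqrt (1/2)" by (simp add: \<eta>_def cmod_def power_divide real_sqrt_divide)
  then have "speed (x, \<eta>) = 1" by (simp add: speed_def Gx)
  then have "rescale (x, \<eta>) = (x, \<eta>)" by (simp add: rescale_def)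
  then show ?thesis using ell by (intro exI[of _ "(x, \<eta>)"]) (auto simp: \<eta>_def complex_eq_iff)
qed

lemma escaping_nonempty: "\<exists>z. snd z \<noteq> 0 \<and> rescale z \<in> escaping"
proof -
  have "speed (2, 1) > 0" by (rule speed_pos) simp
  then have "rescale (2, 1) \<in> escaping"
    by (auto simp: escaping_def rescale_def inner_complex_def)
  then show ?thesis by (intro exI[of _ "(2, 1)"]) auto
qed

end

section \<open>Partial derivatives of sums of plane waves\<close>

lemma openin_fun_upd:
  assumes "openin (Euclidean_space N) D" "x \<in> D" "i < N"
  shows "\<forall>\<^sub>F t in nhds (x i). x(i := t) \<in> D"
proof -
  obtain r where r: "r > 0" "coord_box N x r \<subseteq> D" by (rule exists_coord_box[OF assms(1,2)])
  have "x \<in> topspace (Euclidean_space N)" using assms openin_subset by blast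
  then have box: "x(i := t) \<in> coord_box N x r" if "dist t (x i) < r" for t
    using that r(1) assms(3) by (auto simp: coord_box_def topspace_Euclidean_space dist_real_def)
  show ?thesis
    unfolding eventually_nhds_metric
  proof (intro exI conjI allI impI)
    show "r > 0" by (rule r(1))
    show "x(i := t) \<in> D" if "dist t (x i) < r" for t using box[OF that] r(2) by (rule subsetD[rotated])
  qed
qed

lemma partial_derivs_cong:
  assumes "openin (Euclidean_space N) D" "\<And>x. x \<in> D \<Longrightarrow> u x = v x" "set is \<subseteq> {..<N}" "x \<in> D"
  shows "partial_derivs is u x = partial_derivs is v x"
  using assms(3,4)
proof (induction "is" arbitrary: x)
  case (Cons i "is")
  have IH: "partial_derivs is u y = partial_derivs is v y" if "y \<in> D" for y
    by (rule Cons.IH[OF _ that]) (use Cons.prems(1) in simp)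
  have "\<forall>\<^sub>F t in nhds (x i). x(i := t) \<in> D" using assms(1) Cons.prems by (intro openin_fun_upd) auto
  then have "\<forall>\<^sub>F t in nhds (x i). partial_derivs is u (x(i := t)) = partial_derivs is v (x(i := t))"
    by (rule eventually_mono) (rule IH)
  then show ?case unfolding partial_derivs.simps partial_deriv_def by (rule deriv_cong_ev) (rule refl)
qed (use assms(2) in simp)

lemma smooth_on_cong:
  assumes D: "openin (Euclidean_space N) D" and uv: "\<And>x. x \<in> D \<Longrightarrow> u x = v x" and "smooth_on N D v"
  shows "smooth_on N D u"
  unfolding smooth_on_def
proof (intro allI impI conjI ballI)
  fix "is" assume is': "set is \<subseteq> {..<N}"
  note eq = partial_derivs_cong[OF D uv is']
  have "continuous_map (subtopology (Euclidean_space N) D) euclideanreal (partial_derivs is v)"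
    using assms(3) is' by (simp add: smooth_on_def)
  then show "continuous_map (subtopology (Euclidean_space N) D) euclideanreal (partial_derivs is u)"
    by (rule continuous_map_eq) (simp add: eq)
  fix i x assume i: "i < N" and x: "x \<in> D"
  have "(\<lambda>t. partial_derivs is v (x(i := t))) differentiable (at (x i))"
    using assms(3) is' i x by (simp add: smooth_on_def)
  then obtain d where d: "((\<lambda>t. partial_derivs is v (x(i := t))) has_real_derivative d) (at (x i))"
    by (auto simp: real_differentiable_def)
  have ev: "\<forall>\<^sub>F t in nhds (x i). partial_derivs is u (x(i := t)) = partial_derivs is v (x(i := t))"
    using openin_fun_upd[OF D x i] by (rule eventually_mono) (rule eq)
  have "((\<lambda>t. partial_derivs is u (x(i := t))) has_real_derivative d) (at (x i))"
    using d DERIV_cong_ev[OF refl ev refl] by blast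
  then show "(\<lambda>t. partial_derivs is u (x(i := t))) differentiable (at (x i))"
    by (auto simp: real_differentiable_def)
qed

text \<open>
  A plane wave is a function of \<open>lin N c x\<close> for a fixed vector \<open>c\<close>.
\<close>

definition lin :: "nat \<Rightarrow> (nat \<Rightarrow> real) \<Rightarrow> coord \<Rightarrow> real" where
  "lin N c x = (\<Sum>i<N. c i * x i)"

lemma lin_fun_upd: "i < N \<Longrightarrow> lin N c (x(i := t)) = c i * t + (lin N c x - c i * x i)"
  unfolding lin_def by (subst (1 2) sum.remove[of _ i]) auto

lemma ridge_line_deriv:
  assumes "\<And>k t. k \<in> A \<Longrightarrow> jet_at (F k) t" "i < N"
  shows "((\<lambda>t. \<Sum>k\<in>A. b k * F k n (lin N (c k) (x(i := t)))) has_real_derivative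
    (\<Sum>k\<in>A. b k * (c k i * F k (Suc n) (lin N (c k) (x(i := s)))))) (at s)"
proof (intro DERIV_sum DERIV_cmult)
  fix k assume k: "k \<in> A"
  let ?l = "lin N (c k) x - c k i * x i"
  have "(F k n has_real_derivative F k (Suc n) (c k i * s + ?l)) (at (c k i * s + ?l))"
    using assms(1)[OF k] by (simp add: jet_at_def)
  moreover have "((\<lambda>t. c k i * t + ?l) has_real_derivative c k i) (at s)"
    by (auto intro!: derivative_eq_intros)
  ultimately have "((\<lambda>t. F k n (c k i * t + ?l)) has_real_derivative F k (Suc n) (c k i * s + ?l) * c k i) (at s)"
    by (rule DERIV_chain2)
  then show "((\<lambda>t. F k n (lin N (c k) (x(i := t)))) has_real_derivative c k i * F k (Suc n) (lin N (c k) (x(i := s)))) (at s)"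
    using assms(2) by (simp add: lin_fun_upd mult.commute)
qed

lemma partial_derivs_ridge:
  assumes "\<And>k t. k \<in> A \<Longrightarrow> jet_at (F k) t" "set is \<subseteq> {..<N}"
  shows "partial_derivs is (\<lambda>x. \<Sum>k\<in>A. F k 0 (lin N (c k) x)) =
    (\<lambda>x. \<Sum>k\<in>A. prod_list (map (c k) is) * F k (length is) (lin N (c k) x))"
  using assms(2)
proof (induction "is")
  case (Cons i "is")
  have i: "i < N" using Cons.prems by simp
  show ?case
  proof
    fix x
    have "partial_derivs (i # is) (\<lambda>x. \<Sum>k\<in>A. F k 0 (lin N (c k) x)) x =
        deriv (\<lambda>t. \<Sum>k\<in>A. prod_list (map (c k) is) * F k (length is) (lin N (c k) (x(i := t)))) (x i)"
      using Cons by (simp add: partial_deriv_def)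
    also have "\<dots> = (\<Sum>k\<in>A. prod_list (map (c k) is) * (c k i * F k (Suc (length is)) (lin N (c k) (x(i := x i)))))"
      by (intro DERIV_imp_deriv ridge_line_deriv assms i)
    finally show "partial_derivs (i # is) (\<lambda>x. \<Sum>k\<in>A. F k 0 (lin N (c k) x)) x =
        (\<Sum>k\<in>A. prod_list (map (c k) (i # is)) * F k (length (i # is)) (lin N (c k) x))"
      by (simp add: mult_ac)
  qed
qed simp

lemma continuous_lin: "continuous_on S (lin N c)"
  unfolding lin_def by (intro continuous_intros continuous_on_subset[OF continuous_on_product_coordinates]) auto

lemma continuous_map_Euclidean_sub:
  assumes "continuous_on S (f :: coord \<Rightarrow> real)" "D \<subseteq> S"
  shows "continuous_map (subtopology (Euclidean_space N) D) euclideanreal f"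
  unfolding Euclidean_space_eq subtopology_subtopology continuous_map_iff_continuous
  using assms by (auto intro: continuous_on_subset)

lemma smooth_on_ridge:
  assumes "\<And>k t. k \<in> A \<Longrightarrow> jet_at (F k) t"
  shows "smooth_on N D (\<lambda>x. \<Sum>k\<in>A. F k 0 (lin N (c k) x))"
  unfolding smooth_on_def
proof (intro allI impI conjI ballI)
  fix "is" assume is': "set is \<subseteq> {..<N}"
  have eq: "partial_derivs is (\<lambda>x. \<Sum>k\<in>A. F k 0 (lin N (c k) x)) =
      (\<lambda>x. \<Sum>k\<in>A. prod_list (map (c k) is) * F k (length is) (lin N (c k) x))"
    by (rule partial_derivs_ridge) (use assms is' in auto)
  have "continuous_on UNIV (F k n)" if "k \<in> A" for k n
    using assms[OF that] unfolding jet_at_def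
    by (intro DERIV_continuous_on) (auto intro: has_field_derivative_at_within)
  then have "continuous_on UNIV (\<lambda>x. F k n (lin N (c k) x))" if "k \<in> A" for k n
    using that by (intro continuous_on_compose2[OF _ continuous_lin]) auto
  then show "continuous_map (subtopology (Euclidean_space N) D) euclideanreal
      (partial_derivs is (\<lambda>x. \<Sum>k\<in>A. F k 0 (lin N (c k) x)))"
    unfolding eq by (intro continuous_map_Euclidean_sub[of UNIV] continuous_intros) auto
  fix i x assume i: "i < N" and "x \<in> D"
  show "(\<lambda>t. partial_derivs is (\<lambda>x. \<Sum>k\<in>A. F k 0 (lin N (c k) x)) (x(i := t))) differentiable (at (x i))"
    unfolding eq real_differentiable_def by (rule exI, rule ridge_line_deriv) (use assms i in auto)
qed

context carleman
begin

lemma carleman_class_ridge: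
  assumes "finite A" and jet: "\<And>k t. k \<in> A \<Longrightarrow> jet_at (F k) t"
    and bound: "\<And>k n t. k \<in> A \<Longrightarrow> n \<ge> 1 \<Longrightarrow> \<bar>F k n t\<bar> \<le> C ^ n * m n" and C: "C \<ge> 0"
    and c: "\<And>k i. k \<in> A \<Longrightarrow> \<bar>c k i\<bar> \<le> 1"
  shows "carleman_class m N D (\<lambda>x. \<Sum>k\<in>A. F k 0 (lin N (c k) x))"
  unfolding carleman_class_def carleman_bounded_def
proof (intro allI impI conjI)
  fix D'
  show "smooth_on N D' (\<lambda>x. \<Sum>k\<in>A. F k 0 (lin N (c k) x))" using jet by (rule smooth_on_ridge)
  define B where "B = (real (card A) + 1) * (C + 1)"
  show "\<exists>C>0. \<forall>is. set is \<subseteq> {..<N} \<and> 1 \<le> length is \<longrightarrow> (\<forall>x\<in>D'.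
      \<bar>partial_derivs is (\<lambda>x. \<Sum>k\<in>A. F k 0 (lin N (c k) x)) x\<bar> \<le> C ^ length is * m (length is))"
  proof (intro exI[of _ B] conjI allI impI ballI)
    show "B > 0" using C by (simp add: B_def add_nonneg_pos)
    fix "is" x assume is': "set is \<subseteq> {..<N} \<and> 1 \<le> length is"
    define n where "n = length is"
    have n: "n \<ge> 1" using is' by (simp add: n_def)
    have coef: "\<bar>prod_list (map (c k) js)\<bar> \<le> 1" if "k \<in> A" for k js
      using c[OF that] by (induction js) (auto simp: abs_mult intro: mult_le_one)
    have "\<bar>partial_derivs is (\<lambda>x. \<Sum>k\<in>A. F k 0 (lin N (c k) x)) x\<bar> \<le>
        (\<Sum>k\<in>A. \<bar>prod_list (map (c k) is) * F k n (lin N (c k) x)\<bar>)"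
    proof -
      have "partial_derivs is (\<lambda>x. \<Sum>k\<in>A. F k 0 (lin N (c k) x)) x =
          (\<Sum>k\<in>A. prod_list (map (c k) is) * F k n (lin N (c k) x))"
        unfolding n_def
        by (rule fun_cong[OF partial_derivs_ridge[where A = A and F = F and c = c]])
           (use jet is' in auto)
      then show ?thesis by (simp only: sum_abs)
    qed
    also have "\<dots> \<le> (\<Sum>k\<in>A. 1 * (C ^ n * m n))"
      unfolding abs_mult using coef bound n C m_pos[OF n]
      by (intro sum_mono mult_mono) auto
    also have "\<dots> = real (card A) * (C ^ n * m n)" by simp
    also have "\<dots> \<le> (real (card A) + 1) ^ n * ((C + 1) ^ n * m n)"
    proof (intro mult_mono power_mono)
      have "real (card A) \<le> (real (card A) + 1) ^ 1" by simp
      also have "\<dots> \<le> (real (card A) + 1) ^ n" using n by (intro power_increasing) auto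
      finally show "real (card A) \<le> (real (card A) + 1) ^ n" .
    qed (use C m_pos[OF n] in auto)
    finally show "\<bar>partial_derivs is (\<lambda>x. \<Sum>k\<in>A. F k 0 (lin N (c k) x)) x\<bar> \<le> B ^ length is * m (length is)"
      by (simp add: B_def n_def power_mult_distrib mult.assoc)
  qed
qed

lemma carleman_class_cong:
  assumes "\<And>x. x \<in> topspace (Euclidean_space N) \<Longrightarrow> u x = v x" "carleman_class m N D v"
  shows "carleman_class m N D u"
  unfolding carleman_class_def
proof (intro allI impI)
  fix D' assume D': "openin (Euclidean_space N) D' \<and>
    compactin (Euclidean_space N) (Euclidean_space N closure_of D') \<and> Euclidean_space N closure_of D' \<subseteq> D"
  then have b: "carleman_bounded m N D' v" using assms(2) by (simp add: carleman_class_def)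
  have uv: "u x = v x" if "x \<in> D'" for x using that D' openin_subset assms(1) by blast
  have eq: "partial_derivs is u x = partial_derivs is v x" if "set is \<subseteq> {..<N}" "x \<in> D'" for "is" x
    using D' that uv by (intro partial_derivs_cong) auto
  show "carleman_bounded m N D' u"
    using b smooth_on_cong[of N D' u v] D' uv unfolding carleman_bounded_def by (auto simp: eq)
qed

text \<open>
  A plane wave with the identity as profile. The value of the profile is unbounded, which is
  harmless: the class bounds derivatives of positive order only.
\<close>

lemma carleman_class_coordinate:
  assumes "k < N"
  shows "carleman_class m N D (\<lambda>x. x k)"
proof -
  define F where "F (j::nat) n t = (if n = 0 then t else if n = 1 then 1 else 0 :: real)" for j n :: nat and t :: real
  define c where "c (j::nat) i = (if i = k then 1 else 0 :: real)" for j i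
  have m1: "m 1 > 0" by (rule m_pos) simp
  have "carleman_class m N D (\<lambda>x. \<Sum>j\<in>{0::nat}. F j 0 (lin N (c j) x))"
  proof (rule carleman_class_ridge[where C = "1 / m 1"])
    show "jet_at (F j) t" for j t
      by (auto simp: jet_at_def F_def[abs_def])
    show "\<bar>F j n t\<bar> \<le> (1 / m 1) ^ n * m n" if "n \<ge> 1" for j n t
      using that m1 m_pos[OF that] by (auto simp: F_def)
  qed (use m1 in \<open>auto simp: c_def\<close>)
  moreover have "lin N (c j) x = x k" for j x
    unfolding lin_def c_def using assms by (simp add: if_distrib[of "\<lambda>a. a * _"] cong: if_cong)
  ultimately show ?thesis by (simp add: F_def)
qed

lemma carleman_class_0: "carleman_class m N D (\<lambda>x. 0)"
  using carleman_class_ridge[of "{} :: nat set" "\<lambda>_ _ _. 0" 0 "\<lambda>_ _. 0"] by simp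

end

section \<open>Coordinates on the plane and on its phase space\<close>

text \<open>
  The plane is modelled by \<^typ>\<open>complex\<close> and its phase space by pairs of position and covector.
  The maps \<open>vec2\<close> and \<open>vec4\<close> are the homeomorphisms onto the coordinate spaces \<open>\<real>\<^sup>2\<close> and \<open>\<real>\<^sup>4\<close>, and
  \<open>cpx\<close> and \<open>phase_of\<close> are their inverses.
\<close>

definition vec2 :: "complex \<Rightarrow> coord" where
  "vec2 z = (\<lambda>i. if i = 0 then Re z else if i = 1 then Im z else 0)"
definition cpx :: "coord \<Rightarrow> complex" where "cpx x = Complex (x 0) (x 1)"
definition vec4 :: "phase \<Rightarrow> coord" where
  "vec4 z = (\<lambda>i. if i < 2 then vec2 (fst z) i else vec2 (snd z) (i - 2))"
definition phase_of :: "coord \<Rightarrow> phase" where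
  "phase_of w = (Complex (w 0) (w 1), Complex (w 2) (w 3))"

lemma cpx_vec2 [simp]: "cpx (vec2 z) = z"
  by (simp add: cpx_def vec2_def)

lemma vec2_in [simp]: "vec2 z \<in> topspace (Euclidean_space 2)"
  by (auto simp: vec2_def topspace_Euclidean_space)

lemma vec2_cpx: "x \<in> topspace (Euclidean_space 2) \<Longrightarrow> vec2 (cpx x) = x"
  by (auto simp: vec2_def cpx_def topspace_Euclidean_space fun_eq_iff)

lemma phase_of_vec4 [simp]: "phase_of (vec4 z) = z"
  by (simp add: phase_of_def vec4_def vec2_def prod_eq_iff complex_eq_iff)

lemma vec4_phase_of:
  assumes "w \<in> topspace (Euclidean_space 4)"
  shows "vec4 (phase_of w) = w"
proof
  fix i :: nat
  consider "i = 0" | "i = 1" | "i = 2" | "i = 3" | "i \<ge> 4" by linarith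
  then show "vec4 (phase_of w) i = w i"
    using assms by cases (auto simp: vec4_def vec2_def phase_of_def topspace_Euclidean_space)
qed

lemma vec4_in [simp]: "vec4 z \<in> topspace (Euclidean_space 4)"
  by (auto simp: vec4_def vec2_def topspace_Euclidean_space)

lemma vec4_inject [simp]: "vec4 z = vec4 z' \<longleftrightarrow> z = z'"
  by (metis phase_of_vec4)

lemma vec4_image: "vec4 ` A = topspace (Euclidean_space 4) \<inter> phase_of -` A"
  by (auto simp: image_iff) (metis vec4_phase_of)

lemma continuous_vec2: "continuous_on S vec2"
proof (rule continuous_on_coordinatewise_then_product)
  fix i show "continuous_on S (\<lambda>z. vec2 z i)"
    unfolding vec2_def by (cases "i = 0"; cases "i = 1") (auto intro!: continuous_intros)
qed

lemma continuous_vec4: "continuous_on S vec4"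
proof (rule continuous_on_coordinatewise_then_product)
  fix i
  have *: "continuous_on S (\<lambda>z. vec2 (f z) j)" if "continuous_on S f" for f :: "phase \<Rightarrow> complex" and j
    unfolding vec2_def using that by (cases "j = 0"; cases "j = 1") (auto intro!: continuous_intros)
  show "continuous_on S (\<lambda>z. vec4 z i)"
    unfolding vec4_def by (cases "i < 2") (auto intro!: * continuous_on_fst continuous_on_snd continuous_on_id)
qed

lemma continuous_phase_of: "continuous_on S phase_of"
  unfolding phase_of_def Complex_eq
  by (intro continuous_intros continuous_on_subset[OF continuous_on_product_coordinates]) auto

lemma closed_Euclidean: "closed (topspace (Euclidean_space n))"
  by (metis closedin_Euclidean_space_iff closedin_topspace)

lemma openin_vec4_image: "open A \<Longrightarrow> openin (Euclidean_space 4) (vec4 ` A)"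
  unfolding vec4_image Euclidean_space_eq
  using open_vimage[OF _ continuous_phase_of] by (auto simp: openin_open)

lemma borel_vec4_image: "vec4 ` A \<in> sets borel \<longleftrightarrow> A \<in> sets borel"
proof
  assume "A \<in> sets borel"
  moreover have "phase_of \<in> borel_measurable borel"
    by (intro borel_measurable_continuous_onI continuous_phase_of)
  ultimately have "phase_of -` A \<in> sets borel" using measurable_sets[of phase_of borel borel A] by simp
  then show "vec4 ` A \<in> sets borel"
    unfolding vec4_image using closed_Euclidean by (intro sets.Int) auto
next
  assume "vec4 ` A \<in> sets borel"
  moreover have "vec4 \<in> borel_measurable borel"
    by (intro borel_measurable_continuous_onI continuous_vec4)
  ultimately have "vec4 -` (vec4 ` A) \<in> sets borel" using measurable_sets[of vec4 borel borel "vec4 ` A"] by simp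
  moreover have "vec4 -` (vec4 ` A) = A" by auto
  ultimately show "A \<in> sets borel" by simp
qed

section \<open>Lebesgue measure of open sets\<close>

lemma measurable_extend [measurable]:
  fixes N :: nat
  shows "(\<lambda>x i. if i < N then x i else 0) \<in> borel_measurable (Pi\<^sub>M {..<N} (\<lambda>_. lborel :: real measure))"
proof (rule measurable_coordinatewise_then_product)
  fix i :: nat
  show "(\<lambda>x. if i < N then x i else 0) \<in> borel_measurable (Pi\<^sub>M {..<N} (\<lambda>_. lborel :: real measure))"
    by (cases "i < N") auto
qed

lemma sets_lebesgue_Rn [simp]: "sets (lebesgue_Rn N) = sets borel"
  by (simp add: lebesgue_Rn_def)

lemma emeasure_lebesgue_Rn_Int:
  assumes "A \<in> sets borel"
  shows "emeasure (lebesgue_Rn N) (topspace (Euclidean_space N) \<inter> A) = emeasure (lebesgue_Rn N) A"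
proof -
  have "topspace (Euclidean_space N) \<inter> A \<in> sets borel" using assms closed_Euclidean by (intro sets.Int) auto
  then show ?thesis
    unfolding lebesgue_Rn_def using assms
    by (subst (1 2) emeasure_distr) (auto intro!: arg_cong2[of _ _ _ _ emeasure] simp: topspace_Euclidean_space)
qed

lemma borel_openin_Euclidean: "openin (Euclidean_space N) D \<Longrightarrow> D \<in> sets borel"
  unfolding Euclidean_space_eq openin_open
  using closed_Euclidean[of N] unfolding topspace_Euclidean_space by (auto intro!: sets.Int)

lemma emeasure_lebesgue_Rn_open:
  assumes "openin (Euclidean_space N) D" "D \<noteq> {}"
  shows "emeasure (lebesgue_Rn N) D > 0"
proof -
  obtain z where z: "z \<in> D" using assms by blast
  obtain r where r: "r > 0" "coord_box N z r \<subseteq> D" by (rule exists_coord_box[OF assms(1) z])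
  let ?P = "Pi\<^sub>M {..<N} (\<lambda>_. lborel :: real measure)"
  have "coord_box N z r \<in> sets borel" by (rule borel_openin_Euclidean[OF openin_coord_box])
  then have "emeasure (lebesgue_Rn N) (coord_box N z r) =
      emeasure ?P ((\<lambda>x i. if i < N then x i else 0) -` coord_box N z r \<inter> space ?P)"
    unfolding lebesgue_Rn_def by (subst emeasure_distr) auto
  also have "(\<lambda>x i. if i < N then x i else 0) -` coord_box N z r \<inter> space ?P =
      (\<Pi>\<^sub>E i\<in>{..<N}. {z i - r<..<z i + r})"
  proof -
    have "t \<in> {z i - r<..<z i + r} \<longleftrightarrow> \<bar>t - z i\<bar> < r" for t i by auto
    then show ?thesis by (simp add: coord_box_def space_PiM PiE_iff set_eq_iff Ball_def conj_commute)
  qed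
  also have "emeasure ?P \<dots> = (\<Prod>i\<in>{..<N}. emeasure lborel {z i - r<..<z i + r})"
  proof -
    interpret product_sigma_finite "\<lambda>_ :: nat. lborel :: real measure"
      by (intro product_sigma_finite.intro sigma_finite_lborel)
    show ?thesis by (rule emeasure_PiM) auto
  qed
  also have "\<dots> = ennreal (2 * r) ^ N" using r(1) by simp
  also have "\<dots> > 0" using r(1) by (simp add: ennreal_power)
  finally have "0 < emeasure (lebesgue_Rn N) (coord_box N z r)" .
  also have "\<dots> \<le> emeasure (lebesgue_Rn N) D"
    using borel_openin_Euclidean[OF assms(1)] by (intro emeasure_mono r(2)) simp
  finally show ?thesis .
qed

section \<open>The conformal plane and its geodesic flow\<close>

definition chart0 :: "coord chart" where "chart0 = (topspace (Euclidean_space 2), \<lambda>x. x)"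

text \<open>
  A covector is a family indexed by charts; only its member at \<open>chart0\<close> carries information.
\<close>

definition cpt :: "phase \<Rightarrow> coord cpoint" where
  "cpt z = (vec2 (fst z), \<lambda>c. if c = chart0 then vec2 (snd z) else (\<lambda>_. 0))"
definition uncpt :: "coord cpoint \<Rightarrow> phase" where
  "uncpt p = (cpx (fst p), cpx (snd p chart0))"

lemma uncpt_cpt [simp]: "uncpt (cpt z) = z"
  by (simp add: uncpt_def cpt_def)

lemma cpt_simps [simp]: "fst (cpt z) = vec2 (fst z)" "snd (cpt z) chart0 = vec2 (snd z)"
  by (simp_all add: cpt_def)

lemma cpt_inject [simp]: "cpt z = cpt z' \<longleftrightarrow> z = z'"
  by (metis uncpt_cpt)

lemma second_countable_Euclidean_space: "second_countable (Euclidean_space n)"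
proof -
  obtain B :: "coord set set" where B: "countable B" "topological_basis B"
    using ex_countable_basis[where 'a = coord] by (elim exE conjE)
  have "second_countable (euclidean :: coord topology)"
    unfolding second_countable_def
  proof (intro exI[of _ B] conjI allI impI ballI)
    show "openin euclidean V" if "V \<in> B" for V
      using topological_basis_open[OF B(2) that] by simp
    fix U and x :: coord assume U: "openin euclidean U \<and> x \<in> U"
    then have "open U" "x \<in> U" by simp_all
    then obtain V where "V \<in> B" "x \<in> V" "V \<subseteq> U" by (rule topological_basisE[OF B(2)])
    then show "\<exists>V\<in>B. x \<in> V \<and> V \<subseteq> U" by (intro bexI[of _ V] conjI)
  qed (rule B(1))
  then show ?thesis
    unfolding Euclidean_space_eq by (rule second_countable_subtopology)
qed

lemma transition_chart0: "x \<in> topspace (Euclidean_space 2) \<Longrightarrow> transition chart0 chart0 x = x"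
  unfolding transition_def chart0_def
  using f_inv_into_f[of x "\<lambda>x. x" "topspace (Euclidean_space 2)"] by simp

lemma jacobian_chart0:
  assumes "x \<in> topspace (Euclidean_space 2)" "i < 2" "k < 2"
  shows "jacobian chart0 chart0 x k i = (if k = i then 1 else 0)"
proof -
  have "partial_derivs [i] (\<lambda>x'. transition chart0 chart0 x' k) x = partial_derivs [i] (\<lambda>x'. x' k) x"
    using assms by (intro partial_derivs_cong[of 2 "topspace (Euclidean_space 2)"]) (auto simp: transition_chart0)
  also have "\<dots> = (if k = i then 1 else 0)" by (simp add: partial_deriv_def)
  finally show ?thesis by (simp add: jacobian_def)
qed

definition unit_vec :: "nat \<Rightarrow> complex" where "unit_vec i = (if i = 0 then 1 else \<i>)"

lemma inner_unit_vec: "i < 2 \<Longrightarrow> z \<bullet> unit_vec i = vec2 z i"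
  by (auto simp: unit_vec_def vec2_def inner_complex_def less_2_cases_iff)

lemma cpx_fun_upd: "i < 2 \<Longrightarrow> cpx ((vec2 x)(i := t)) = x + (t - vec2 x i) *\<^sub>R unit_vec i"
  by (auto simp: unit_vec_def vec2_def cpx_def less_2_cases_iff complex_eq_iff)

text \<open>
  Reduces the coordinate derivatives of the Hamiltonian to total derivatives on \<^typ>\<open>complex\<close>.
\<close>

lemma partial_deriv_cpx:
  assumes "(f has_derivative f') (at x)" "i < 2"
  shows "partial_deriv i (\<lambda>y. f (cpx y)) (vec2 x) = f' (unit_vec i)"
proof -
  define c where "c = vec2 x i"
  have "((\<lambda>t. x + (t - c) *\<^sub>R unit_vec i) has_derivative (\<lambda>h. h *\<^sub>R unit_vec i)) (at c)"
    by (auto intro!: derivative_eq_intros)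
  moreover have "(f has_derivative f') (at (x + (c - c) *\<^sub>R unit_vec i))" using assms(1) by simp
  ultimately have "((\<lambda>t. f (x + (t - c) *\<^sub>R unit_vec i)) has_derivative (\<lambda>h. f' (h *\<^sub>R unit_vec i))) (at c)"
    by (rule has_derivative_compose)
  moreover have "(\<lambda>h. f' (h *\<^sub>R unit_vec i)) = (*) (f' (unit_vec i))"
    using linear_cmul[OF has_derivative_linear[OF assms(1)]] by (auto simp: mult.commute)
  ultimately have "((\<lambda>t. f (x + (t - c) *\<^sub>R unit_vec i)) has_real_derivative f' (unit_vec i)) (at c)"
    by (simp add: has_field_derivative_def)
  then show ?thesis
    using assms(2) by (simp add: partial_deriv_def cpx_fun_upd c_def[symmetric] DERIV_imp_deriv)
qed

lemma has_derivative_vec2: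
  assumes "(X has_vector_derivative D) (at s)"
  shows "((\<lambda>s. vec2 (X s) i) has_real_derivative vec2 D i) (at s)"
  using bounded_linear.has_vector_derivative[OF bounded_linear_Re assms]
    bounded_linear.has_vector_derivative[OF bounded_linear_Im assms]
  by (auto simp: vec2_def has_real_derivative_iff_has_vector_derivative)

context oscillator
begin

definition plane :: "coord rmanifold" where
  "plane = \<lparr>mdim = 2, mtop = Euclidean_space 2, atlas = {chart0},
    metric = (\<lambda>c x i j. if i = j then G (cpx x) else 0)\<rparr>"

lemma plane_simps [simp]: "mdim plane = 2" "mtop plane = Euclidean_space 2" "atlas plane = {chart0}"
  "metric plane = (\<lambda>c x i j. if i = j then G (cpx x) else 0)"
  by (simp_all add: plane_def)

lemma chart0_simps [simp]: "fst chart0 = topspace (Euclidean_space 2)" "snd chart0 = (\<lambda>x. x)"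
  by (simp_all add: chart0_def)

lemma sum_lessThan_2: "(\<Sum>i<2. f i) = f 0 + f (1::nat)"
  by (simp add: numeral_2_eq_2)

text \<open>
  The metric is \<open>G\<close> times the identity matrix, whose inverse is \<open>1 / G\<close> times the identity.
\<close>

lemma hamiltonian_plane: "hamiltonian plane c x \<xi> = norm (cpx \<xi>) / sqrt (G (cpx x))"
proof -
  define g where "g = G (cpx x)"
  have g: "g > 0" using G_pos by (simp add: g_def)
  have inv: "inverse_mat 2 (\<lambda>i j. if i = j then g else 0) = (\<lambda>i j. if i = j \<and> i < 2 then 1 / g else 0)"
    unfolding inverse_mat_def
  proof (rule the_equality)
    fix H :: "nat \<Rightarrow> nat \<Rightarrow> real"
    assume H: "(\<forall>i j. 2 \<le> i \<or> 2 \<le> j \<longrightarrow> H i j = 0) \<and>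
      (\<forall>i<2. \<forall>j<2. (\<Sum>k<2. (if i = k then g else 0) * H k j) = (if i = j then 1 else 0))"
    show "H = (\<lambda>i j. if i = j \<and> i < 2 then 1 / g else 0)"
    proof (intro ext)
      fix i j
      show "H i j = (if i = j \<and> i < 2 then 1 / g else 0)"
      proof (cases "i < 2 \<and> j < 2")
        case True
        then have "(\<Sum>k<2. (if i = k then g else 0) * H k j) = (if i = j then 1 else 0)" using H by blast
        moreover have "(\<Sum>k<2. (if i = k then g else 0) * H k j) = g * H i j"
          using True by (auto simp: sum_lessThan_2 less_2_cases_iff)
        ultimately show ?thesis using True g by (auto simp: field_simps split: if_splits)
      next
        case False
        then have "2 \<le> i \<or> 2 \<le> j" by linarith
        then show ?thesis using H by auto
      qed
    qed
  qed (use g in \<open>auto simp: sum_lessThan_2 less_2_cases_iff\<close>)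
  show ?thesis
    unfolding hamiltonian_def plane_simps g_def[symmetric] inv
    by (simp add: sum_lessThan_2 cpx_def cmod_def power2_eq_square add_divide_distrib
        flip: real_sqrt_divide)
qed

lemma cotangent_plane: "cotangent plane = range cpt"
proof (intro equalityI subsetI)
  fix z assume "z \<in> cotangent plane"
  then have z: "fst z \<in> topspace (Euclidean_space 2)" "\<And>c. c \<noteq> chart0 \<Longrightarrow> snd z c = (\<lambda>_. 0)"
    "snd z chart0 \<in> topspace (Euclidean_space 2)"
    by (auto simp: cotangent_def)
  have "z = cpt (uncpt z)"
  proof (rule prod_eqI)
    show "fst z = fst (cpt (uncpt z))" using z(1) by (simp add: uncpt_def vec2_cpx)
    show "snd z = snd (cpt (uncpt z))"
    proof
      fix c show "snd z c = snd (cpt (uncpt z)) c"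
        using z(2)[of c] z(3) by (cases "c = chart0") (simp_all add: cpt_def uncpt_def vec2_cpx)
    qed
  qed
  then show "z \<in> range cpt" by blast
next
  fix z assume "z \<in> range cpt"
  then obtain y where y: "z = cpt y" by blast
  have "snd z chart0 i = (\<Sum>k<2. jacobian chart0 chart0 (fst z) k i * snd z chart0 k)" if "i < 2" for i
    using that by (auto simp: y cpt_def jacobian_chart0 sum_lessThan_2 less_2_cases_iff)
  then show "z \<in> cotangent plane"
    by (simp add: cotangent_def y cpt_def)
qed

lemma cotangent_nz_plane: "cotangent_nz plane = cpt ` {z. snd z \<noteq> 0}"
proof -
  have "snd (cpt z) = (\<lambda>_ _. 0) \<longleftrightarrow> snd z = 0" for z
  proof
    assume "snd (cpt z) = (\<lambda>_ _. 0)"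
    then have "snd (cpt z) chart0 = (\<lambda>_. 0)" by simp
    then have "cpx (vec2 (snd z)) = cpx (\<lambda>_. 0)" by (simp only: cpt_simps)
    then show "snd z = 0" unfolding cpx_vec2 by (simp add: cpx_def complex_eq_iff)
  qed (simp add: cpt_def vec2_def fun_eq_iff)
  then show ?thesis unfolding cotangent_nz_def cotangent_plane by auto
qed

definition unit_sphere :: "phase set" where
  "unit_sphere = {z. snd z \<noteq> 0 \<and> speed z = 1}"

lemma cosphere_plane: "cosphere plane = cpt ` unit_sphere"
  unfolding cosphere_def cotangent_nz_plane unit_sphere_def
  by (auto simp: hamiltonian_plane cpt_def speed_def)

lemma bundle_coords_plane: "bundle_coords plane chart0 (cpt z) = vec4 z"
  by (auto simp: bundle_coords_def cpt_def vec4_def vec2_def fun_eq_iff)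

lemma bundle_point_plane: "snd z \<noteq> 0 \<Longrightarrow> bundle_point plane chart0 (vec4 z) = cpt z"
proof -
  assume "snd z \<noteq> 0"
  then have "cpt z \<in> {z \<in> cotangent_nz plane. fst z \<in> fst chart0}"
    unfolding cotangent_nz_plane by (auto simp: cpt_def)
  moreover have "inj_on (bundle_coords plane chart0) {z \<in> cotangent_nz plane. fst z \<in> fst chart0}"
  proof (rule inj_onI)
    fix p p' assume "p \<in> {z \<in> cotangent_nz plane. fst z \<in> fst chart0}"
      "p' \<in> {z \<in> cotangent_nz plane. fst z \<in> fst chart0}"
      and eq: "bundle_coords plane chart0 p = bundle_coords plane chart0 p'"
    then obtain y y' where "p = cpt y" "p' = cpt y'" unfolding cotangent_nz_plane by blast
    then show "p = p'" using eq by (simp add: bundle_coords_plane)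
  qed
  ultimately have "inv_into {z \<in> cotangent_nz plane. fst z \<in> fst chart0} (bundle_coords plane chart0)
      (bundle_coords plane chart0 (cpt z)) = cpt z"
    by (rule inv_into_f_f[rotated])
  then show ?thesis unfolding bundle_point_def bundle_coords_plane .
qed

definition flow :: "real \<Rightarrow> coord cpoint \<Rightarrow> coord cpoint" where
  "flow t z = cpt (geo t (uncpt z))"

lemma flow_cpt [simp]: "flow t (cpt z) = cpt (geo t z)"
  by (simp add: flow_def)

lemma hamiltonian_deriv_\<xi>:
  assumes "\<xi> \<noteq> 0" "i < 2"
  shows "partial_deriv i (\<lambda>\<xi>'. hamiltonian plane c (vec2 x) \<xi>') (vec2 \<xi>) =
    vec2 ((1 / (sqrt (G x) * norm \<xi>)) *\<^sub>R \<xi>) i"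
proof -
  have "((\<lambda>\<xi>. norm \<xi> / sqrt (G x)) has_derivative (\<lambda>h. (h \<bullet> sgn \<xi>) / sqrt (G x))) (at \<xi>)"
    unfolding divide_inverse by (intro has_derivative_mult_left has_derivative_norm assms(1))
  from partial_deriv_cpx[OF this assms(2)] show ?thesis
    using assms(2) by (simp add: hamiltonian_plane inner_unit_vec[symmetric] inner_commute sgn_div_norm divide_inverse)
qed

lemma hamiltonian_deriv_x:
  assumes "i < 2"
  shows "partial_deriv i (\<lambda>x'. hamiltonian plane c x' (vec2 \<xi>)) (vec2 x) =
    - vec2 ((norm \<xi> / (2 * sqrt (G x) ^ 3)) *\<^sub>R gradG x) i"
proof -
  have "((\<lambda>g. norm \<xi> / sqrt g) has_real_derivative - (norm \<xi> / (2 * sqrt (G x) ^ 3))) (at (G x))"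
    using G_pos[of x] by (auto intro!: derivative_eq_intros simp: field_simps power3_eq_cube)
  then have "((\<lambda>x. norm \<xi> / sqrt (G x)) has_derivative (\<lambda>h. - (norm \<xi> / (2 * sqrt (G x) ^ 3)) * (gradG x \<bullet> h))) (at x)"
    unfolding has_field_derivative_def by (rule has_derivative_compose[OF G_has_derivative])
  from partial_deriv_cpx[OF this assms] show ?thesis
    using assms by (simp add: hamiltonian_plane inner_unit_vec[symmetric])
qed

text \<open>
  In the only chart, Hamilton's equations are the components of \<open>geo_Hamilton\<close>.
\<close>

lemma geodesic_flow_plane: "geodesic_flow plane flow"
  unfolding geodesic_flow_def cotangent_nz_plane
proof (intro ballI, elim imageE, intro conjI allI impI ballI)
  fix z y assume z: "z = cpt y" and "y \<in> {z. snd z \<noteq> 0}"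
  then have y: "snd y \<noteq> 0" by simp
  show "flow 0 z = z" using geo_0[OF y] by (simp add: z)
  show "flow t z \<in> cpt ` {z. snd z \<noteq> 0}" for t using geo_nonzero[OF y] by (simp add: z)
  have fst_flow: "fst (flow t z) = vec2 (fst (geo t y))" for t by (simp add: z)
  have "continuous_on UNIV (\<lambda>t. fst (geo t y))"
    using has_vector_derivative_continuous[OF geo_Hamilton(1)[OF y]]
    by (intro continuous_at_imp_continuous_on) auto
  then have "continuous_on UNIV (\<lambda>t. vec2 (fst (geo t y)))"
    by (rule continuous_on_compose2[OF continuous_vec2]) auto
  then show "continuous_map euclideanreal (mtop plane) (\<lambda>t. fst (flow t z))"
    using vec2_in unfolding plane_simps Euclidean_space_eq topspace_Euclidean_space
    unfolding fst_flow by (simp add: continuous_map_in_subtopology image_subset_iff)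
  fix t c assume "c \<in> atlas plane" "fst (flow t z) \<in> fst c"
  then have c: "c = chart0" by simp
  show "let x = \<lambda>s. snd c (fst (flow s z)); \<xi> = \<lambda>s. snd (flow s z) c
    in \<forall>i<mdim plane. ((\<lambda>s. x s i) has_real_derivative
            partial_deriv i (\<lambda>\<xi>'. hamiltonian plane c (x t) \<xi>') (\<xi> t)) (at t) \<and>
           ((\<lambda>s. \<xi> s i) has_real_derivative
            - partial_deriv i (\<lambda>x'. hamiltonian plane c x' (\<xi> t)) (x t)) (at t)"
    unfolding Let_def c z
    using has_derivative_vec2[OF geo_Hamilton(1)[OF y]] has_derivative_vec2[OF geo_Hamilton(2)[OF y]]
    by (simp add: hamiltonian_deriv_\<xi>[OF geo_nonzero[OF y]] hamiltonian_deriv_x)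
qed

section \<open>The Liouville measure\<close>

text \<open>
  The cone over a subset of the cosphere bundle, without its apex.
\<close>

definition cone :: "phase set \<Rightarrow> phase set" where
  "cone A = {z. snd z \<noteq> 0 \<and> speed z \<le> 1 \<and> rescale z \<in> A}"

lemma speed_rescale: "snd z \<noteq> 0 \<Longrightarrow> snd (rescale z) \<noteq> 0 \<and> speed (rescale z) = 1"
  using speed_pos[of z] G_pos[of "fst z"] by (simp add: rescale_def speed_def)

lemma rescale_unit_sphere: "z \<in> unit_sphere \<Longrightarrow> rescale z = z"
  by (simp add: unit_sphere_def rescale_def)

lemma unit_cone_plane:
  assumes "A \<subseteq> unit_sphere"
  shows "bundle_coords plane chart0 ` unit_cone (cpt ` A) = vec4 ` cone A"
proof -
  have sc: "(vec2 x, \<lambda>c i. t * snd (cpt (x, \<xi>)) c i) = cpt (x, t *\<^sub>R \<xi>)" for x \<xi> and t :: real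
    by (auto simp: cpt_def vec2_def fun_eq_iff)
  have "unit_cone (cpt ` A) = cpt ` {(x, t *\<^sub>R \<xi>) | x \<xi> t. (x, \<xi>) \<in> A \<and> 0 < t \<and> t \<le> 1}"
  proof (intro equalityI subsetI)
    fix p assume "p \<in> unit_cone (cpt ` A)"
    then obtain q \<omega> t where p: "p = (q, \<lambda>c i. t * \<omega> c i)" "(q, \<omega>) \<in> cpt ` A" "0 < t" "t \<le> 1"
      by (auto simp: unit_cone_def)
    then obtain x \<xi> where z: "(q, \<omega>) = cpt (x, \<xi>)" "(x, \<xi>) \<in> A" by auto
    then have "q = vec2 x" "\<omega> = snd (cpt (x, \<xi>))" by (auto simp: cpt_def prod_eq_iff)
    then have "p = cpt (x, t *\<^sub>R \<xi>)" using p(1) sc by simp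
    then show "p \<in> cpt ` {(x, t *\<^sub>R \<xi>) | x \<xi> t. (x, \<xi>) \<in> A \<and> 0 < t \<and> t \<le> 1}"
      using z(2) p(3,4) by blast
  next
    fix p assume "p \<in> cpt ` {(x, t *\<^sub>R \<xi>) | x \<xi> t. (x, \<xi>) \<in> A \<and> 0 < t \<and> t \<le> 1}"
    then obtain x \<xi> t where p: "p = cpt (x, t *\<^sub>R \<xi>)" "(x, \<xi>) \<in> A" "0 < t" "t \<le> 1" by blast
    have "(vec2 x, snd (cpt (x, \<xi>))) \<in> cpt ` A"
      using p(2) by (intro image_eqI[of _ _ "(x, \<xi>)"]) (auto simp: cpt_def)
    then show "p \<in> unit_cone (cpt ` A)"
      unfolding unit_cone_def p(1) sc[symmetric] using p(3,4) by blast
  qed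
  also have "{(x, t *\<^sub>R \<xi>) | x \<xi> t. (x, \<xi>) \<in> A \<and> 0 < t \<and> t \<le> 1} = cone A"
  proof (intro equalityI subsetI)
    fix p assume "p \<in> {(x, t *\<^sub>R \<xi>) | x \<xi> t. (x, \<xi>) \<in> A \<and> 0 < t \<and> t \<le> 1}"
    then obtain x \<xi> t where p: "p = (x, t *\<^sub>R \<xi>)" "(x, \<xi>) \<in> A" "0 < t" "t \<le> 1" by blast
    then have u: "(x, \<xi>) \<in> unit_sphere" using assms by blast
    then have "speed p = t" using p by (simp add: p(1) unit_sphere_def speed_def)
    then show "p \<in> cone A"
      using p u rescale_unit_sphere[OF u] rescale_scaled[OF p(3), of x \<xi>]
      by (simp add: cone_def unit_sphere_def)
  next
    fix p assume p: "p \<in> cone A"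
    then have "p = (fst (rescale p), speed p *\<^sub>R snd (rescale p))"
      using speed_pos[of p] by (simp add: cone_def rescale_def)
    then show "p \<in> {(x, t *\<^sub>R \<xi>) | x \<xi> t. (x, \<xi>) \<in> A \<and> 0 < t \<and> t \<le> 1}"
      using p speed_pos[of p] unfolding cone_def by (smt (verit) mem_Collect_eq prod.collapse)
  qed
  finally show ?thesis by (simp add: image_image bundle_coords_plane)
qed

lemma measurable_G [measurable]: "G \<in> borel_measurable borel"
  by (intro borel_measurable_continuous_onI G_continuous)

lemma measurable_speed [measurable]: "speed \<in> borel_measurable borel"
  unfolding speed_def[abs_def] borel_prod[symmetric] by measurable

lemma measurable_rescale [measurable]: "rescale \<in> borel_measurable borel"
  unfolding rescale_def[abs_def] speed_def[abs_def] borel_prod[symmetric] by measurable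

lemma borel_unit_sphere: "unit_sphere \<in> sets borel"
proof -
  have [measurable]: "snd \<in> borel_measurable (borel :: phase measure)"
    unfolding borel_prod[symmetric] by measurable
  have "{z \<in> space borel. snd z \<noteq> 0 \<and> speed z = 1} \<in> sets borel" by measurable
  then show ?thesis by (simp add: unit_sphere_def)
qed

lemma borel_cone_top: "{z :: phase. snd z \<noteq> 0 \<and> speed z \<le> 1} \<in> sets borel"
proof -
  have [measurable]: "snd \<in> borel_measurable (borel :: phase measure)"
    unfolding borel_prod[symmetric] by measurable
  have "{z \<in> space borel. snd z \<noteq> 0 \<and> speed z \<le> 1} \<in> sets borel" by measurable
  then show ?thesis by simp
qed

lemma borel_cone:
  assumes "A \<in> sets borel"
  shows "cone A \<in> sets borel"
proof -
  have "cone A = {z. snd z \<noteq> 0 \<and> speed z \<le> 1} \<inter> rescale -` A" by (auto simp: cone_def)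
  then show ?thesis
    using borel_cone_top measurable_sets[OF measurable_rescale assms] by auto
qed

text \<open>
  The volume of cones, pushed forward to the cosphere bundle along the radial projection; the factor
  \<open>2\<close> is the dimension of the plane.
\<close>

definition sphere_measure :: "phase measure" where
  "sphere_measure = distr (restrict_space (scale_measure 2 (distr (lebesgue_Rn 4) borel phase_of))
     {z. snd z \<noteq> 0 \<and> speed z \<le> 1}) (restrict_space borel unit_sphere) rescale"

lemma space_sphere_measure [simp]: "space sphere_measure = unit_sphere"
  by (simp add: sphere_measure_def space_restrict_space)

lemma sets_sphere_measure: "A \<in> sets sphere_measure \<longleftrightarrow> A \<subseteq> unit_sphere \<and> A \<in> sets borel"
  using borel_unit_sphere by (auto simp: sphere_measure_def sets_restrict_space_iff)

lemma emeasure_sphere_measure: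
  assumes "A \<in> sets sphere_measure"
  shows "emeasure sphere_measure A = 2 * emeasure (lebesgue_Rn 4) (vec4 ` cone A)"
proof -
  let ?S = "scale_measure 2 (distr (lebesgue_Rn 4) borel phase_of)"
  let ?C = "{z :: phase. snd z \<noteq> 0 \<and> speed z \<le> 1}"
  have A: "A \<subseteq> unit_sphere" "A \<in> sets borel" using assms by (auto simp: sets_sphere_measure)
  have resc: "rescale \<in> measurable (restrict_space ?S ?C) (restrict_space borel unit_sphere)"
    using speed_rescale
    by (intro measurable_restrict_space3) (auto simp: unit_sphere_def intro: measurable_restrict_space1)
  have eq: "rescale -` A \<inter> space (restrict_space ?S ?C) = cone A"
    by (auto simp: cone_def space_restrict_space space_scale_measure)
  have bc: "cone A \<in> sets borel" using A(2) by (rule borel_cone)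
  have mp: "phase_of \<in> measurable (lebesgue_Rn 4) borel"
    using borel_measurable_continuous_onI[OF continuous_phase_of]
    by (simp cong: measurable_cong_sets)
  have "emeasure sphere_measure A = emeasure (restrict_space ?S ?C) (cone A)"
    unfolding sphere_measure_def eq[symmetric] using resc A
    by (intro emeasure_distr) (auto simp: sets_restrict_space_iff borel_unit_sphere)
  also have "\<dots> = emeasure ?S (cone A)"
    using borel_cone_top by (intro emeasure_restrict_space) (auto simp: cone_def)
  also have "\<dots> = 2 * emeasure (lebesgue_Rn 4) (phase_of -` cone A)"
    using bc mp sets_eq_imp_space_eq[OF sets_lebesgue_Rn, of 4]
    by (simp add: emeasure_scale_measure emeasure_distr)
  also have "emeasure (lebesgue_Rn 4) (phase_of -` cone A) = emeasure (lebesgue_Rn 4) (vec4 ` cone A)"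
    unfolding vec4_image
    using measurable_sets[OF mp bc] sets_eq_imp_space_eq[OF sets_lebesgue_Rn, of 4]
    by (subst emeasure_lebesgue_Rn_Int) auto
  finally show ?thesis .
qed

definition liouville :: "coord cpoint measure" where
  "liouville = embed_measure sphere_measure cpt"

lemma inj_cpt: "inj_on cpt S" by (simp add: inj_on_def)

lemma sets_liouville: "sets liouville = {cpt ` A | A. A \<in> sets sphere_measure}"
  unfolding liouville_def by (simp add: sets_embed_measure' inj_cpt)

lemma emeasure_liouville:
  assumes "A \<in> sets sphere_measure"
  shows "emeasure liouville (cpt ` A) = 2 * emeasure (lebesgue_Rn 4) (vec4 ` cone A)"
proof -
  have "cpt -` cpt ` A \<inter> space sphere_measure = A"
    using assms by (auto simp: sets_sphere_measure)
  then show ?thesis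
    unfolding liouville_def using assms
    by (subst emeasure_embed_measure') (auto simp: inj_cpt sets_embed_measure' emeasure_sphere_measure)
qed

lemma liouville_measure_plane: "liouville_measure plane liouville"
proof -
  have sp: "space liouville = cosphere plane"
    by (simp add: liouville_def space_embed_measure cosphere_plane)
  have "sets liouville = {B. B \<subseteq> cosphere plane \<and>
      (\<exists>c\<in>atlas plane. fst ` B \<subseteq> fst c \<and> bundle_coords plane c ` B \<in> sets borel)}"
  proof (intro equalityI subsetI)
    fix B assume "B \<in> sets liouville"
    then obtain A where A: "B = cpt ` A" "A \<subseteq> unit_sphere" "A \<in> sets borel"
      unfolding sets_liouville sets_sphere_measure by blast
    then show "B \<in> {B. B \<subseteq> cosphere plane \<and>
      (\<exists>c\<in>atlas plane. fst ` B \<subseteq> fst c \<and> bundle_coords plane c ` B \<in> sets borel)}"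
      by (auto simp: cosphere_plane image_image bundle_coords_plane borel_vec4_image)
  next
    fix B assume "B \<in> {B. B \<subseteq> cosphere plane \<and>
      (\<exists>c\<in>atlas plane. fst ` B \<subseteq> fst c \<and> bundle_coords plane c ` B \<in> sets borel)}"
    then have B: "B \<subseteq> cpt ` unit_sphere" "bundle_coords plane chart0 ` B \<in> sets borel"
      by (auto simp: cosphere_plane)
    then obtain A where A: "A \<subseteq> unit_sphere" "B = cpt ` A" by (auto simp: subset_image_iff)
    then have "A \<in> sets borel" using B(2) by (simp add: image_image bundle_coords_plane borel_vec4_image)
    then show "B \<in> sets liouville" unfolding sets_liouville sets_sphere_measure using A by blast
  qed
  then have "sets liouville = sigma_sets (cosphere plane) {B. B \<subseteq> cosphere plane \<and>
      (\<exists>c\<in>atlas plane. fst ` B \<subseteq> fst c \<and> bundle_coords plane c ` B \<in> sets borel)}"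
    using sets.sigma_sets_eq[of liouville] sp by metis
  moreover have "emeasure liouville B = of_nat (mdim plane) *
      emeasure (lebesgue_Rn (2 * mdim plane)) (bundle_coords plane chart0 ` unit_cone B)"
    if "B \<in> sets liouville" for B
  proof -
    from that obtain A where A: "B = cpt ` A" "A \<in> sets sphere_measure"
      unfolding sets_liouville by blast
    then have "A \<subseteq> unit_sphere" by (simp add: sets_sphere_measure)
    then show ?thesis using emeasure_liouville[OF A(2)] unit_cone_plane by (simp add: A(1))
  qed
  ultimately show ?thesis unfolding liouville_measure_def using sp by simp
qed

text \<open>
  The cone over \<open>A\<close> contains the nonempty open set of all covectors of length less than \<open>1\<close> whose
  normalization lies in \<open>U\<close>.
\<close>

lemma positive_measure_region:
  assumes "A \<in> sets borel" "A \<subseteq> unit_sphere" "open U" "\<exists>z. snd z \<noteq> 0 \<and> rescale z \<in> U"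
    "unit_sphere \<inter> U \<subseteq> A"
  shows "positive_measure liouville (cpt ` A)"
proof -
  have A: "A \<in> sets sphere_measure" using assms by (simp add: sets_sphere_measure)
  then have cA: "cpt ` A \<in> sets liouville" by (auto simp: sets_liouville)
  define W where "W = {z. snd z \<noteq> 0 \<and> rescale z \<in> U} \<inter> {z. norm (snd z) < sqrt (G (fst z))}"
  have "open W"
    unfolding W_def
    by (intro open_Int open_rescale_vimage assms open_Collect_less continuous_intros
        continuous_on_compose2[OF G_continuous]) auto
  moreover have "W \<noteq> {}"
  proof -
    obtain z where z: "snd z \<noteq> 0" "rescale z \<in> U" using assms(4) by blast
    define t where "t = 1 / (2 * speed z)"
    have t: "t > 0" using speed_pos[OF z(1)] by (simp add: t_def)
    have "(fst z, t *\<^sub>R snd z) \<in> W"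
      using z t rescale_scaled[OF t, of "fst z" "snd z"] G_pos[of "fst z"]
      by (simp add: W_def t_def speed_def field_simps)
    then show ?thesis by blast
  qed
  ultimately have pos: "emeasure (lebesgue_Rn 4) (vec4 ` W) > 0"
    by (intro emeasure_lebesgue_Rn_open openin_vec4_image) auto
  have "W \<subseteq> cone A"
    using assms(5) speed_rescale G_pos
    by (auto simp: W_def cone_def unit_sphere_def speed_def)
  moreover have "cone A \<in> sets borel" using assms(1) by (rule borel_cone)
  ultimately have "emeasure (lebesgue_Rn 4) (vec4 ` W) \<le> emeasure (lebesgue_Rn 4) (vec4 ` cone A)"
    by (intro emeasure_mono image_mono) (auto simp: borel_vec4_image)
  then have "emeasure liouville (cpt ` A) > 0"
    unfolding emeasure_liouville[OF A] using pos by (simp add: ennreal_zero_less_mult_iff order.strict_trans2)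
  then show ?thesis
    unfolding positive_measure_def using cA by (simp add: emeasure_completion main_part)
qed

end

section \<open>Absolutely periodic and nonperiodic points\<close>

lemma partial_derivs_0: "partial_derivs is (\<lambda>_. 0) = (\<lambda>_. 0)"
  by (induction "is") (auto simp: partial_deriv_def)

lemma smooth_on_0: "smooth_on N D (\<lambda>_. 0)"
  using smooth_on_ridge[of "{} :: nat set" "\<lambda>_ _ _. 0" N D "\<lambda>_ _. 0"] by simp

lemma infinite_order_zero_locally_0:
  assumes "openin (Euclidean_space N) D" "x \<in> D" "\<And>y. y \<in> D \<Longrightarrow> u y = 0"
  shows "infinite_order_zero N u x"
  unfolding infinite_order_zero_def
proof (intro conjI exI[of _ D] allI impI assms(1,2))
  show "smooth_on N D u"
    using assms(3) by (intro smooth_on_cong[OF assms(1) _ smooth_on_0]) auto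
  show "partial_derivs is u x = 0" if "set is \<subseteq> {..<N}" for "is"
    using partial_derivs_cong[of N D u "\<lambda>_. 0" "is" x] assms that by (simp add: partial_derivs_0)
qed

text \<open>
  Let \<open>S\<close> be the union of all open sets on which \<open>u\<close> is smooth. Each partial
  derivative is locally continuous on \<open>S\<close>, so the set of its zeros is \<open>S\<close> minus an open set, and there
  are countably many partial derivatives.
\<close>

lemma borel_infinite_order_zero: "{x. infinite_order_zero N u x} \<in> sets borel"
proof -
  define S where "S = \<Union>{D. openin (Euclidean_space N) D \<and> smooth_on N D u}"
  have S: "openin (Euclidean_space N) S" unfolding S_def by (intro openin_Union) auto
  have nz: "openin (Euclidean_space N) {x \<in> S. partial_derivs is u x \<noteq> 0}" if is': "set is \<subseteq> {..<N}" for "is"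
    unfolding openin_subopen[of _ "{x \<in> S. partial_derivs is u x \<noteq> 0}"]
  proof
    fix x assume x: "x \<in> {x \<in> S. partial_derivs is u x \<noteq> 0}"
    then obtain D where D: "openin (Euclidean_space N) D" "smooth_on N D u" "x \<in> D"
      by (auto simp: S_def)
    let ?X = "subtopology (Euclidean_space N) D"
    have top: "topspace ?X = D" using openin_subset[OF D(1)] by auto
    have "continuous_map ?X euclideanreal (partial_derivs is u)"
      using D(2) is' by (auto simp: smooth_on_def)
    then have "openin ?X {y \<in> topspace ?X. partial_derivs is u y \<in> - {0}}"
      by (rule openin_continuous_map_preimage) auto
    then have "openin (Euclidean_space N) {y \<in> D. partial_derivs is u y \<in> - {0}}"
      unfolding top using D(1) by (rule openin_trans_full)
    moreover have "D \<subseteq> S" using D by (auto simp: S_def)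
    ultimately show "\<exists>T. openin (Euclidean_space N) T \<and> x \<in> T \<and>
        T \<subseteq> {x \<in> S. partial_derivs is u x \<noteq> 0}"
      using D(3) x by (intro exI[of _ "{y \<in> D. partial_derivs is u y \<in> - {0}}"]) auto
  qed
  have "{x. infinite_order_zero N u x} =
      (\<Inter>is\<in>lists {..<N}. S - {x \<in> S. partial_derivs is u x \<noteq> 0})"
  proof (intro equalityI subsetI)
    fix x assume "x \<in> {x. infinite_order_zero N u x}"
    then show "x \<in> (\<Inter>is\<in>lists {..<N}. S - {x \<in> S. partial_derivs is u x \<noteq> 0})"
      unfolding infinite_order_zero_def S_def lists_eq_set by blast
  next
    fix x assume x: "x \<in> (\<Inter>is\<in>lists {..<N}. S - {x \<in> S. partial_derivs is u x \<noteq> 0})"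
    have "[] \<in> lists {..<N}" by simp
    then have "x \<in> S" using x by blast
    moreover have "partial_derivs is u x = 0" if "set is \<subseteq> {..<N}" for "is"
      using x that unfolding lists_eq_set by blast
    ultimately show "x \<in> {x. infinite_order_zero N u x}"
      unfolding infinite_order_zero_def S_def by blast
  qed
  also have "\<dots> \<in> sets borel"
  proof (rule sets.countable_INT')
    show "countable (lists {..<N})" by simp
    show "lists {..<N} \<noteq> {}" using lists.Nil by blast
    show "(\<lambda>is. S - {x \<in> S. partial_derivs is u x \<noteq> 0}) ` lists {..<N} \<subseteq> sets borel"
      using borel_openin_Euclidean[OF S] borel_openin_Euclidean[OF nz] by (auto simp: lists_eq_set)
  qed
  finally show ?thesis .
qed

context oscillator
begin

lemma displacement_plane:
  assumes "snd z \<noteq> 0"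
  shows "displacement plane flow chart0 T (vec4 z) = (\<Sum>i<4. (vec4 (geo T z) i - vec4 z i)\<^sup>2)"
  unfolding displacement_def by (simp add: bundle_point_plane[OF assms] bundle_coords_plane)

lemma displacement_eq_0_iff:
  assumes "snd z \<noteq> 0"
  shows "displacement plane flow chart0 T (vec4 z) = 0 \<longleftrightarrow> geo T z = z"
proof
  assume "displacement plane flow chart0 T (vec4 z) = 0"
  then have "\<forall>i\<in>{..<4}. (vec4 (geo T z) i - vec4 z i)\<^sup>2 = 0"
    unfolding displacement_plane[OF assms] by (subst (asm) sum_nonneg_eq_0_iff) auto
  then have "vec4 (geo T z) i = vec4 z i" if "i < 4" for i using that by simp
  moreover have "vec4 (geo T z) i = vec4 z i" if "\<not> i < 4" for i
    using that vec4_in[of "geo T z"] vec4_in[of z] by (simp add: topspace_Euclidean_space)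
  ultimately have "vec4 (geo T z) = vec4 z" by blast
  then show "geo T z = z" by simp
qed (simp add: displacement_plane[OF assms])

text \<open>
  The zero of the displacement already says that the trajectory is periodic.
\<close>

lemma absolutely_periodic_set_plane:
  "absolutely_periodic_set plane flow T =
    cpt ` {z \<in> unit_sphere. infinite_order_zero 4 (displacement plane flow chart0 T) (vec4 z)}"
proof -
  have "absolutely_periodic plane flow T (cpt z) \<longleftrightarrow>
      infinite_order_zero 4 (displacement plane flow chart0 T) (vec4 z)" if "z \<in> unit_sphere" for z
  proof -
    have z: "snd z \<noteq> 0" using that by (simp add: unit_sphere_def)
    have "T_periodic flow T (cpt z)"
      if "infinite_order_zero 4 (displacement plane flow chart0 T) (vec4 z)"
    proof -
      have "partial_derivs [] (displacement plane flow chart0 T) (vec4 z) = 0"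
        using that unfolding infinite_order_zero_def by (metis empty_set empty_subsetI)
      then show ?thesis using displacement_eq_0_iff[OF z] by (simp add: T_periodic_def)
    qed
    then show ?thesis by (auto simp: absolutely_periodic_def bundle_coords_plane)
  qed
  then show ?thesis unfolding absolutely_periodic_set_def cosphere_plane by auto
qed

text \<open>
  Near an elliptic point all points are elliptic, and there the displacement at time \<open>\<pi>\<close> is \<open>0\<close>.
\<close>

lemma absolutely_periodic_positive:
  "positive_measure liouville (absolutely_periodic_set plane flow pi)"
  unfolding absolutely_periodic_set_plane
proof (rule positive_measure_region[OF _ _ open_elliptic elliptic_nonempty])
  let ?Z = "{w. infinite_order_zero 4 (displacement plane flow chart0 pi) w}"
  have "vec4 \<in> borel_measurable borel"
    by (intro borel_measurable_continuous_onI continuous_vec4)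
  from measurable_sets[OF this borel_infinite_order_zero]
  have "vec4 -` ?Z \<in> sets borel" by simp
  then have "unit_sphere \<inter> vec4 -` ?Z \<in> sets borel" using borel_unit_sphere by blast
  then show "{z \<in> unit_sphere. infinite_order_zero 4 (displacement plane flow chart0 pi) (vec4 z)} \<in> sets borel"
    by (simp add: vimage_def Int_def)
  show "unit_sphere \<inter> elliptic \<subseteq>
      {z \<in> unit_sphere. infinite_order_zero 4 (displacement plane flow chart0 pi) (vec4 z)}"
  proof
    fix z assume z: "z \<in> unit_sphere \<inter> elliptic"
    let ?D = "{z. snd z \<noteq> 0 \<and> rescale z \<in> elliptic}"
    have "infinite_order_zero 4 (displacement plane flow chart0 pi) (vec4 z)"
    proof (rule infinite_order_zero_locally_0)
      show "openin (Euclidean_space 4) (vec4 ` ?D)"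
        by (intro openin_vec4_image open_rescale_vimage open_elliptic)
      show "vec4 z \<in> vec4 ` ?D"
        using z rescale_unit_sphere[of z] by (simp add: unit_sphere_def inj_image_mem_iff inj_def)
      show "displacement plane flow chart0 pi y = 0" if "y \<in> vec4 ` ?D" for y
        using that geo_elliptic displacement_eq_0_iff by auto
    qed
    then show "z \<in> {z \<in> unit_sphere. infinite_order_zero 4 (displacement plane flow chart0 pi) (vec4 z)}"
      using z by simp
  qed
qed auto

lemma nonperiodic_positive:
  "positive_measure liouville (cosphere plane - periodic_set plane flow)"
proof -
  have per: "periodic flow (cpt z) \<longleftrightarrow> (\<exists>t>0. geo t z = z)" for z
    by (simp add: periodic_def T_periodic_def)
  have newton: "(\<exists>t>0. geo t z = z) \<longleftrightarrow> (\<exists>t>0. newton z t = z)" if "z \<in> unit_sphere" for z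
    using geo_periodic_iff[of z] rescale_unit_sphere[OF that] that by (simp add: unit_sphere_def)
  have eq: "cosphere plane - periodic_set plane flow = cpt ` (unit_sphere - {z. \<exists>t>0. newton z t = z})"
    unfolding cosphere_plane periodic_set_def using newton by (auto simp: per)
  show ?thesis
    unfolding eq
  proof (rule positive_measure_region[OF _ _ open_escaping escaping_nonempty])
    show "unit_sphere - {z. \<exists>t>0. newton z t = z} \<in> sets borel"
      using borel_unit_sphere borel_periodic by blast
    show "unit_sphere \<inter> escaping \<subseteq> unit_sphere - {z. \<exists>t>0. newton z t = z}"
    proof
      fix z assume z: "z \<in> unit_sphere \<inter> escaping"
      then have "\<not> (\<exists>t>0. geo t z = z)"
        using rescale_unit_sphere[of z] by (intro geo_escaping) (auto simp: unit_sphere_def)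
      then show "z \<in> unit_sphere - {z. \<exists>t>0. newton z t = z}" using z newton[of z] by auto
    qed
  qed auto
qed

lemma nonperiodic_exists: "\<exists>z\<in>cotangent_nz plane. \<not> periodic flow z"
proof -
  obtain z where z: "snd z \<noteq> 0" "rescale z \<in> escaping" using escaping_nonempty by blast
  have "\<not> periodic flow (cpt z)"
    using geo_escaping[OF z] by (simp add: periodic_def T_periodic_def)
  then show ?thesis unfolding cotangent_nz_plane using z(1) by blast
qed

end

section \<open>The Carleman class of the metric\<close>

locale carleman_oscillator = carleman m + oscillator "Q 0" "Q 1" K
  for m and Q :: "nat \<Rightarrow> real \<Rightarrow> real" and K +
  assumes Q_jet: "\<And>t. jet_at Q t" and Q_bounded: "bounded_jets Q UNIV"
begin

lemma carleman_class_G: "carleman_class m 2 D (\<lambda>x. G (cpx x))"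
proof -
  obtain B C where C: "C \<ge> 0" "\<And>t. bounded_jet B C Q t"
    using Q_bounded unfolding bounded_jets_def by blast
  define c where "c k i = vec2 (hexdir k) i" for k i
  have "carleman_class m 2 D (\<lambda>x. \<Sum>k\<in>{..<3::nat}. Q 0 (lin 2 (c k) x))"
  proof (rule carleman_class_ridge[where F = "\<lambda>_. Q" and C = C])
    show "\<bar>Q n t\<bar> \<le> C ^ n * m n" if "n \<ge> 1" for n t
      using C(2)[of t] that by (simp add: bounded_jet_def)
    show "\<bar>c k i\<bar> \<le> 1" for k i
      using abs_Re_le_cmod[of "hexdir k"] abs_Im_le_cmod[of "hexdir k"] norm_hexdir[of k]
      by (simp add: c_def vec2_def)
  qed (use C Q_jet in auto)
  moreover have "lin 2 (c k) x = hexdir k \<bullet> cpx x" for k x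
    by (simp add: lin_def c_def vec2_def cpx_def inner_complex_def sum_lessThan_2)
  ultimately show ?thesis by (simp add: G_def)
qed

lemma carleman_manifold_plane: "carleman_manifold m plane"
proof -
  have "is_chart 2 (Euclidean_space 2) chart0"
    by (simp add: is_chart_def homeomorphic_map_involution subtopology_topspace)
  moreover have "carleman_class m 2 (topspace (Euclidean_space 2)) (\<lambda>x. transition chart0 chart0 x k)"
    if "k < 2" for k
    by (rule carleman_class_cong[OF _ carleman_class_coordinate[OF that]]) (simp add: transition_chart0)
  ultimately show ?thesis
    unfolding carleman_manifold_def
    by (simp add: Hausdorff_Euclidean_space second_countable_Euclidean_space connected_Euclidean_space)
qed

lemma carleman_metric_plane: "carleman_metric m plane"
proof -
  have pos: "0 < (\<Sum>i<2. \<Sum>j<2. (if i = j then G (cpx x) else 0) * v i * v j)"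
    if v: "\<exists>i<2. v i \<noteq> 0" for x and v :: coord
  proof -
    have "(\<Sum>i<2. \<Sum>j<2. (if i = j then G (cpx x) else 0) * v i * v j) = G (cpx x) * ((v 0)\<^sup>2 + (v 1)\<^sup>2)"
      by (simp add: sum_lessThan_2 power2_eq_square algebra_simps)
    moreover have "(v 0)\<^sup>2 + (v 1)\<^sup>2 > 0"
      using v by (auto simp: less_2_cases_iff sum_power2_gt_zero_iff)
    ultimately show ?thesis using G_pos by simp
  qed
  have trans: "(if i = j then G (cpx x) else 0) =
      (\<Sum>k<2. \<Sum>l<2. jacobian chart0 chart0 x k i * jacobian chart0 chart0 x l j *
        (if k = l then G (cpx (transition chart0 chart0 x)) else 0))"
    if "x \<in> topspace (Euclidean_space 2)" "i < 2" "j < 2" for x i j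
    using that by (auto simp: sum_lessThan_2 jacobian_chart0 transition_chart0 less_2_cases_iff)
  have coeff: "carleman_class m 2 D (\<lambda>x. if i = j then G (cpx x) else 0)" for D and i j :: nat
    using carleman_class_G carleman_class_0 by (cases "i = j") auto
  show ?thesis
    unfolding carleman_metric_def Let_def plane_simps singleton_iff ball_simps chart0_simps
      image_ident Int_absorb
  proof (intro conjI ballI allI impI)
    fix x and i j :: nat assume "x \<in> topspace (Euclidean_space 2)" "i < 2" "j < 2"
    then show "(if i = j then G (cpx x) else 0) =
      (\<Sum>k<2. \<Sum>l<2. jacobian chart0 chart0 x k i * jacobian chart0 chart0 x l j *
        (if k = l then G (cpx (transition chart0 chart0 x)) else 0))"
      by (rule trans)
  qed (use pos coeff in \<open>auto split: if_splits\<close>)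
qed

end

theorem theorem4p7:
  fixes m :: "nat \<Rightarrow> real"
  assumes "carleman_sequence m"
    and "\<not> quasianalytic m"
  shows "\<exists>(M :: (nat \<Rightarrow> real) rmanifold) \<Phi> \<mu>.
           riemannian_carleman_manifold m M \<and> geodesic_flow M \<Phi> \<and> liouville_measure M \<mu> \<and>
           (\<exists>T>0. positive_measure \<mu> (absolutely_periodic_set M \<Phi> T)) \<and>
           (\<exists>z\<in>cotangent_nz M. \<not> periodic \<Phi> z) \<and>
           positive_measure \<mu> (cosphere M - periodic_set M \<Phi>)"
proof -
  interpret carleman m by unfold_locales (rule assms(1))
  obtain Q where Q: "\<And>t. jet_at Q t" "bounded_jets Q UNIV"
    "\<And>t. \<bar>t\<bar> \<le> 3/4 \<Longrightarrow> Q 0 t = 1/3 - 2/3 * t\<^sup>2" "\<And>t. \<bar>t\<bar> \<ge> 4/5 \<Longrightarrow> Q 0 t = 1"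
    "\<And>t. 1/3 - 2/3 * t\<^sup>2 \<le> Q 0 t"
    by (rule oscillator_profile[OF assms(2)]) (rule that)
  obtain B C where C: "\<And>t. bounded_jet B C Q t" using Q(2) unfolding bounded_jets_def by blast
  \<comment> \<open>The Carleman bound on the second derivative is a Lipschitz constant for the first.\<close>
  define K where "K = C\<^sup>2 * m 2"
  have lip: "\<bar>Q 1 s - Q 1 t\<bar> \<le> K * \<bar>s - t\<bar>" for s t
  proof -
    have "norm (Q 1 s - Q 1 t) \<le> K * norm (s - t)"
    proof (rule field_differentiable_bound[of UNIV])
      show "(Q 1 has_real_derivative Q 2 t) (at t within UNIV)" for t
        using Q(1)[of t] unfolding jet_at_def by (metis Suc_1 has_field_derivative_at_within)
      show "norm (Q 2 t) \<le> K" for t using C[of t] by (simp add: bounded_jet_def K_def)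
    qed auto
    then show ?thesis by simp
  qed
  interpret carleman_oscillator m Q K
  proof unfold_locales
    show "(Q 0 has_real_derivative Q 1 t) (at t)" for t using Q(1)[of t] by (simp add: jet_at_def)
  qed (use Q lip in auto)
  show ?thesis
    using carleman_manifold_plane carleman_metric_plane geodesic_flow_plane liouville_measure_plane
      absolutely_periodic_positive nonperiodic_exists nonperiodic_positive pi_gt_zero
    unfolding riemannian_carleman_manifold_def by blast
qed

end
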